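(* Let $\psi$ be one of $\partial_t\phi,\partial_1\phi,\partial_2\phi,\partial_3\phi$ and $\underline{u}\in[0,\delta]$, and let $E^0(t,\underline{u})$, $E^{\prime1}(t,\underline{u})$ be the energies of $\psi$ associated with the multipliers $K_0$ and $K_1$. The limits $\lim_{r_0\to\infty}E^0(-r_0,\underline{u})$ and $\lim_{r_0\to\infty}E^{\prime1}(-r_0,\underline{u})$ both exist, and $$\lim_{r_0\to\infty}E^0(-r_0,\underline{u})\lesssim1,\qquad\lim_{r_0\to\infty}E^{\prime1}(-r_0,\underline{u})\lesssim\delta^2.$$
   Context: Equation and data. $G''(0)\ne0$ is a real constant, $c:=(1+3G''(0)(\partial_t\phi)^2)^{-1/2}$, $r=|x|$, $\Sigma_t=\{t\}\times\mathbb{R}^3$, $r_0$ is an arbitrarily large parameter. $\phi$ is the smooth solution of $-(1+3G''(0)(\partial_t\phi)^2)\partial_t^2\phi+\Delta\phi=0$ with data on $\{t=-r_0,\ r\le r_0+\delta\}$: $\phi=\partial_t\phi=0$ for $r\le r_0$, and $\phi=\frac{\delta^{3/2}}{r_0}\phi_0(\frac{r-r_0}{\delta},\theta)$, $\partial_t\phi=\frac{\delta^{1/2}}{r_0}\phi_1(\frac{r-r_0}{\delta},\theta)$ for $r_0\le r\le r_0+\delta$. Here the seed data $(\phi_1,\phi_2)\in C_0^\infty((0,1]\times\mathbb{S}^2)^2$ are fixed, independent of $\delta,r_0$, and $\phi_0$ (which may depend on $\delta,r_0$) has each $C^k$ norm bounded by a function of the $C^k$ norms of $\phi_1,\phi_2$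 and is such that $|(\partial_t-c\partial_r)\phi|\lesssim\delta^{3/2}r_0^{-2}$, $|(\partial_t-c\partial_r)^2\phi|\lesssim\delta^{3/2}r_0^{-3}$ on $\{t=-r_0,\ r_0\le r\le r_0+\delta\}$ ("no-outgoing-radiation short pulse data"). Geometry. $g=-c^2dt^2+\sum_i(dx^i)^2$, $\widetilde g=c^{-1}g$. $\underline{u}=r-r_0$ on $\Sigma_{-r_0}$; $\underline{C}_{\underline{u}}$ is the incoming $g$-null hypersurface emanating from $\{t=-r_0,r=r_0+\underline{u}\}$, and $\underline{u}$ is extended to be constant on it. $\underline{L}$ is the tangent field of the null generators of $\underline{C}_{\underline{u}}$ with $\underline{L}t=1$; $\mu^{-1}=-(g^{-1})^{\alpha\beta}\partial_\alpha\underline{u}\,\partial_\beta t$; $S_{t,\underline{u}}=\Sigma_t\cap\underline{C}_{\underline{u}}$ with induced metric $\gamma$ (from $g$), area form $d\mu_\gamma$ and exterior differential $d_S$; $\Sigma_t^{\underline{u}}=\bigcup_{0\le\underline{u}'\le\underline{u}}S_{t,\underline{u}'}$. $T$ is tangent to $\Sigma_t$, $g$-orthogonal to $S_{t,\underline{u}}$, with $T\underline{u}=1$; $L=c^{-2}\mu\underline{L}+2T$. (On $\Sigma_{-r_0}$: $T=\partial_r$, $\underline{L}=\partial_t-c\partial_r$, $\mu=c$.) $\widetilde{\mathrm{tr}}\underline\chi$ is the trace, with respect to the metric induced by $\widetilde g$ on $S_{t,\underline{u}}$, of the second fundamental form $\widetilde g(\widetilde\nabla_X\underline{L},Y)$ of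 $S_{t,\underline{u}}$ in $\underline{C}_{\underline{u}}$. Energies, with $\int_{\Sigma_t^{\underline{u}}}f=\int_0^{\underline{u}}\bigl(\int_{S_{t,\underline{u}'}}f\,d\mu_\gamma\bigr)d\underline{u}'$: $$E^0(t,\underline{u})=\int_{\Sigma_t^{\underline{u}}}\frac1{2c}\Bigl((L\psi)^2+c^{-2}\mu(\underline{L}\psi)^2+(\mu+c^{-2}\mu^2)|d_S\psi|^2\Bigr),$$ $$E^{\prime1}(t,\underline{u})=\int_{\Sigma_t^{\underline{u}}}\frac1{2c}\,\frac{4(-t)}{\widetilde{\mathrm{tr}}\underline\chi}\Bigl(c^{-2}\mu\bigl(\underline{L}\psi+\tfrac12\widetilde{\mathrm{tr}}\underline\chi\,\psi\bigr)^2+\mu|d_S\psi|^2\Bigr).$$ They are associated with the multipliers $K_0=L+\underline{L}$ and $K_1=\frac{2(-t)}{\widetilde{\mathrm{tr}}\underline\chi}\underline{L}$. Constants in $\lesssim$ depend only on the seed data, not on $\delta$ or $r_0$. *)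

theory Defs
  imports "HOL-Analysis.Analysis"
begin

type_synonym spacetime = "real \<times> (real^3)"

text \<open>
  \<open>pd X f p\<close> is the derivative of \<open>f\<close> at \<open>p\<close> in the direction \<open>X\<close>. A constant vector \<open>X\<close> gives a
  partial derivative, and \<open>pd (X p) f p\<close> is the action of a vector field \<open>X\<close> on a function \<open>f\<close>.
\<close>

definition pd :: "'a::real_normed_vector \<Rightarrow> ('a \<Rightarrow> 'b::real_normed_vector) \<Rightarrow> 'a \<Rightarrow> 'b" where
  "pd X f p = frechet_derivative f (at p) X"

definition et :: spacetime where "et = (1, 0)"

definition ex :: "3 \<Rightarrow> spacetime" where "ex i = (0, axis i 1)"

text \<open>Smoothness is only used on open sets.\<close>

fun Ck_on :: "nat \<Rightarrow> ('a::euclidean_space \<Rightarrow> real) \<Rightarrow> 'a set \<Rightarrow> bool" where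
  "Ck_on 0 f S = continuous_on S f"
| "Ck_on (Suc k) f S = (f differentiable_on S \<and> (\<forall>b\<in>Basis. Ck_on k (pd b f) S))"

definition Cinf_on :: "('a::euclidean_space \<Rightarrow> real) \<Rightarrow> 'a set \<Rightarrow> bool" where
  "Cinf_on f S \<longleftrightarrow> (\<forall>k. Ck_on k f S)"


section \<open>Functions on the cylinder over the unit sphere\<close>

text \<open>
  A function of \<open>(s, \<theta>)\<close> with \<open>s\<close> in an interval \<open>I\<close> and \<open>\<theta>\<close> in the unit sphere is represented by a
  function on \<^typ>\<open>real \<times> (real^3)\<close> of which only the values on \<open>I \<times> sphere 0 1\<close> matter. It is smooth,
  up to the end points that belong to \<open>I\<close>, if it is the restriction of a smooth function on an open set.
\<close>

definition Cinf_cyl :: "real set \<Rightarrow> (real \<times> (real^3) \<Rightarrow> real) \<Rightarrow> bool" where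
  "Cinf_cyl I f \<longleftrightarrow> (\<exists>F W. open W \<and> I \<times> sphere 0 1 \<subseteq> W \<and> Cinf_on F W \<and>
     (\<forall>p \<in> I \<times> sphere 0 1. F p = f p))"

text \<open>
  Smooth functions with compact support in \<open>(0,1] \<times> S\<^sup>2\<close>, extended by zero to \<open>s = 0\<close>;
  they need not vanish at \<open>s = 1\<close>.
\<close>

definition seed_data :: "(real \<times> (real^3) \<Rightarrow> real) \<Rightarrow> bool" where
  "seed_data f \<longleftrightarrow> Cinf_cyl {0..1} f \<and>
     (\<exists>\<epsilon>>0. \<forall>s\<in>{0..\<epsilon>}. \<forall>\<theta>\<in>sphere 0 1. f (s, \<theta>) = 0)"

text \<open>
  The \<open>C\<^sup>k\<close> norm is taken with respect to the extension of \<open>f\<close> which is homogeneous of degree zero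
  in the second variable, so that only tangential derivatives along the sphere enter. For functions which are
  smooth up to the boundary, the supremum over the open interval equals that over the closed one.
\<close>

definition hom0 :: "(real \<times> (real^3) \<Rightarrow> real) \<Rightarrow> real \<times> (real^3) \<Rightarrow> real" where
  "hom0 f = (\<lambda>(s, x). f (s, x /\<^sub>R norm x))"

definition Ck_norm :: "nat \<Rightarrow> (real \<times> (real^3) \<Rightarrow> real) \<Rightarrow> ereal" where
  "Ck_norm k f =
     (SUP (bs, p) \<in> {bs. set bs \<subseteq> Basis \<and> length bs \<le> k} \<times> ({0<..<1} \<times> sphere 0 1).
        ereal \<bar>foldr pd bs (hom0 f) p\<bar>)"


section \<open>The wave equation and the short pulse data\<close>

text \<open>Throughout, \<open>G\<close> stands for \<open>G''(0)\<close>.\<close>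

definition wave_speed :: "real \<Rightarrow> (spacetime \<Rightarrow> real) \<Rightarrow> spacetime \<Rightarrow> real" where
  "wave_speed G \<phi> p = (1 + 3 * G * (pd et \<phi> p)\<^sup>2) powr (-1/2)"

definition solves_wave_eq :: "real \<Rightarrow> (spacetime \<Rightarrow> real) \<Rightarrow> spacetime set \<Rightarrow> bool" where
  "solves_wave_eq G \<phi> W \<longleftrightarrow> (\<forall>p\<in>W.
     - (1 + 3 * G * (pd et \<phi> p)\<^sup>2) * pd et (pd et \<phi>) p + (\<Sum>i\<in>UNIV. pd (ex i) (pd (ex i) \<phi>) p) = 0)"

text \<open>The first-order operator \<open>\<partial>\<^sub>t - c \<partial>\<^sub>r\<close>.\<close>

definition ingoing :: "real \<Rightarrow> (spacetime \<Rightarrow> real) \<Rightarrow> (spacetime \<Rightarrow> real) \<Rightarrow> spacetime \<Rightarrow> real" where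
  "ingoing G \<phi> f p = pd (1, - wave_speed G \<phi> p *\<^sub>R (snd p /\<^sub>R norm (snd p))) f p"

text \<open>
  Only the germ of the solution at the initial slab matters. The solution on the domain of dependence of
  the slab, smooth up to the boundary, is always the restriction of a smooth solution on an open neighbourhood of
  the slab: extend the data smoothly to \<open>r > r0 + \<delta>\<close> and solve locally, forwards and backwards in time.
\<close>

definition short_pulse_solution ::
  "real \<Rightarrow> real \<Rightarrow> real \<Rightarrow> (real \<times> (real^3) \<Rightarrow> real) \<Rightarrow> (real \<times> (real^3) \<Rightarrow> real) \<Rightarrow>
   (spacetime \<Rightarrow> real) \<Rightarrow> bool" where
  "short_pulse_solution G \<delta> r0 \<phi>0 \<phi>1 \<phi> \<longleftrightarrow>
     (\<exists>W. open W \<and> {-r0} \<times> cball 0 (r0 + \<delta>) \<subseteq> W \<and> Cinf_on \<phi> W \<and> solves_wave_eq G \<phi> W) \<and>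
     (\<forall>x. norm x \<le> r0 \<longrightarrow> \<phi> (-r0, x) = 0 \<and> pd et \<phi> (-r0, x) = 0) \<and>
     (\<forall>x. r0 \<le> norm x \<and> norm x \<le> r0 + \<delta> \<longrightarrow>
        \<phi> (-r0, x) = \<delta> powr (3/2) / r0 * \<phi>0 ((norm x - r0) / \<delta>, x /\<^sub>R norm x) \<and>
        pd et \<phi> (-r0, x) = \<delta> powr (1/2) / r0 * \<phi>1 ((norm x - r0) / \<delta>, x /\<^sub>R norm x))"

text \<open>
  \<open>A\<close> is the constant implicit in the two pointwise bounds; \<open>B k\<close> is the function of the norms
  of the seed data which bounds the \<open>C\<^sup>k\<close> norm of \<open>\<phi>0\<close>.
\<close>

definition no_outgoing_radiation ::
  "real \<Rightarrow> real \<Rightarrow> (nat \<Rightarrow> (nat \<Rightarrow> ereal) \<Rightarrow> (nat \<Rightarrow> ereal) \<Rightarrow> real) \<Rightarrow> real \<Rightarrow> real \<Rightarrow>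
   (real \<times> (real^3) \<Rightarrow> real) \<Rightarrow> (real \<times> (real^3) \<Rightarrow> real) \<Rightarrow> (real \<times> (real^3) \<Rightarrow> real) \<Rightarrow>
   (spacetime \<Rightarrow> real) \<Rightarrow> bool" where
  "no_outgoing_radiation G A B \<delta> r0 \<phi>0 \<phi>1 \<phi>2 \<phi> \<longleftrightarrow>
     Cinf_cyl {0..1} \<phi>0 \<and>
     (\<forall>k. Ck_norm k \<phi>0 \<le> ereal (B k (\<lambda>j. Ck_norm j \<phi>1) (\<lambda>j. Ck_norm j \<phi>2))) \<and>
     (\<forall>x. r0 \<le> norm x \<and> norm x \<le> r0 + \<delta> \<longrightarrow>
        \<bar>ingoing G \<phi> \<phi> (-r0, x)\<bar> \<le> A * \<delta> powr (3/2) / r0^2 \<and>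
        \<bar>ingoing G \<phi> (ingoing G \<phi> \<phi>) (-r0, x)\<bar> \<le> A * \<delta> powr (3/2) / r0^3)"


section \<open>The geometry\<close>

text \<open>The Levi-Civita connection of a metric \<open>h\<close>, paired with a vector: \<open>h (\<nabla>\<^sub>X V) Z\<close>.\<close>

definition christoffel ::
  "(spacetime \<Rightarrow> spacetime \<Rightarrow> spacetime \<Rightarrow> real) \<Rightarrow> spacetime \<Rightarrow> spacetime \<Rightarrow> spacetime \<Rightarrow> spacetime \<Rightarrow> real" where
  "christoffel h p X Y Z =
     1/2 * (pd X (\<lambda>q. h q Y Z) p + pd Y (\<lambda>q. h q X Z) p - pd Z (\<lambda>q. h q X Y) p)"

definition levi_civita ::
  "(spacetime \<Rightarrow> spacetime \<Rightarrow> spacetime \<Rightarrow> real) \<Rightarrow> (spacetime \<Rightarrow> spacetime) \<Rightarrow>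
   spacetime \<Rightarrow> spacetime \<Rightarrow> spacetime \<Rightarrow> real" where
  "levi_civita h V p X Z = h p (pd X V p) Z + christoffel h p X (V p) Z"

text \<open>
  The trace of a bilinear form \<open>k\<close> on a two-dimensional space \<open>V\<close> with respect to an inner
  product \<open>h\<close>, computed in any orthonormal basis.
\<close>

definition trace2 ::
  "(spacetime \<Rightarrow> spacetime \<Rightarrow> real) \<Rightarrow> spacetime set \<Rightarrow> (spacetime \<Rightarrow> spacetime \<Rightarrow> real) \<Rightarrow> real" where
  "trace2 h V k = (THE s. \<exists>e1\<in>V. \<exists>e2\<in>V. h e1 e1 = 1 \<and> h e2 e2 = 1 \<and> h e1 e2 = 0 \<and>
     s = k e1 e1 + k e2 e2)"

definition sph :: "real \<times> real \<Rightarrow> real^3" where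
  "sph = (\<lambda>(\<theta>, \<omega>). vector [sin \<theta> * cos \<omega>, sin \<theta> * sin \<omega>, cos \<theta>])"

context
  fixes G :: real and \<phi> :: "spacetime \<Rightarrow> real"
begin

definition gmet :: "spacetime \<Rightarrow> spacetime \<Rightarrow> spacetime \<Rightarrow> real" where
  "gmet p X Y = - (wave_speed G \<phi> p)\<^sup>2 * fst X * fst Y + snd X \<bullet> snd Y"

definition gtilde :: "spacetime \<Rightarrow> spacetime \<Rightarrow> spacetime \<Rightarrow> real" where
  "gtilde p X Y = gmet p X Y / wave_speed G \<phi> p"

text \<open>\<open>(g\<^sup>-\<^sup>1)\<^sup>\<alpha>\<^sup>\<beta> \<partial>\<^sub>\<alpha> a \<partial>\<^sub>\<beta> b\<close>.\<close>

definition ginv :: "(spacetime \<Rightarrow> real) \<Rightarrow> (spacetime \<Rightarrow> real) \<Rightarrow> spacetime \<Rightarrow> real" where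
  "ginv a b p = - pd et a p * pd et b p / (wave_speed G \<phi> p)\<^sup>2 + (\<Sum>i\<in>UNIV. pd (ex i) a p * pd (ex i) b p)"

context
  fixes u :: "spacetime \<Rightarrow> real"  \<comment> \<open>the optical function, written \<open>u\<close> with an underline on paper\<close>
begin

text \<open>
  The level sets of \<open>u\<close> are null hypersurfaces. As \<open>\<partial>\<^sub>r u = 1\<close> on the initial slice, the sign of
  \<open>\<partial>\<^sub>t u\<close> singles out the incoming ones.
\<close>

definition optical :: "real \<Rightarrow> real \<Rightarrow> bool" where
  "optical \<delta> r0 \<longleftrightarrow> (\<exists>V. open V \<and> {-r0} \<times> (cball 0 (r0 + \<delta>) - ball 0 r0) \<subseteq> V \<and> Cinf_on u V \<and>
     (\<forall>p\<in>V. ginv u u p = 0 \<and> pd et u p > 0) \<and>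
     (\<forall>x. (-r0, x) \<in> V \<longrightarrow> u (-r0, x) = norm x - r0))"

definition TS :: "spacetime \<Rightarrow> spacetime set" where
  "TS p = {X. fst X = 0 \<and> pd X u p = 0}"

definition mu :: "spacetime \<Rightarrow> real" where
  "mu p = inverse (- ginv u fst p)"

text \<open>The null direction tangent to a null hypersurface is unique: it is that of the generators.\<close>

definition Lbar :: "spacetime \<Rightarrow> spacetime" where
  "Lbar p = (THE X. pd X u p = 0 \<and> gmet p X X = 0 \<and> fst X = 1)"

definition Tvec :: "spacetime \<Rightarrow> spacetime" where
  "Tvec p = (THE X. fst X = 0 \<and> (\<forall>Y\<in>TS p. gmet p X Y = 0) \<and> pd X u p = 1)"

definition Lvec :: "spacetime \<Rightarrow> spacetime" where
  "Lvec p = (mu p / (wave_speed G \<phi> p)\<^sup>2) *\<^sub>R Lbar p + 2 *\<^sub>R Tvec p"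

definition tr_chi :: "spacetime \<Rightarrow> real" where
  "tr_chi p = trace2 (gtilde p) (TS p) (levi_civita gtilde Lbar p)"

definition dS_sq :: "(spacetime \<Rightarrow> real) \<Rightarrow> spacetime \<Rightarrow> real" where
  "dS_sq \<psi> p = trace2 (gmet p) (TS p) (\<lambda>X Y. pd X \<psi> p * pd Y \<psi> p)"

text \<open>
  \<open>(t, \<Gamma> t u' \<omega>)\<close> is the point at time \<open>t\<close> on the null generator which starts
  at \<open>(r0 + u') \<omega>\<close>; thus \<open>\<Gamma> t u'\<close> parametrizes \<open>S\<^bsub>t,u'\<^esub>\<close> by the unit sphere.
\<close>

definition generators :: "real \<Rightarrow> real \<Rightarrow> (real \<Rightarrow> real \<Rightarrow> real^3 \<Rightarrow> real^3) \<Rightarrow> bool" where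
  "generators \<delta> r0 \<Gamma> \<longleftrightarrow> (\<exists>\<epsilon>>0. \<forall>u'\<in>{0..\<delta>}. \<forall>\<omega>\<in>sphere 0 1.
     \<Gamma> (-r0) u' \<omega> = (r0 + u') *\<^sub>R \<omega> \<and>
     (\<forall>t\<in>{-r0..<-r0+\<epsilon>}. ((\<lambda>\<tau>. (\<tau>, \<Gamma> \<tau> u' \<omega>)) has_vector_derivative Lbar (t, \<Gamma> t u' \<omega>))
        (at t within {-r0..<-r0+\<epsilon>})))"

text \<open>
  The integral with respect to the area form \<open>d\<mu>\<^sub>\<gamma> = sqrt (det \<gamma>) d\<theta> d\<omega>\<close> in spherical
  coordinates on the parameter sphere.
\<close>

definition integral_S ::
  "(real \<Rightarrow> real \<Rightarrow> real^3 \<Rightarrow> real^3) \<Rightarrow> real \<Rightarrow> real \<Rightarrow> (spacetime \<Rightarrow> real) \<Rightarrow> real" where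
  "integral_S \<Gamma> t u' f = integral (cbox (0, 0) (pi, 2 * pi)) (\<lambda>y.
     let X = (\<lambda>z. (t, \<Gamma> t u' (sph z)));
         \<gamma> = (\<lambda>a b. gmet (X y) (pd a X y) (pd b X y))
     in f (X y) * sqrt (\<gamma> (1, 0) (1, 0) * \<gamma> (0, 1) (0, 1) - (\<gamma> (1, 0) (0, 1))\<^sup>2))"

definition integral_Sigma ::
  "(real \<Rightarrow> real \<Rightarrow> real^3 \<Rightarrow> real^3) \<Rightarrow> real \<Rightarrow> real \<Rightarrow> (spacetime \<Rightarrow> real) \<Rightarrow> real" where
  "integral_Sigma \<Gamma> t v f = integral {0..v} (\<lambda>u'. integral_S \<Gamma> t u' f)"

definition energy0 ::
  "(real \<Rightarrow> real \<Rightarrow> real^3 \<Rightarrow> real^3) \<Rightarrow> (spacetime \<Rightarrow> real) \<Rightarrow> real \<Rightarrow> real \<Rightarrow> real" where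
  "energy0 \<Gamma> \<psi> t v = integral_Sigma \<Gamma> t v (\<lambda>p. let c = wave_speed G \<phi> p in
     1 / (2 * c) * ((pd (Lvec p) \<psi> p)\<^sup>2 + mu p / c\<^sup>2 * (pd (Lbar p) \<psi> p)\<^sup>2 +
       (mu p + (mu p)\<^sup>2 / c\<^sup>2) * dS_sq \<psi> p))"

text \<open>
  With this convention for the second fundamental form, \<open>tr_chi\<close> is negative (about \<open>-2 / r\<close>) and \<open>energy1\<close>
  is nonpositive near the initial slice, so it is its absolute value that has to be estimated.
\<close>

definition energy1 ::
  "(real \<Rightarrow> real \<Rightarrow> real^3 \<Rightarrow> real^3) \<Rightarrow> (spacetime \<Rightarrow> real) \<Rightarrow> real \<Rightarrow> real \<Rightarrow> real" where
  "energy1 \<Gamma> \<psi> t v = integral_Sigma \<Gamma> t v (\<lambda>p. let c = wave_speed G \<phi> p in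
     1 / (2 * c) * (4 * (-t) / tr_chi p) *
       (mu p / c\<^sup>2 * (pd (Lbar p) \<psi> p + 1/2 * tr_chi p * \<psi> p)\<^sup>2 + mu p * dS_sq \<psi> p))"

end

end

end

theory Submission
  imports Defs
begin

text \<open>
  On the initial slice the geometry is explicit: with \<open>r = |x|\<close> one has \<open>\<mu> = c\<close>,
  \<open>L\<close> (underlined) \<open>= \<partial>\<^sub>t - c \<partial>\<^sub>r\<close>, \<open>L = c\<^sup>-\<^sup>1 \<partial>\<^sub>t + \<partial>\<^sub>r\<close>, and the null expansion is \<open>-2c/r\<close> up to a
  term of order \<open>r0\<^sup>-\<^sup>3\<close>. The first no-radiation bound says that \<open>\<partial>\<^sub>s \<phi>0 - \<phi>1\<close> is of order \<open>1/r0\<close>,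
  so that \<open>\<partial>\<^sub>s \<phi>0 \<rightarrow> \<phi>1\<close> uniformly. In the second one, \<open>\<partial>\<^sub>t\<^sup>2 \<phi>\<close> is eliminated with the wave equation: this
  gives \<open>r0\<^sup>2 (\<partial>\<^sub>t - c \<partial>\<^sub>r) \<partial>\<^sub>t \<phi> \<rightarrow> \<delta>\<^bsup>1/2\<^esup> \<phi>1\<close>, which is exactly cancelled by the null expansion term of the
  energy of \<open>K\<^sub>1\<close>, and hence also \<open>\<partial>\<^sub>s\<^sup>2 \<phi>0 \<rightarrow> \<partial>\<^sub>s \<phi>1\<close>. The angular derivatives of \<open>\<partial>\<^sub>s \<phi>0\<close> converge by
  interpolation with the \<open>C\<^sup>3\<close> bound. Writing \<open>\<psi>\<close> asymptotically as \<open>a \<partial>\<^sub>t \<phi>\<close> with \<open>a = 1\<close> or \<open>a = x\<^sub>i/r\<close>, the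
  two energies therefore tend to the integrals over \<open>[0,v] \<times> S\<^sup>2\<close> of \<open>2 \<delta>\<^sup>-\<^sup>1 (a \<partial>\<^sub>s \<phi>1)\<^sup>2\<close> and of
  \<open>- \<delta> |\<nabla>\<^sub>S (a \<phi>1)|\<^sup>2\<close>, which depend on the seed data only.
\<close>


section \<open>Functions of class C^k\<close>

text \<open>The precision needed is dictated by the energy of K_1: its weight contributes two powers
  of r0 and the area two more, so the incoming derivative of \<psi> plus half the expansion times
  \<psi> must be known up to o(r0^(-2)), although \<psi> is only of size 1/r0. Computed directly,
  r0^2 times the incoming derivative of \<partial>_t \<phi> contains r0 times the difference of
  \<partial>_s^2 \<phi>0 and \<partial>_s \<phi>1, for which no rate is given. Applying the ingoing
  operator twice and using the wave equation expresses the same quantity through the non-radial part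
  of the Laplacian, which the first bound controls; for \<partial>_i \<phi> the difference is
  eliminated in favour of this quantity. Since \<phi>0 varies with r0 and need not converge, all
  comparisons are made along points of the cylinder that move arbitrarily with r0, and uniformity is
  recovered afterwards. The pointwise formulas are derived for 0 < s < 1, where the data can be
  differentiated in space; the closed shell follows by continuity. The bounds on \<phi>0 affect the
  convergence but not the limits, so the final constant comes from derivatives of \<phi>1
  alone.\<close>

lemma pd_eqI: "(f has_derivative f') (at p) \<Longrightarrow> pd X f p = f' X"
  unfolding pd_def using frechet_derivative_at by metis

lemma has_derivative_pd: "f differentiable (at p) \<Longrightarrow> (f has_derivative (\<lambda>X. pd X f p)) (at p)"
  unfolding pd_def by (simp add: frechet_derivative_works)

lemma pd_cong:
  assumes "open S" "p \<in> S" "\<And>q. q \<in> S \<Longrightarrow> f q = g q"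
  shows "pd X f p = pd X g p"
proof -
  have "(f has_derivative D) (at p) \<longleftrightarrow> (g has_derivative D) (at p)" for D
    using assms has_derivative_transform_within_open[of f D p UNIV S g]
      has_derivative_transform_within_open[of g D p UNIV S f] by auto
  then show ?thesis unfolding pd_def frechet_derivative_def by simp
qed

lemma pd_scale: "f differentiable (at p) \<Longrightarrow> pd (a *\<^sub>R X) f p = a *\<^sub>R pd X f p"
  unfolding pd_def using linear_frechet_derivative linear_scale by blast

lemma pd_sum_Basis:
  fixes f :: "'a::euclidean_space \<Rightarrow> real"
  assumes "f differentiable (at p)"
  shows "pd X f p = (\<Sum>b\<in>Basis. (X \<bullet> b) * pd b f p)"
proof -
  have l: "linear (\<lambda>X. pd X f p)"
    unfolding pd_def using linear_frechet_derivative[OF assms] by simp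
  have "pd X f p = pd (\<Sum>b\<in>Basis. (X \<bullet> b) *\<^sub>R b) f p" by (simp add: euclidean_representation)
  also have "\<dots> = (\<Sum>b\<in>Basis. (X \<bullet> b) * pd b f p)"
    using linear_sum[OF l, of "\<lambda>b. (X \<bullet> b) *\<^sub>R b" Basis] linear_scale[OF l] by simp
  finally show ?thesis .
qed

lemma Ck_on_SucD: "Ck_on (Suc k) f S \<Longrightarrow> Ck_on k f S"
  by (induction k arbitrary: f) (auto intro: differentiable_imp_continuous_on)

lemma Ck_on_cong:
  assumes "open S" "\<And>x. x \<in> S \<Longrightarrow> f x = g x"
  shows "Ck_on k f S = Ck_on k g S"
  using assms(2)
proof (induction k arbitrary: f g)
  case 0 then show ?case by (simp cong: continuous_on_cong)
next
  case (Suc k)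
  have "f differentiable_on S \<longleftrightarrow> g differentiable_on S"
    using Suc.prems differentiable_transform_within by (metis differentiable_on_def zero_less_one)
  moreover have "Ck_on k (pd b f) S = Ck_on k (pd b g) S" for b
    by (rule Suc.IH) (rule pd_cong[OF assms(1) _ Suc.prems])
  ultimately show ?case by simp
qed

lemma Ck_on_const: "Ck_on k (\<lambda>x. c) S"
proof (induction k arbitrary: c)
  case (Suc k)
  have "pd b (\<lambda>x::'a. c) = (\<lambda>x. 0)" for b by (auto simp: pd_def)
  then show ?case using Suc by simp
qed simp

lemma Ck_on_linear:
  assumes "bounded_linear f" shows "Ck_on k f S"
proof (cases k)
  case 0 then show ?thesis using assms by (simp add: linear_continuous_on)
next
  case (Suc j)
  have "pd b f = (\<lambda>x. f b)" for b
    using bounded_linear_imp_has_derivative[OF assms] pd_eqI by blast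
  then show ?thesis
    using Suc assms by (simp add: Ck_on_const bounded_linear_imp_differentiable_on)
qed

lemma Ck_on_add:
  assumes "open S" "Ck_on k f S" "Ck_on k g S"
  shows "Ck_on k (\<lambda>x. f x + g x) S"
  using assms(2,3)
proof (induction k arbitrary: f g)
  case 0 then show ?case by (simp add: continuous_on_add)
next
  case (Suc k)
  have d: "f differentiable (at x)" "g differentiable (at x)" if "x \<in> S" for x
    using Suc.prems that assms(1) by (auto simp: differentiable_on_eq_differentiable_at)
  have "pd b (\<lambda>x. f x + g x) x = pd b f x + pd b g x" if "x \<in> S" for b x
    by (rule pd_eqI) (intro derivative_intros has_derivative_pd d that)
  then have "Ck_on k (pd b (\<lambda>x. f x + g x)) S = Ck_on k (\<lambda>x. pd b f x + pd b g x) S" for b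
    by (intro Ck_on_cong assms)
  then show ?case using Suc by simp
qed

lemma Ck_on_mult:
  assumes "open S" "Ck_on k f S" "Ck_on k g S"
  shows "Ck_on k (\<lambda>x. f x * g x) S"
  using assms(2,3)
proof (induction k arbitrary: f g)
  case 0 then show ?case by (simp add: continuous_on_mult)
next
  case (Suc k)
  have d: "f differentiable (at x)" "g differentiable (at x)" if "x \<in> S" for x
    using Suc.prems that assms(1) by (auto simp: differentiable_on_eq_differentiable_at)
  have "pd b (\<lambda>x. f x * g x) x = f x * pd b g x + pd b f x * g x" if "x \<in> S" for b x
    by (rule pd_eqI) (intro derivative_intros has_derivative_pd d that)
  then have "Ck_on k (pd b (\<lambda>x. f x * g x)) S = Ck_on k (\<lambda>x. f x * pd b g x + pd b f x * g x) S" for b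
    by (intro Ck_on_cong assms)
  moreover have "Ck_on k f S" "Ck_on k g S" using Suc.prems Ck_on_SucD by blast+
  ultimately show ?case using Suc assms(1) by (simp add: Ck_on_add)
qed

lemma Ck_on_sum:
  assumes "open S" "finite I" "\<And>i. i \<in> I \<Longrightarrow> Ck_on k (f i) S"
  shows "Ck_on k (\<lambda>x. \<Sum>i\<in>I. f i x) S"
  using assms(2,3) by (induction I) (auto intro: Ck_on_const Ck_on_add[OF assms(1)])

text \<open>By the chain rule a derivative of the composite is a sum of derivatives of the
  components of \<open>g\<close> times functions \<open>pd b f\<close> composed with
  \<open>g\<close>. Hence the induction fixes \<open>g\<close> and generalises
  \<open>f\<close>.\<close>

lemma Ck_on_compose:
  fixes f :: "'b::euclidean_space \<Rightarrow> real" and g :: "'a::euclidean_space \<Rightarrow> 'b"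
  assumes "open S" "open W" "g ` S \<subseteq> W" "Ck_on k f W" "\<And>b. b \<in> Basis \<Longrightarrow> Ck_on k (\<lambda>x. g x \<bullet> b) S"
  shows "Ck_on k (\<lambda>x. f (g x)) S"
  using assms(4,5)
proof (induction k arbitrary: f)
  case 0
  then have "continuous_on S g" using continuous_on_componentwise[of S g] by simp
  then show ?case using 0 assms(3) by (auto intro: continuous_on_compose2)
next
  case (Suc k)
  have df: "f differentiable (at (g x))" if "x \<in> S" for x
    using Suc.prems(1) that assms(2,3) by (auto simp: differentiable_on_eq_differentiable_at)
  have dg: "(\<lambda>x. g x \<bullet> b) differentiable (at x)" if "x \<in> S" "b \<in> Basis" for x b
    using Suc.prems(2) that assms(1) by (auto simp: differentiable_on_eq_differentiable_at)
  have hg: "(g has_derivative (\<lambda>X. \<Sum>b\<in>Basis. pd X (\<lambda>x. g x \<bullet> b) x *\<^sub>R b)) (at x)" if "x \<in> S" for x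
  proof (rule has_derivative_componentwise_within[THEN iffD2], rule ballI)
    fix b :: 'b assume b: "b \<in> Basis"
    show "((\<lambda>x. g x \<bullet> b) has_derivative
        (\<lambda>X. (\<Sum>b\<in>Basis. pd X (\<lambda>x. g x \<bullet> b) x *\<^sub>R b) \<bullet> b)) (at x)"
      using has_derivative_pd[OF dg[OF that b]] b by simp
  qed
  have hfg: "((\<lambda>x. f (g x)) has_derivative
      (\<lambda>X. pd (\<Sum>b\<in>Basis. pd X (\<lambda>x. g x \<bullet> b) x *\<^sub>R b) f (g x))) (at x)" if "x \<in> S" for x
    by (rule has_derivative_compose[OF hg has_derivative_pd[OF df]]) (use that in auto)
  have e: "pd a (\<lambda>x. f (g x)) x = (\<Sum>b\<in>Basis. pd a (\<lambda>x. g x \<bullet> b) x * pd b f (g x))"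
    if "x \<in> S" for a x
    unfolding pd_eqI[OF hfg[OF that]] by (subst pd_sum_Basis[OF df[OF that]]) simp
  have "Ck_on k (pd a (\<lambda>x. f (g x))) S =
      Ck_on k (\<lambda>x. \<Sum>b\<in>Basis. pd a (\<lambda>x. g x \<bullet> b) x * pd b f (g x)) S" for a
    by (rule Ck_on_cong[OF assms(1) e])
  moreover have "Ck_on k (\<lambda>x. \<Sum>b\<in>Basis. pd a (\<lambda>x. g x \<bullet> b) x * pd b f (g x)) S"
    if "a \<in> Basis" for a
  proof (intro Ck_on_sum[OF assms(1) finite_Basis] Ck_on_mult[OF assms(1)])
    fix b :: 'b assume b: "b \<in> Basis"
    show "Ck_on k (pd a (\<lambda>x. g x \<bullet> b)) S" using Suc.prems(2)[OF b] that by simp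
    have "Ck_on k (pd b f) W" using Suc.prems(1) b by simp
    then show "Ck_on k (\<lambda>x. pd b f (g x)) S"
      by (rule Suc.IH) (rule Ck_on_SucD[OF Suc.prems(2)])
  qed
  moreover have "(\<lambda>x. f (g x)) differentiable_on S"
    unfolding differentiable_on_def differentiable_def
    using has_derivative_at_withinI[OF hfg] by blast
  ultimately show ?case by simp
qed

lemma Ck_on_subset: "Ck_on k f S \<Longrightarrow> T \<subseteq> S \<Longrightarrow> Ck_on k f T"
  by (induction k arbitrary: f) (auto intro: continuous_on_subset differentiable_on_subset)

lemma Cinf_on_pd: "Cinf_on f S \<Longrightarrow> b \<in> Basis \<Longrightarrow> Cinf_on (pd b f) S"
  unfolding Cinf_on_def by (metis Ck_on.simps(2))

lemma Cinf_on_differentiable: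
  assumes "Cinf_on f S" "open S" "p \<in> S"
  shows "f differentiable (at p)"
proof -
  have "Ck_on (Suc 0) f S" using assms(1) unfolding Cinf_on_def by blast
  then show ?thesis using assms by (simp add: differentiable_on_eq_differentiable_at)
qed

lemma Cinf_on_continuous: "Cinf_on f S \<Longrightarrow> continuous_on S f"
  unfolding Cinf_on_def by (metis Ck_on.simps(1))

lemma Cinf_on_subset: "Cinf_on f S \<Longrightarrow> T \<subseteq> S \<Longrightarrow> Cinf_on f T"
  unfolding Cinf_on_def using Ck_on_subset by blast

section \<open>Symmetry of mixed second derivatives\<close>

lemma pd_mean_value_square:
  fixes f :: "'a::real_normed_vector \<Rightarrow> real"
  assumes h: "h > 0" and sq: "\<And>s t. s \<in> {0..h} \<Longrightarrow> t \<in> {0..h} \<Longrightarrow> p + s *\<^sub>R a + t *\<^sub>R b \<in> S"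
    and d: "\<And>q. q \<in> S \<Longrightarrow> f differentiable (at q)"
    and da: "\<And>q. q \<in> S \<Longrightarrow> pd a f differentiable (at q)"
  shows "\<exists>s\<in>{0<..<h}. \<exists>t\<in>{0<..<h}.
    f (p + h *\<^sub>R a + h *\<^sub>R b) - f (p + h *\<^sub>R a) - f (p + h *\<^sub>R b) + f p
      = h\<^sup>2 * pd b (pd a f) (p + s *\<^sub>R a + t *\<^sub>R b)"
proof -
  have line: "((\<lambda>s. F (q + s *\<^sub>R v)) has_real_derivative pd v F (q + s *\<^sub>R v)) (at s)"
    if "F differentiable (at (q + s *\<^sub>R v))" for F :: "'a \<Rightarrow> real" and q v s
  proof -
    have "((\<lambda>s. F (q + s *\<^sub>R v)) has_derivative (\<lambda>r. pd (r *\<^sub>R v) F (q + s *\<^sub>R v))) (at s)"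
      by (rule has_derivative_compose[where f = "\<lambda>s. q + s *\<^sub>R v" and g = F, OF _ has_derivative_pd[OF that]])
         (auto intro!: derivative_eq_intros)
    then show ?thesis
      unfolding has_field_derivative_def using pd_scale[OF that] by (simp add: mult_commute_abs)
  qed
  define F where "F s = f (p + h *\<^sub>R b + s *\<^sub>R a) - f (p + s *\<^sub>R a)" for s
  have sqb: "p + h *\<^sub>R b + s *\<^sub>R a \<in> S" "p + s *\<^sub>R a \<in> S" if "s \<in> {0..h}" for s
    using sq[OF that, of h] sq[OF that, of 0] h by (simp_all add: algebra_simps)
  have "(F has_real_derivative (pd a f (p + h *\<^sub>R b + s *\<^sub>R a) - pd a f (p + s *\<^sub>R a))) (at s)"
    if "0 \<le> s" "s \<le> h" for s
    unfolding F_def using sqb that by (intro derivative_intros line d) auto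
  from MVT2[OF h this] obtain s where s: "0 < s" "s < h"
    and Fs: "F h - F 0 = h * (pd a f (p + h *\<^sub>R b + s *\<^sub>R a) - pd a f (p + s *\<^sub>R a))"
    by auto
  have "((\<lambda>t. pd a f (p + s *\<^sub>R a + t *\<^sub>R b)) has_real_derivative
      pd b (pd a f) (p + s *\<^sub>R a + t *\<^sub>R b)) (at t)" if "0 \<le> t" "t \<le> h" for t
    using sq s that by (intro line da) auto
  from MVT2[OF h this] obtain t where "0 < t" "t < h"
    "pd a f (p + s *\<^sub>R a + h *\<^sub>R b) - pd a f (p + s *\<^sub>R a) = h * pd b (pd a f) (p + s *\<^sub>R a + t *\<^sub>R b)"
    by auto
  then show ?thesis using s Fs
    by (intro bexI[of _ s] bexI[of _ t]) (auto simp: F_def algebra_simps power2_eq_square)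
qed

text \<open>Schwarz's theorem: the second difference over a small square is symmetric in
  \<open>a\<close> and \<open>b\<close>, and \<open>pd_mean_value_square\<close> evaluates it in
  either order as h^2 times a mixed derivative at some point of the square. Continuity at
  \<open>p\<close> then leaves no gap between the two.\<close>

lemma pd_commute:
  fixes f :: "'a::real_normed_vector \<Rightarrow> real"
  assumes "open S" "p \<in> S"
    and d: "\<And>q. q \<in> S \<Longrightarrow> f differentiable (at q)"
    and da: "\<And>q. q \<in> S \<Longrightarrow> pd a f differentiable (at q)"
    and db: "\<And>q. q \<in> S \<Longrightarrow> pd b f differentiable (at q)"
    and c: "continuous_on S (pd a (pd b f))" "continuous_on S (pd b (pd a f))"
  shows "pd a (pd b f) p = pd b (pd a f) p"
proof (rule ccontr)
  assume ne: "pd a (pd b f) p \<noteq> pd b (pd a f) p"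
  define e where "e = dist (pd a (pd b f) p) (pd b (pd a f) p) / 2"
  have e: "e > 0" using ne by (simp add: e_def)
  have ct: "isCont (pd a (pd b f)) p" "isCont (pd b (pd a f)) p"
    using c assms(1,2) by (auto simp: continuous_on_eq_continuous_at)
  obtain r0 where r0: "r0 > 0" "ball p r0 \<subseteq> S" using assms(1,2) openE by blast
  obtain r1 where r1: "r1 > 0" "\<And>q. dist q p < r1 \<Longrightarrow> dist (pd a (pd b f) q) (pd a (pd b f) p) < e"
    using ct(1) e unfolding continuous_at_eps_delta by metis
  obtain r2 where r2: "r2 > 0" "\<And>q. dist q p < r2 \<Longrightarrow> dist (pd b (pd a f) q) (pd b (pd a f) p) < e"
    using ct(2) e unfolding continuous_at_eps_delta by metis
  define r where "r = min r0 (min r1 r2)"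
  define h where "h = r / (2 * (norm a + norm b + 1))"
  have r: "r > 0" using r0 r1 r2 by (simp add: r_def)
  have n: "norm a + norm b + 1 > 0" by (metis add_nonneg_pos norm_ge_zero add_nonneg_nonneg zero_less_one)
  have h: "h > 0" using r n by (simp add: h_def)
  have near: "dist (p + s *\<^sub>R a + t *\<^sub>R b) p < r" if "s \<in> {0..h}" "t \<in> {0..h}" for s t
  proof -
    have "dist (p + s *\<^sub>R a + t *\<^sub>R b) p \<le> s * norm a + t * norm b"
      using that norm_triangle_ineq[of "s *\<^sub>R a" "t *\<^sub>R b"] by (simp add: dist_norm add.assoc)
    also have "\<dots> \<le> h * norm a + h * norm b"
      using that by (intro add_mono mult_right_mono) auto
    also have "\<dots> < h * (2 * (norm a + norm b + 1))"
      using h n by (simp add: algebra_simps add_strict_increasing2)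
    also have "\<dots> = r" using n by (simp add: h_def)
    finally show ?thesis .
  qed
  have in1: "p + s *\<^sub>R a + t *\<^sub>R b \<in> S" if "s \<in> {0..h}" "t \<in> {0..h}" for s t
    using near[OF that] r0 by (auto simp: r_def dist_commute)
  have in2: "p + s *\<^sub>R b + t *\<^sub>R a \<in> S" if "s \<in> {0..h}" "t \<in> {0..h}" for s t
    using in1[OF that(2,1)] by (simp add: algebra_simps)
  obtain s t where 1: "s \<in> {0<..<h}" "t \<in> {0<..<h}"
    "f (p + h *\<^sub>R a + h *\<^sub>R b) - f (p + h *\<^sub>R a) - f (p + h *\<^sub>R b) + f p
      = h\<^sup>2 * pd b (pd a f) (p + s *\<^sub>R a + t *\<^sub>R b)"
    using pd_mean_value_square[OF h in1 d da] by blast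
  obtain s' t' where 2: "s' \<in> {0<..<h}" "t' \<in> {0<..<h}"
    "f (p + h *\<^sub>R b + h *\<^sub>R a) - f (p + h *\<^sub>R b) - f (p + h *\<^sub>R a) + f p
      = h\<^sup>2 * pd a (pd b f) (p + s' *\<^sub>R b + t' *\<^sub>R a)"
    using pd_mean_value_square[OF h in2 d db] by blast
  have "h\<^sup>2 * pd b (pd a f) (p + s *\<^sub>R a + t *\<^sub>R b) = h\<^sup>2 * pd a (pd b f) (p + t' *\<^sub>R a + s' *\<^sub>R b)"
    using 1(3) 2(3) by (simp add: algebra_simps)
  then have eq: "pd b (pd a f) (p + s *\<^sub>R a + t *\<^sub>R b) = pd a (pd b f) (p + t' *\<^sub>R a + s' *\<^sub>R b)"
    using h by simp
  have "dist (pd b (pd a f) (p + s *\<^sub>R a + t *\<^sub>R b)) (pd b (pd a f) p) < e"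
    using near[of s t] 1 by (intro r2) (auto simp: r_def)
  moreover have "dist (pd a (pd b f) (p + t' *\<^sub>R a + s' *\<^sub>R b)) (pd a (pd b f) p) < e"
    using near[of t' s'] 2 by (intro r1) (auto simp: r_def)
  ultimately show False
    unfolding eq e_def using dist_triangle_half_l[of "pd a (pd b f) (p + t' *\<^sub>R a + s' *\<^sub>R b)"]
    by (smt (verit) dist_commute dist_triangle field_sum_of_halves)
qed

lemma Cinf_on_pd_commute:
  assumes "Cinf_on f S" "open S" "p \<in> S" "a \<in> Basis" "b \<in> Basis"
  shows "pd a (pd b f) p = pd b (pd a f) p"
  using assms by (intro pd_commute[of S]) (blast intro: Cinf_on_pd Cinf_on_differentiable Cinf_on_continuous)+


section \<open>Geometry of the initial slice\<close>

text \<open>The type \<open>spacetime\<close> also serves for pairs (s, x) of the cylinder, so for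
  functions such as \<open>H\<close> and \<open>K\<close> below this is the gradient in x at fixed
  s.\<close>

definition sgrad :: "(spacetime \<Rightarrow> real) \<Rightarrow> spacetime \<Rightarrow> real^3" where
  "sgrad f p = (\<chi> i. pd (ex i) f p)"

lemma Basis_spacetime: "(Basis :: spacetime set) = insert et (range ex)"
  unfolding Basis_prod_def Basis_vec_def et_def ex_def by auto

lemma et_Basis [simp]: "et \<in> Basis" and ex_Basis [simp]: "ex i \<in> Basis"
  by (auto simp: Basis_spacetime)

lemma pd_spacetime:
  assumes "f differentiable (at p)"
  shows "pd X f p = fst X * pd et f p + snd X \<bullet> sgrad f p"
proof -
  have inj: "inj ex" by (auto simp: inj_def ex_def axis_eq_axis)
  have "et \<notin> range ex" by (auto simp: et_def ex_def)
  then have "pd X f p = (X \<bullet> et) * pd et f p + (\<Sum>i\<in>UNIV. (X \<bullet> ex i) * pd (ex i) f p)"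
    using pd_sum_Basis[OF assms, of X] unfolding Basis_spacetime
    by (simp add: sum.reindex[OF inj])
  moreover have "X \<bullet> ex i = snd X $ i" for i
    by (simp add: ex_def inner_prod_def inner_axis)
  ultimately show ?thesis
    by (simp add: sgrad_def et_def inner_prod_def inner_vec_def)
qed

lemma ginv_sgrad: "ginv G \<phi> a b p = - pd et a p * pd et b p / (wave_speed G \<phi> p)\<^sup>2 + sgrad a p \<bullet> sgrad b p"
  unfolding ginv_def sgrad_def inner_vec_def by simp

text \<open>The data prescribe functions on the time slice only. This is how their formulas are
  differentiated in directions tangent to the slice.\<close>

lemma pd_slice:
  assumes "f differentiable (at (t, x))" "open N" "x \<in> N" "\<And>z. z \<in> N \<Longrightarrow> f (t, z) = g z"
    and "(g has_derivative g') (at x)"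
  shows "pd (0, y) f (t, x) = g' y"
proof -
  have "((\<lambda>z. f (t, z)) has_derivative (\<lambda>y. pd (0, y) f (t, x))) (at x)"
    by (rule has_derivative_compose[where f = "\<lambda>z. (t, z)" and g = f, OF _ has_derivative_pd[OF assms(1)]])
       (auto intro!: derivative_eq_intros)
  then have "(g has_derivative (\<lambda>y. pd (0, y) f (t, x))) (at x)"
    using has_derivative_transform_within_open assms(2-4) by blast
  then show ?thesis using has_derivative_unique[OF assms(5)] by metis
qed

lemma wave_speed_pos: "1 + 3 * G * (pd et \<phi> p)\<^sup>2 > 0 \<Longrightarrow> wave_speed G \<phi> p > 0"
  unfolding wave_speed_def by simp

lemma wave_speed_sq:
  "1 + 3 * G * (pd et \<phi> p)\<^sup>2 > 0 \<Longrightarrow> (wave_speed G \<phi> p)\<^sup>2 * (1 + 3 * G * (pd et \<phi> p)\<^sup>2) = 1"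
  unfolding wave_speed_def by (simp add: powr_powr[symmetric] powr_minus powr_half_sqrt field_simps)

lemma has_derivative_wave_speed:
  assumes "pd et \<phi> differentiable (at p)" "1 + 3 * G * (pd et \<phi> p)\<^sup>2 > 0"
  shows "(wave_speed G \<phi> has_derivative
    (\<lambda>X. - 3 * G * wave_speed G \<phi> p ^ 3 * pd et \<phi> p * pd X (pd et \<phi>) p)) (at p)"
proof -
  define s where "s = 1 + 3 * G * (pd et \<phi> p)\<^sup>2"
  have s: "s > 0" using assms s_def by simp
  have "((\<lambda>s. s powr (-1/2)) has_real_derivative (-1/2) * s powr (-1/2 - 1)) (at s)"
    using has_real_derivative_powr[OF s, of "-1/2"] by simp
  moreover have "s powr (-1/2 - 1) = (s powr (-1/2)) ^ 3"
    using s by (simp add: powr_powr flip: powr_numeral)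
  ultimately have d: "((\<lambda>s. s powr (-1/2)) has_derivative (*) ((-1/2) * (s powr (-1/2)) ^ 3)) (at s)"
    by (simp add: has_field_derivative_def)
  have "((\<lambda>q. 1 + 3 * G * (pd et \<phi> q)\<^sup>2) has_derivative (\<lambda>X. 6 * G * pd et \<phi> p * pd X (pd et \<phi>) p)) (at p)"
    by (rule derivative_eq_intros has_derivative_pd[OF assms(1)] refl)+ (auto simp: fun_eq_iff)
  from has_derivative_compose[OF this d[unfolded s_def]]
  show ?thesis unfolding wave_speed_def[abs_def] by (simp add: mult_ac)
qed

section \<open>Traces over planes orthogonal to a unit vector\<close>

lemma ex_orthonormal_perp:
  fixes w :: "real^3"
  assumes "norm w = 1"
  obtains a b where "norm a = 1" "norm b = 1" "a \<bullet> b = 0" "a \<bullet> w = 0" "b \<bullet> w = 0"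
proof -
  obtain S where S: "w \<in> S" "pairwise orthogonal S" "\<And>x. x \<in> S \<Longrightarrow> norm x = 1"
    and "card S = DIM(real^3)"
    using vector_in_orthonormal_basis[OF assms] by metis
  then have "card (S - {w}) = 2" by simp
  then obtain a b where ab: "S - {w} = {a, b}" "a \<noteq> b" by (meson card_2_iff)
  then show ?thesis using S
    by (intro that[of a b]) (auto simp: pairwise_def orthogonal_def insert_eq_iff)
qed

lemma orthonormal_perp_Parseval:
  fixes w :: "real^3"
  assumes "norm a = 1" "norm b = 1" "norm w = 1" "a \<bullet> b = 0" "a \<bullet> w = 0" "b \<bullet> w = 0"
  shows "(a \<bullet> z)\<^sup>2 + (b \<bullet> z)\<^sup>2 = z \<bullet> z - (w \<bullet> z)\<^sup>2"
proof -
  have ne: "a \<noteq> b" "a \<noteq> w" "b \<noteq> w"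
    using assms by (auto simp: norm_eq_1)
  let ?B = "{a, b, w}"
  have o: "pairwise orthogonal ?B"
    using assms by (auto simp: pairwise_def orthogonal_def inner_commute)
  have "independent ?B" using assms by (intro pairwise_orthogonal_independent o) auto
  moreover have "card ?B = 3" using ne by simp
  ultimately have "z \<in> span ?B"
    using card_ge_dim_independent[of ?B UNIV] by auto
  then have "(\<Sum>i\<in>?B. (z \<bullet> i) *\<^sub>R i) = z"
    using assms by (intro orthonormal_basis_expand o) auto
  then have "z = (z \<bullet> a) *\<^sub>R a + ((z \<bullet> b) *\<^sub>R b + (z \<bullet> w) *\<^sub>R w)" using ne by simp
  then have "z \<bullet> z = z \<bullet> ((z \<bullet> a) *\<^sub>R a + ((z \<bullet> b) *\<^sub>R b + (z \<bullet> w) *\<^sub>R w))" by simp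
  then show ?thesis by (simp add: inner_right_distrib power2_eq_square inner_commute)
qed

text \<open>\<open>trace2\<close> is a definite description, so independence of the orthonormal
  basis has to be shown. As \<open>h\<close> is \<open>m\<close> times the Euclidean product, its
  orthonormal pairs are the Euclidean ones divided by \<open>sqrt m\<close>, and it is enough that
  the sum is constant over those.\<close>

lemma trace2_perp:
  assumes w: "norm w = 1" and V: "V = {X :: spacetime. fst X = 0 \<and> snd X \<bullet> w = 0}"
    and m: "m > 0" and h: "\<And>y z. h (0, y) (0, z) = m * (y \<bullet> z)"
    and s: "\<And>a b. norm a = 1 \<Longrightarrow> norm b = 1 \<Longrightarrow> a \<bullet> b = 0 \<Longrightarrow> a \<bullet> w = 0 \<Longrightarrow> b \<bullet> w = 0 \<Longrightarrow>
      k (0, a /\<^sub>R sqrt m) (0, a /\<^sub>R sqrt m) + k (0, b /\<^sub>R sqrt m) (0, b /\<^sub>R sqrt m) = s"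
  shows "trace2 h V k = s"
  unfolding trace2_def
proof (rule the_equality)
  obtain a b where ab: "norm a = 1" "norm b = 1" "a \<bullet> b = 0" "a \<bullet> w = 0" "b \<bullet> w = 0"
    using ex_orthonormal_perp[OF w] by blast
  show "\<exists>e1\<in>V. \<exists>e2\<in>V. h e1 e1 = 1 \<and> h e2 e2 = 1 \<and> h e1 e2 = 0 \<and> s = k e1 e1 + k e2 e2"
    using ab m s[OF ab]
    by (intro bexI[of _ "(0, a /\<^sub>R sqrt m)"] bexI[of _ "(0, b /\<^sub>R sqrt m)"])
       (auto simp: V h norm_eq_1 field_simps)
next
  fix s' assume "\<exists>e1\<in>V. \<exists>e2\<in>V. h e1 e1 = 1 \<and> h e2 e2 = 1 \<and> h e1 e2 = 0 \<and> s' = k e1 e1 + k e2 e2"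
  then obtain y z where yz: "y \<bullet> w = 0" "z \<bullet> w = 0" "m * (y \<bullet> y) = 1" "m * (z \<bullet> z) = 1" "y \<bullet> z = 0"
    "s' = k (0, y) (0, y) + k (0, z) (0, z)"
    using m by (auto simp: V h)
  have n: "norm (sqrt m *\<^sub>R y) = 1" if "m * (y \<bullet> y) = 1" for y :: "real^3"
    unfolding norm_eq_1 using that m by (simp flip: mult.assoc)
  show "s' = s"
    using n[OF yz(3)] n[OF yz(4)] s[of "sqrt m *\<^sub>R y" "sqrt m *\<^sub>R z"] yz m by simp
qed

text \<open>The eikonal equation is required on the open set \<open>V\<close>, since the null
  expansion needs \<open>Lbar\<close> to be differentiable in spacetime and not merely known on the
  slice.\<close>

locale optical_slice =
  fixes G :: real and \<phi> u :: "spacetime \<Rightarrow> real" and W V :: "spacetime set" and t r0 :: real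
  assumes open_W: "open W" and open_V: "open V"
    and smooth_\<phi>: "Cinf_on \<phi> W" and smooth_u: "Cinf_on u V"
    and eikonal: "p \<in> V \<Longrightarrow> ginv G \<phi> u u p = 0" and dt_u_pos: "p \<in> V \<Longrightarrow> pd et u p > 0"
    and u_init: "(t, x) \<in> V \<Longrightarrow> u (t, x) = norm x - r0"
begin

lemma diff_u: "p \<in> V \<Longrightarrow> u differentiable (at p)"
  using Cinf_on_differentiable smooth_u open_V by blast

lemma diff_\<phi>t: "p \<in> W \<Longrightarrow> pd et \<phi> differentiable (at p)"
  using Cinf_on_differentiable[OF Cinf_on_pd[OF smooth_\<phi>]] open_W by simp

text \<open>Off the origin x/|x| is smooth, and positivity of the coefficient of the second time
  derivative makes the wave speed, a \<open>powr\<close>, positive and differentiable.\<close>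

definition dom :: "spacetime set" where
  "dom = {p \<in> V \<inter> W. snd p \<noteq> 0 \<and> 1 + 3 * G * (pd et \<phi> p)\<^sup>2 > 0}"

abbreviation c :: "spacetime \<Rightarrow> real" where "c \<equiv> wave_speed G \<phi>"

lemma domD: assumes "p \<in> dom"
  shows "p \<in> V" "p \<in> W" "snd p \<noteq> 0" "1 + 3 * G * (pd et \<phi> p)\<^sup>2 > 0" "c p > 0"
  using assms wave_speed_pos by (auto simp: dom_def)

lemma open_dom: "open dom"
proof -
  have "continuous_on W (\<lambda>p. 1 + 3 * G * (pd et \<phi> p)\<^sup>2)"
    by (intro continuous_intros Cinf_on_continuous Cinf_on_pd smooth_\<phi> et_Basis)
  then have "open (W \<inter> (\<lambda>p. 1 + 3 * G * (pd et \<phi> p)\<^sup>2) -` {0<..})"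
    by (rule continuous_open_preimage[OF _ open_W]) simp
  moreover have "open ({p. snd p \<noteq> 0} :: spacetime set)"
    by (intro open_Collect_neq continuous_intros)
  moreover have "dom = (V \<inter> {p. snd p \<noteq> 0}) \<inter> (W \<inter> (\<lambda>p. 1 + 3 * G * (pd et \<phi> p)\<^sup>2) -` {0<..})"
    by (auto simp: dom_def)
  ultimately show ?thesis using open_V by (auto intro: open_Int)
qed

lemma open_slice: "open {x. (t, x) \<in> dom}"
proof -
  have "{x. (t, x) \<in> dom} = Pair t -` dom" by auto
  then show ?thesis using open_dom by (simp add: open_vimage continuous_on_Pair)
qed

lemma norm_sgrad_u:
  assumes "p \<in> dom" shows "norm (sgrad u p) = pd et u p / c p"
proof -
  have "(norm (sgrad u p))\<^sup>2 = (pd et u p / c p)\<^sup>2"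
    using eikonal[of p] domD[OF assms]
    by (simp add: ginv_sgrad power_divide power2_norm_eq_inner flip: power2_eq_square)
  then show ?thesis using domD[OF assms] dt_u_pos[of p] by (simp add: power2_eq_iff_nonneg)
qed

lemma pd_u: "p \<in> dom \<Longrightarrow> pd X u p = fst X * pd et u p + snd X \<bullet> sgrad u p"
  using pd_spacetime diff_u domD by blast

text \<open>The metric gradient of \<open>u\<close> is tangent to its own null level set; dividing
  it by its time component gives the generator. The formula is proved on all of \<open>dom\<close>
  because \<open>Lbar\<close> is differentiated later.\<close>

lemma Lbar_dom:
  assumes p: "p \<in> dom" shows "Lbar G \<phi> u p = (1, - ((c p)\<^sup>2 / pd et u p) *\<^sub>R sgrad u p)"
  unfolding Lbar_def
proof (rule the_equality)
  have pos: "c p > 0" "pd et u p > 0" using domD[OF p] dt_u_pos by auto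
  have sq: "sgrad u p \<bullet> sgrad u p = (pd et u p / c p)\<^sup>2"
    using norm_sgrad_u[OF p] by (simp add: dot_square_norm)
  let ?X = "(1, - ((c p)\<^sup>2 / pd et u p) *\<^sub>R sgrad u p) :: spacetime"
  have "pd ?X u p = 0" using pos pd_u[OF p, of ?X] by (simp add: sq power2_eq_square)
  moreover have "gmet G \<phi> p ?X ?X = 0" using pos by (simp add: gmet_def sq power2_eq_square)
  ultimately show "pd ?X u p = 0 \<and> gmet G \<phi> p ?X ?X = 0 \<and> fst ?X = 1" by simp
  fix X assume X: "pd X u p = 0 \<and> gmet G \<phi> p X X = 0 \<and> fst X = 1"
  then have e: "snd X \<bullet> sgrad u p = - pd et u p" "snd X \<bullet> snd X = (c p)\<^sup>2"
    using pd_u[OF p, of X] by (auto simp: gmet_def)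
  \<comment> \<open>\<open>z\<close> is the difference between the spatial parts of \<open>X\<close>
    and of the candidate; tangency and nullity of \<open>X\<close> force its Euclidean norm to
    vanish.\<close>
  define z where "z = snd X + ((c p)\<^sup>2 / pd et u p) *\<^sub>R sgrad u p"
  have "z \<bullet> z = snd X \<bullet> snd X + 2 * ((c p)\<^sup>2 / pd et u p) * (snd X \<bullet> sgrad u p)
      + ((c p)\<^sup>2 / pd et u p)\<^sup>2 * (sgrad u p \<bullet> sgrad u p)"
    unfolding z_def by (simp add: inner_add_left inner_add_right inner_commute power2_eq_square algebra_simps)
  also have "\<dots> = 0" unfolding e sq using pos by (simp add: power2_eq_square field_simps)
  finally have "z = 0" by simp
  then have "snd X = - ((c p)\<^sup>2 / pd et u p) *\<^sub>R sgrad u p" by (simp add: z_def eq_neg_iff_add_eq_0)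
  then show "X = ?X" using X by (simp add: prod_eq_iff)
qed

context
  fixes x :: "real^3"
  assumes x: "(t, x) \<in> dom"
begin

abbreviation (input) pt :: spacetime where "pt \<equiv> (t, x)"
abbreviation (input) dir :: "real^3" where "dir \<equiv> x /\<^sub>R norm x"

lemma x_nz: "x \<noteq> 0" using domD(3)[OF x] by simp

lemma norm_dir: "norm dir = 1" using x_nz by simp

lemma cpos: "c pt > 0" using domD[OF x] by simp

lemma sgrad_u: "sgrad u pt = dir"
proof -
  have "pd (0, y) u pt = y \<bullet> sgn x" for y
    by (rule pd_slice[where N = "{x. (t, x) \<in> dom}" and g = "\<lambda>z. norm z - r0"])
       (use open_slice x domD u_init diff_u x_nz in \<open>auto intro!: derivative_eq_intros has_derivative_norm\<close>)
  then show ?thesis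
    by (simp add: sgrad_def ex_def vec_eq_iff inner_axis' sgn_div_norm)
qed

lemma dt_u: "pd et u pt = c pt"
  using norm_sgrad_u[OF x] norm_dir cpos unfolding sgrad_u by (simp add: field_simps)

lemma mu_slice: "mu G \<phi> u pt = c pt"
proof -
  have f: "pd X fst q = fst X" for X q :: spacetime
    by (rule pd_eqI) (auto intro!: derivative_eq_intros)
  have "sgrad fst pt = 0" by (simp add: sgrad_def vec_eq_iff f ex_def)
  then show ?thesis
    unfolding mu_def ginv_sgrad dt_u f using cpos by (simp add: et_def power2_eq_square field_simps)
qed

lemma pd_u_slice: "pd X u pt = fst X * c pt + snd X \<bullet> dir"
  using pd_u[OF x, of X] by (simp add: dt_u sgrad_u)

lemma TS_slice: "TS u pt = {X. fst X = 0 \<and> snd X \<bullet> dir = 0}"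
  unfolding TS_def by (auto simp: pd_u_slice)

lemma Lbar_slice: "Lbar G \<phi> u pt = (1, - c pt *\<^sub>R dir)"
  unfolding Lbar_dom[OF x] dt_u sgrad_u by (simp add: power2_eq_square)

lemma Tvec_slice: "Tvec G \<phi> u pt = (0, dir)"
  unfolding Tvec_def
proof (rule the_equality)
  show "fst (0, dir) = 0 \<and> (\<forall>Y\<in>TS u pt. gmet G \<phi> pt (0, dir) Y = 0) \<and> pd (0, dir) u pt = 1"
    unfolding TS_slice pd_u_slice using norm_dir[unfolded norm_eq_1]
    by (auto simp: gmet_def inner_commute simp del: inner_scaleR_left inner_scaleR_right)
  fix X assume X: "fst X = 0 \<and> (\<forall>Y\<in>TS u pt. gmet G \<phi> pt X Y = 0) \<and> pd X u pt = 1"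
  then have "fst X = 0" "pd X u pt = 1" by auto
  then have 1: "snd X \<bullet> dir = 1" by (simp add: pd_u_slice)
  define z where "z = snd X - dir"
  have ww: "dir \<bullet> dir = 1" using norm_dir norm_eq_1 by blast
  have z: "z \<bullet> dir = 0" unfolding z_def inner_diff_left 1 ww by simp
  then have "(0, z) \<in> TS u pt" by (simp add: TS_slice)
  then have "snd X \<bullet> z = 0" using X by (auto simp: gmet_def)
  then have "z \<bullet> z = 0" using z unfolding z_def[symmetric]
    by (metis z_def inner_diff_left inner_commute diff_zero)
  then show "X = (0, dir)" using X by (auto simp: z_def prod_eq_iff)
qed

lemma Lvec_slice: "Lvec G \<phi> u pt = (1 / c pt, dir)"
proof -
  have "(1 / k) *\<^sub>R (1, - k *\<^sub>R w) + 2 *\<^sub>R (0, w) = (1 / k, w)" if "k > 0" for k and w :: "real^3"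
    using that by (simp add: vec_eq_iff)
  from this[OF cpos, of dir] show ?thesis
    unfolding Lvec_def mu_slice Lbar_slice Tvec_slice using cpos by (simp add: power2_eq_square)
qed

lemma dS_sq_slice:
  assumes "\<psi> differentiable (at pt)"
  shows "dS_sq G \<phi> u \<psi> pt = (norm (sgrad \<psi> pt))\<^sup>2 - (dir \<bullet> sgrad \<psi> pt)\<^sup>2"
  unfolding dS_sq_def
proof (rule trace2_perp[OF norm_dir TS_slice, of 1])
  fix a b :: "real^3" assume ab: "norm a = 1" "norm b = 1" "a \<bullet> b = 0" "a \<bullet> dir = 0" "b \<bullet> dir = 0"
  show "pd (0, a /\<^sub>R sqrt 1) \<psi> pt * pd (0, a /\<^sub>R sqrt 1) \<psi> pt
      + pd (0, b /\<^sub>R sqrt 1) \<psi> pt * pd (0, b /\<^sub>R sqrt 1) \<psi> pt = (norm (sgrad \<psi> pt))\<^sup>2 - (dir \<bullet> sgrad \<psi> pt)\<^sup>2"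
    using orthonormal_perp_Parseval[OF ab(1,2) norm_dir ab(3-5), of "sgrad \<psi> pt"]
    using pd_spacetime[OF assms, of "(0, a)"] pd_spacetime[OF assms, of "(0, b)"] by (simp add: power2_eq_square dot_square_norm)
qed (simp_all add: gmet_def)

lemma diff_Lbar: "Lbar G \<phi> u differentiable (at pt)"
proof -
  have sg: "sgrad u = (\<lambda>q. \<Sum>i\<in>UNIV. pd (ex i) u q *\<^sub>R axis i 1)"
    by (simp add: sgrad_def fun_eq_iff vec_eq_iff axis_def if_distrib cong: if_cong)
  have "((\<lambda>q. \<Sum>i\<in>UNIV. pd (ex i) u q *\<^sub>R axis i 1) has_derivative
      (\<lambda>X. \<Sum>i\<in>UNIV. pd X (pd (ex i) u) pt *\<^sub>R axis i (1::real))) (at pt)"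
    by (intro has_derivative_sum has_derivative_scaleR_left has_derivative_pd
        Cinf_on_differentiable[OF Cinf_on_pd[OF smooth_u] open_V]) (use domD[OF x] in auto)
  then have d: "sgrad u differentiable (at pt)"
    unfolding sg by (rule differentiableI)
  have "(\<lambda>q. (1::real, - ((c q)\<^sup>2 / pd et u q) *\<^sub>R sgrad u q)) differentiable (at pt)"
  proof -
    have "c differentiable (at pt)"
      using has_derivative_wave_speed[OF diff_\<phi>t] domD[OF x] differentiableI by blast
    moreover have "pd et u differentiable (at pt)"
      using Cinf_on_differentiable[OF Cinf_on_pd[OF smooth_u] open_V] domD[OF x] by simp
    moreover have "pd et u pt \<noteq> 0" using dt_u cpos by simp
    ultimately obtain D1 D2 D3 where "(c has_derivative D1) (at pt)" "(pd et u has_derivative D2) (at pt)"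
      "(sgrad u has_derivative D3) (at pt)" "pd et u pt \<noteq> 0" using d unfolding differentiable_def by blast
    then show ?thesis by (intro differentiableI) (rule derivative_eq_intros refl | assumption)+
  qed
  then obtain D where "((\<lambda>q. (1::real, - ((c q)\<^sup>2 / pd et u q) *\<^sub>R sgrad u q)) has_derivative D) (at pt)"
    unfolding differentiable_def by blast
  then have "(Lbar G \<phi> u has_derivative D) (at pt)"
    by (rule has_derivative_transform_within_open[OF _ open_dom x]) (simp add: Lbar_dom)
  then show ?thesis by (rule differentiableI)
qed

end

text \<open>In a direction tangent to the slice the values of \<open>Lbar\<close> there suffice, and
  these are explicit. The radial coefficient \<open>k\<close>, which contains the derivative of the
  wave speed, stays unspecified: it disappears when paired with vectors tangent to the
  sphere.\<close>

lemma pd_Lbar_slice: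
  assumes x: "(t, x) \<in> dom" and y: "y \<bullet> x = 0"
  shows "\<exists>k. pd (0, y) (Lbar G \<phi> u) (t, x) = (0, k *\<^sub>R x - (c (t, x) / norm x) *\<^sub>R y)"
proof -
  have nz: "x \<noteq> 0" using x_nz[OF x] .
  have "(c has_derivative (\<lambda>X. pd X c (t, x))) (at (t, x))"
    using has_derivative_wave_speed[OF diff_\<phi>t] domD[OF x] differentiableI has_derivative_pd by blast
  moreover have "((\<lambda>z. (t, z)) has_derivative (\<lambda>y. (0, y))) (at x)"
    by (auto intro!: derivative_eq_intros)
  ultimately have dc: "((\<lambda>z. c (t, z)) has_derivative (\<lambda>y. pd (0, y) c (t, x))) (at x)"
    using has_derivative_compose by blast
  have dn: "((\<lambda>z. z /\<^sub>R norm z) has_derivative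
      (\<lambda>y. (inverse (norm x)) *\<^sub>R y - ((y \<bullet> sgn x) / (norm x)\<^sup>2) *\<^sub>R x)) (at x)"
  proof -
    have "norm x \<noteq> 0" using nz by simp
    from has_derivative_scaleR[OF Deriv.has_derivative_inverse[OF this has_derivative_norm[OF nz]] has_derivative_ident]
    show ?thesis
      by (rule has_derivative_eq_rhs) (simp add: fun_eq_iff power2_eq_square divide_inverse inner_commute mult_ac)
  qed
  have "((\<lambda>z. (1::real, - c (t, z) *\<^sub>R (z /\<^sub>R norm z))) has_derivative
      (\<lambda>y. (0, - c (t, x) *\<^sub>R ((inverse (norm x)) *\<^sub>R y - ((y \<bullet> sgn x) / (norm x)\<^sup>2) *\<^sub>R x)
         + (- pd (0, y) c (t, x)) *\<^sub>R (x /\<^sub>R norm x)))) (at x)"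
    by (rule has_derivative_Pair[OF has_derivative_const has_derivative_scaleR[OF has_derivative_minus[OF dc] dn]])
  from pd_slice[OF diff_Lbar[OF x] open_slice _ _ this, of y]
  have "pd (0, y) (Lbar G \<phi> u) (t, x) = (0, - c (t, x) *\<^sub>R ((inverse (norm x)) *\<^sub>R y
      - ((y \<bullet> sgn x) / (norm x)\<^sup>2) *\<^sub>R x) + (- pd (0, y) c (t, x)) *\<^sub>R (x /\<^sub>R norm x))"
    using x Lbar_slice by simp
  moreover have "y \<bullet> sgn x = 0" using y by (simp add: sgn_div_norm)
  ultimately show ?thesis
    by (intro exI[of _ "- pd (0, y) c (t, x) / norm x"]) (simp add: divide_inverse)
qed

text \<open>On tangent vectors the derivative of -c x/|x| gives -1/r, and the Christoffel part gives
  half the derivative of the conformal factor 1/c along \<open>Lbar\<close>. Tracing with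
  \<open>gtilde\<close> multiplies the sum by 2c.\<close>

lemma tr_chi_slice:
  assumes x: "(t, x) \<in> dom"
  shows "tr_chi G \<phi> u (t, x) = - 2 * c (t, x) / norm x
    + 3 * G * (c (t, x))\<^sup>2 * pd et \<phi> (t, x) * pd (1, - c (t, x) *\<^sub>R (x /\<^sub>R norm x)) (pd et \<phi>) (t, x)"
proof -
  let ?p = "(t, x)" and ?\<omega> = "x /\<^sub>R norm x"
  note d = domD[OF x]
  have nz: "x \<noteq> 0" using x_nz[OF x] .
  define L where "L = (1::real, - c ?p *\<^sub>R ?\<omega>)"
  define l where "l = pd L (\<lambda>q. inverse (c q)) ?p"
  have dic: "((\<lambda>q. inverse (c q)) has_derivative
      (\<lambda>X. 3 * G * c ?p * pd et \<phi> ?p * pd X (pd et \<phi>) ?p)) (at ?p)"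
    using d by (auto intro!: derivative_eq_intros has_derivative_wave_speed diff_\<phi>t
        simp: fun_eq_iff field_simps power3_eq_cube)
  then have l: "l = 3 * G * c ?p * pd et \<phi> ?p * pd L (pd et \<phi>) ?p"
    unfolding l_def by (rule pd_eqI)
  have k: "levi_civita (gtilde G \<phi>) (Lbar G \<phi> u) ?p (0, y) (0, z) = (l / 2 - 1 / norm x) * (y \<bullet> z)"
    if y: "y \<bullet> ?\<omega> = 0" and z: "z \<bullet> ?\<omega> = 0" for y z
  proof -
    have yz: "y \<bullet> x = 0" "x \<bullet> z = 0" using y z nz by (auto simp: inner_commute)
    have "(\<lambda>q. gtilde G \<phi> q (0, y) (0, z)) = (\<lambda>q. (y \<bullet> z) * inverse (c q))"
      by (simp add: gtilde_def gmet_def fun_eq_iff divide_inverse)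
    then have 1: "pd L (\<lambda>q. gtilde G \<phi> q (0, y) (0, z)) ?p = (y \<bullet> z) * l"
      unfolding l_def
      using pd_eqI[OF has_derivative_mult_right[OF has_derivative_pd[OF differentiableI[OF dic]]]] by simp
    \<comment> \<open>The vectors are held constant, so these mixed components vanish identically in
      \<open>q\<close>; of the three Christoffel terms only the derivative along \<open>L\<close>
      survives.\<close>
    have 2: "(\<lambda>q. gtilde G \<phi> q L (0, z)) = (\<lambda>q. 0)" "(\<lambda>q. gtilde G \<phi> q (0, y) L) = (\<lambda>q. 0)"
      using yz by (auto simp: gtilde_def gmet_def fun_eq_iff L_def)
    have "christoffel (gtilde G \<phi>) ?p (0, y) L (0, z) = l / 2 * (y \<bullet> z)"
      unfolding christoffel_def 1 2 by (simp add: pd_def)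
    moreover obtain m where "pd (0, y) (Lbar G \<phi> u) ?p = (0, m *\<^sub>R x - (c ?p / norm x) *\<^sub>R y)"
      using pd_Lbar_slice[OF x yz(1)] by blast
    then have "gtilde G \<phi> ?p (pd (0, y) (Lbar G \<phi> u) ?p) (0, z) = - (y \<bullet> z) / norm x"
      using yz d by (simp add: gtilde_def gmet_def inner_diff_left)
    ultimately show ?thesis
      unfolding levi_civita_def Lbar_slice[OF x] L_def[symmetric] by (simp add: algebra_simps)
  qed
  have "tr_chi G \<phi> u ?p = 2 * c ?p * (l / 2 - 1 / norm x)"
    unfolding tr_chi_def
  proof (rule trace2_perp[OF norm_dir[OF x] TS_slice[OF x], of "inverse (c ?p)"])
    fix a b :: "real^3" assume "norm a = 1" "norm b = 1" "a \<bullet> b = 0" "a \<bullet> ?\<omega> = 0" "b \<bullet> ?\<omega> = 0"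
    then show "levi_civita (gtilde G \<phi>) (Lbar G \<phi> u) ?p (0, a /\<^sub>R sqrt (inverse (c ?p))) (0, a /\<^sub>R sqrt (inverse (c ?p)))
      + levi_civita (gtilde G \<phi>) (Lbar G \<phi> u) ?p (0, b /\<^sub>R sqrt (inverse (c ?p))) (0, b /\<^sub>R sqrt (inverse (c ?p)))
      = 2 * c ?p * (l / 2 - 1 / norm x)"
      using d by (subst (1 2) k) (auto simp: norm_eq_1 inner_commute real_sqrt_inverse field_simps)
  qed (use d in \<open>simp_all add: gtilde_def gmet_def divide_inverse\<close>)
  then show ?thesis unfolding l L_def by (simp add: field_simps power2_eq_square)
qed

end


section \<open>Homogeneous functions\<close>

lemma pd_et_eq: "pd (a, y) f p = a * pd et f p + y \<bullet> sgrad f p" if "f differentiable (at p)"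
  using pd_spacetime[OF that, of "(a, y)"] by simp

text \<open>A derivative of 1/|x| is a linear function times the cube of 1/|x|, so the induction
  closes under products.\<close>

lemma Ck_on_inverse_norm_snd: "Ck_on k (\<lambda>p::spacetime. inverse (norm (snd p))) {p. snd p \<noteq> 0}"
proof (induction k)
  case 0 then show ?case by (auto intro!: continuous_intros)
next
  case (Suc k)
  have op: "open ({p. snd p \<noteq> 0} :: spacetime set)"
    by (intro open_Collect_neq continuous_intros)
  have d: "((\<lambda>p::spacetime. inverse (norm (snd p))) has_derivative
      (\<lambda>X. - (inverse (norm (snd p)) * (snd X \<bullet> sgn (snd p)) * inverse (norm (snd p))))) (at p)"
    if "snd p \<noteq> 0" for p :: spacetime
  proof -
    have "((\<lambda>p. norm (snd p)) has_derivative (\<lambda>X. snd X \<bullet> sgn (snd p))) (at p)"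
      by (rule has_derivative_compose[where f = snd and g = norm, OF _ has_derivative_norm[OF that]]) (auto intro!: derivative_eq_intros)
    then show ?thesis using that by (intro Deriv.has_derivative_inverse) auto
  qed
  have e: "pd b (\<lambda>p. inverse (norm (snd p))) p =
      - 1 * ((snd p \<bullet> snd b) * (inverse (norm (snd p)) * (inverse (norm (snd p)) * inverse (norm (snd p)))))"
    if "snd p \<noteq> 0" for p b :: spacetime
    by (subst pd_eqI[OF d[OF that]]) (simp add: sgn_div_norm inner_commute)
  have "Ck_on k (pd b (\<lambda>p. inverse (norm (snd p)))) {p. snd p \<noteq> 0}" for b :: spacetime
  proof (subst Ck_on_cong[OF op])
    show "Ck_on k (\<lambda>p::spacetime. - 1 * ((snd p \<bullet> snd b) * (inverse (norm (snd p)) *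
        (inverse (norm (snd p)) * inverse (norm (snd p)))))) {p. snd p \<noteq> 0}"
      by (intro Ck_on_mult[OF op] Ck_on_const Suc Ck_on_linear
          bounded_linear_compose[OF bounded_linear_inner_left bounded_linear_snd])
  qed (use e in simp)
  moreover have "(\<lambda>p::spacetime. inverse (norm (snd p))) differentiable_on {p. snd p \<noteq> 0}"
    unfolding differentiable_on_eq_differentiable_at[OF op] using d differentiableI by blast
  ultimately show ?case by simp
qed

definition cone :: "spacetime set \<Rightarrow> spacetime set" where
  "cone W = {p. snd p \<noteq> 0 \<and> (fst p, snd p /\<^sub>R norm (snd p)) \<in> W}"

lemma open_cone: assumes "open W" shows "open (cone W)"
proof -
  have "continuous_on {p. snd p \<noteq> 0} (\<lambda>p::spacetime. (fst p, snd p /\<^sub>R norm (snd p)))"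
    by (auto intro!: continuous_intros)
  from continuous_open_preimage[OF this _ assms]
  have "open ({p. snd p \<noteq> 0} \<inter> (\<lambda>p. (fst p, snd p /\<^sub>R norm (snd p))) -` W)"
    by (simp add: open_Collect_neq continuous_on_snd)
  moreover have "{p. snd p \<noteq> 0} \<inter> (\<lambda>p. (fst p, snd p /\<^sub>R norm (snd p))) -` W = cone W"
    by (auto simp: cone_def)
  ultimately show ?thesis by simp
qed

lemma Cinf_on_hom0:
  assumes "open W" "Cinf_on F W" shows "Cinf_on (hom0 F) (cone W)"
  unfolding Cinf_on_def
proof
  fix k
  have "Ck_on k (\<lambda>p. F (fst p, snd p /\<^sub>R norm (snd p))) (cone W)"
  proof (rule Ck_on_compose[OF open_cone[OF assms(1)] assms(1)])
    show "Ck_on k F W" using assms(2) by (simp add: Cinf_on_def)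
    fix b :: spacetime
    have "Ck_on k (\<lambda>p. fst p * fst b + (snd p \<bullet> snd b) * inverse (norm (snd p))) (cone W)"
      by (intro Ck_on_add Ck_on_mult open_cone assms Ck_on_const Ck_on_subset[OF Ck_on_inverse_norm_snd]
          Ck_on_linear bounded_linear_fst bounded_linear_compose[OF bounded_linear_inner_left bounded_linear_snd])
         (auto simp: cone_def)
    then show "Ck_on k (\<lambda>p. (fst p, snd p /\<^sub>R norm (snd p)) \<bullet> b) (cone W)"
      by (simp add: inner_prod_def mult.commute)
  qed (auto simp: cone_def)
  then show "Ck_on k (hom0 F) (cone W)" by (simp add: hom0_def case_prod_beta')
qed

text \<open>Homogeneity of degree \<open>- k\<close> in the second variable. Starting from degree
  zero, each derivative in x lowers the degree by one, so a natural exponent suffices.\<close>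

definition homog :: "nat \<Rightarrow> spacetime set \<Rightarrow> (spacetime \<Rightarrow> real) \<Rightarrow> bool" where
  "homog k S f \<longleftrightarrow> (\<forall>s x l. (s, x) \<in> S \<longrightarrow> l > 0 \<longrightarrow> (s, l *\<^sub>R x) \<in> S \<and> f (s, l *\<^sub>R x) = f (s, x) / l ^ k)"

lemma homogD: "homog k S f \<Longrightarrow> (s, x) \<in> S \<Longrightarrow> l > 0 \<Longrightarrow> f (s, l *\<^sub>R x) = f (s, x) / l ^ k"
  unfolding homog_def by blast

lemma pd_homog:
  assumes h: "homog k S f" and "open S" and d: "\<And>p. p \<in> S \<Longrightarrow> f differentiable (at p)"
    and x: "(s, x) \<in> S" and l: "l > 0"
  shows "pd (a, l *\<^sub>R y) f (s, l *\<^sub>R x) = pd (a, y) f (s, x) / l ^ k"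
proof -
  have "((\<lambda>p. f (fst p, l *\<^sub>R snd p)) has_derivative (\<lambda>X. pd (fst X, l *\<^sub>R snd X) f (s, l *\<^sub>R x))) (at (s, x))"
    by (rule has_derivative_compose[where g = f and f = "\<lambda>p. (fst p, l *\<^sub>R snd p)"])
       (use h x l in \<open>auto intro!: derivative_eq_intros has_derivative_pd d simp: homog_def\<close>)
  then have "((\<lambda>p. f p / l ^ k) has_derivative (\<lambda>X. pd (fst X, l *\<^sub>R snd X) f (s, l *\<^sub>R x))) (at (s, x))"
    by (rule has_derivative_transform_within_open[OF _ \<open>open S\<close> x])
       (use h l in \<open>auto simp: homog_def\<close>)
  moreover have "((\<lambda>p. f p / l ^ k) has_derivative (\<lambda>X. pd X f (s, x) / l ^ k)) (at (s, x))"
    by (rule bounded_linear.has_derivative[OF bounded_linear_divide has_derivative_pd[OF d[OF x]]])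
  ultimately have "(\<lambda>X. pd (fst X, l *\<^sub>R snd X) f (s, l *\<^sub>R x)) = (\<lambda>X. pd X f (s, x) / l ^ k)"
    by (rule has_derivative_unique)
  from fun_cong[OF this, of "(a, y)"] show ?thesis by simp
qed

lemma homog_pd_et:
  assumes "homog k S f" "open S" "Cinf_on f S" shows "homog k S (pd et f)"
  unfolding homog_def et_def
  using pd_homog[OF assms(1,2), of _ _ _ 1 0] Cinf_on_differentiable[OF assms(3,2)] assms(1)
  by (auto simp: homog_def)

lemma homog_pd_ex:
  assumes "homog k S f" "open S" "Cinf_on f S" shows "homog (Suc k) S (pd (ex i) f)"
proof -
  have d: "f differentiable (at p)" if "p \<in> S" for p using Cinf_on_differentiable assms that by blast
  have "pd (ex i) f (s, l *\<^sub>R x) = pd (ex i) f (s, x) / l ^ Suc k" if x: "(s, x) \<in> S" and l: "l > 0" for s x l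
  proof -
    have "(s, l *\<^sub>R x) \<in> S" using assms(1) that by (simp add: homog_def)
    then have "pd (0, l *\<^sub>R axis i 1) f (s, l *\<^sub>R x) = l * pd (ex i) f (s, l *\<^sub>R x)"
      using pd_scale[OF d, of "(s, l *\<^sub>R x)" l "ex i"] by (simp add: ex_def)
    moreover have "pd (0, l *\<^sub>R axis i 1) f (s, l *\<^sub>R x) = pd (ex i) f (s, x) / l ^ k"
      unfolding ex_def by (rule pd_homog[OF assms(1,2) d x l])
    ultimately show ?thesis using l by (simp add: field_simps)
  qed
  then show ?thesis using assms(1) by (simp add: homog_def)
qed

lemma sgrad_homog:
  assumes "homog k S f" "open S" "Cinf_on f S" "(s, x) \<in> S" "l > 0"
  shows "sgrad f (s, l *\<^sub>R x) = sgrad f (s, x) /\<^sub>R l ^ Suc k"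
  using homogD[OF homog_pd_ex[OF assms(1-3)] assms(4,5)]
  by (simp add: sgrad_def vec_eq_iff divide_inverse)

text \<open>Euler's identity, from differentiating along the ray at l = 1. In degree zero it says
  that the gradient is tangent to the spheres.\<close>

lemma homog_Euler:
  assumes h: "homog k S f" and "open S" "Cinf_on f S" and x: "(s, x) \<in> S"
  shows "x \<bullet> sgrad f (s, x) = - real k * f (s, x)"
proof -
  have d: "f differentiable (at (s, x))" using Cinf_on_differentiable assms by blast
  have "((\<lambda>l. f (s, l *\<^sub>R x)) has_derivative (\<lambda>r. pd (0, r *\<^sub>R x) f (s, 1 *\<^sub>R x))) (at 1)"
    by (rule has_derivative_compose[where g = f and f = "\<lambda>l. (s, l *\<^sub>R x)"])
       (use has_derivative_pd[OF d] in \<open>auto intro!: derivative_eq_intros\<close>)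
  then have "((\<lambda>l. f (s, x) / l ^ k) has_derivative (\<lambda>r. pd (0, r *\<^sub>R x) f (s, 1 *\<^sub>R x))) (at 1)"
    by (rule has_derivative_transform_within_open[where s = "{0<..}"])
       (use homogD[OF h x] in auto)
  moreover have "((\<lambda>l. f (s, x) / l ^ k) has_real_derivative (- real k * f (s, x))) (at 1)"
    by (cases k) (auto intro!: derivative_eq_intros simp: algebra_simps)
  then have "((\<lambda>l. f (s, x) / l ^ k) has_derivative (\<lambda>r. r * (- real k * f (s, x)))) (at 1)"
    unfolding has_field_derivative_def by (rule has_derivative_eq_rhs) (simp add: fun_eq_iff)
  ultimately have "(\<lambda>r. pd (0, r *\<^sub>R x) f (s, 1 *\<^sub>R x)) = (\<lambda>r. r * (- real k * f (s, x)))"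
    by (rule has_derivative_unique)
  from fun_cong[OF this, of 1] show ?thesis using pd_et_eq[OF d, of 0 x] by simp
qed

lemma has_derivative_shell:
  fixes f :: "spacetime \<Rightarrow> real"
  assumes "f differentiable (at ((norm x - r0) / \<delta>, x))" "x \<noteq> 0"
  shows "((\<lambda>z. f ((norm z - r0) / \<delta>, z)) has_derivative
    (\<lambda>y. (y \<bullet> sgn x) / \<delta> * pd et f ((norm x - r0) / \<delta>, x) + y \<bullet> sgrad f ((norm x - r0) / \<delta>, x))) (at x)"
proof -
  have "((\<lambda>z. ((norm z - r0) / \<delta>, z)) has_derivative (\<lambda>y. ((y \<bullet> sgn x) / \<delta>, y))) (at x)"
    using has_derivative_norm[OF assms(2)]
    by (auto intro!: derivative_eq_intros simp: divide_inverse)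
  from has_derivative_compose[OF this has_derivative_pd[OF assms(1)]]
  show ?thesis by (simp add: pd_et_eq[OF assms(1)])
qed

lemma has_derivative_sgn_component:
  fixes x :: "real^'n"
  assumes "x \<noteq> 0"
  shows "((\<lambda>z. z $ i / norm z) has_derivative (\<lambda>y. (y $ i - (y \<bullet> sgn x) * sgn x $ i) / norm x)) (at x)"
proof -
  have "((\<lambda>z. z $ i * inverse (norm z)) has_derivative
     (\<lambda>y. x $ i * - (inverse (norm x) * (y \<bullet> sgn x) * inverse (norm x)) + y $ i * inverse (norm x))) (at x)"
    using assms
    by (intro has_derivative_mult Deriv.has_derivative_inverse has_derivative_norm
        bounded_linear.has_derivative[OF bounded_linear_vec_nth has_derivative_ident]) auto
  then show ?thesis
    unfolding divide_inverse[of "_ $ i", symmetric]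
    by (rule has_derivative_eq_rhs) (use assms in \<open>auto simp: fun_eq_iff sgn_div_norm field_simps\<close>)
qed

text \<open>Landau's inequality on the segment from \<open>\<omega>\<close> in the direction of the \<open>j\<close>-th axis.\<close>

lemma homog_gradient_interpolation:
  assumes h: "homog 0 S f" and S: "open S" "Cinf_on f S"
    and s: "\<And>x. x \<noteq> 0 \<Longrightarrow> (s, x) \<in> S" and \<omega>: "norm \<omega> = 1"
    and small: "\<And>x. norm x = 1 \<Longrightarrow> \<bar>f (s, x)\<bar> \<le> \<eta>"
    and bdd: "\<And>x. norm x = 1 \<Longrightarrow> \<bar>pd (ex j) (pd (ex j) f) (s, x)\<bar> \<le> M"
    and \<tau>: "0 < \<tau>" "\<tau> \<le> 1/2"
  shows "\<bar>pd (ex j) f (s, \<omega>)\<bar> \<le> 2 * \<eta> / \<tau> + 4 * M * \<tau>"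
proof -
  \<comment> \<open>The segment leaves the unit sphere but stays at distance at least 1/2 from the
    origin, so homogeneity carries the bounds over to it. The second derivative has degree -2,
    whence the factor 4.\<close>
  let ?z = "\<lambda>t. \<omega> + t *\<^sub>R axis j 1"
  have nz: "norm (?z t) \<ge> 1/2" if "0 \<le> t" "t \<le> 1/2" for t
  proof -
    have "norm \<omega> - norm (t *\<^sub>R axis j (1::real)) \<le> norm (?z t)" by (rule norm_diff_ineq)
    then show ?thesis using \<omega> that by simp
  qed
  have line: "((\<lambda>t. F (s, ?z t)) has_real_derivative pd (ex j) F (s, ?z t)) (at t)"
    if F: "Cinf_on F S" and t: "0 \<le> t" "t \<le> 1/2" for F t
  proof -
    have "?z t \<noteq> 0" using nz[OF t] by auto
    then have d: "F differentiable (at (s, ?z t))" using s F S(1) Cinf_on_differentiable by blast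
    have "((\<lambda>t. F (s, ?z t)) has_derivative (\<lambda>r. pd (0, r *\<^sub>R axis j 1) F (s, ?z t))) (at t)"
      by (rule has_derivative_compose[where g = F and f = "\<lambda>t. (s, ?z t)", OF _ has_derivative_pd[OF d]])
         (auto intro!: derivative_eq_intros)
    moreover have "pd (0, r *\<^sub>R axis j 1) F (s, ?z t) = pd (ex j) F (s, ?z t) * r" for r
      using pd_scale[OF d, of r "ex j"] by (simp add: ex_def mult.commute)
    ultimately show ?thesis by (simp add: has_field_derivative_def fun_eq_iff)
  qed
  have unit: "F (s, x) = F (s, sgn x) / norm x ^ k" if "homog k S F" "x \<noteq> 0" for F k x
    using homogD[OF that(1) s, of "sgn x" "norm x"] that(2) by (simp add: sgn_div_norm sgn_zero_iff)
  have sm: "\<bar>f (s, x)\<bar> \<le> \<eta>" if "x \<noteq> 0" for x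
    using small[of "sgn x"] unit[OF h that] that by (simp add: norm_sgn)
  have bd: "\<bar>pd (ex j) (pd (ex j) f) (s, ?z t)\<bar> \<le> 4 * M" if t: "0 \<le> t" "t \<le> 1/2" for t
  proof -
    have z: "?z t \<noteq> 0" using nz[OF t] by auto
    have "homog 2 S (pd (ex j) (pd (ex j) f))"
      using homog_pd_ex[OF homog_pd_ex[OF h S] S(1) Cinf_on_pd[OF S(2)]] by (simp add: numeral_2_eq_2)
    from unit[OF this z] have "\<bar>pd (ex j) (pd (ex j) f) (s, ?z t)\<bar> =
        \<bar>pd (ex j) (pd (ex j) f) (s, sgn (?z t))\<bar> / (norm (?z t))\<^sup>2" by simp
    also have "\<dots> \<le> M / (1/2)\<^sup>2"
      using bdd[of "sgn (?z t)"] z nz[OF t] by (intro frac_le power_mono) (auto simp: norm_sgn)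
    also have "\<dots> = 4 * M" by (simp add: power2_eq_square)
    finally show ?thesis .
  qed
  \<comment> \<open>Somewhere on the segment the derivative is at most 2 \<eta> / \<tau>; a second
    use of the mean value theorem bounds its change on the way back to \<omega>.\<close>
  obtain a where a: "0 < a" "a < \<tau>" "f (s, ?z \<tau>) - f (s, ?z 0) = (\<tau> - 0) * pd (ex j) f (s, ?z a)"
    using MVT2[of 0 \<tau> "\<lambda>t. f (s, ?z t)" "\<lambda>t. pd (ex j) f (s, ?z t)"] line[OF S(2)] \<tau> by auto
  obtain b where b: "0 < b" "b < a"
    "pd (ex j) f (s, ?z a) - pd (ex j) f (s, ?z 0) = (a - 0) * pd (ex j) (pd (ex j) f) (s, ?z b)"
    using MVT2[of 0 a "\<lambda>t. pd (ex j) f (s, ?z t)" "\<lambda>t. pd (ex j) (pd (ex j) f) (s, ?z t)"]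
      line[OF Cinf_on_pd[OF S(2)], of "ex j"] a \<tau> by auto
  have "\<bar>\<tau> * pd (ex j) f (s, ?z a)\<bar> \<le> 2 * \<eta>"
  proof -
    have "?z \<tau> \<noteq> 0" "?z 0 \<noteq> 0" using nz[of \<tau>] nz[of 0] \<tau> by auto
    then show ?thesis using a(3) sm[OF \<open>?z \<tau> \<noteq> 0\<close>] sm[OF \<open>?z 0 \<noteq> 0\<close>] by simp
  qed
  then have 1: "\<bar>pd (ex j) f (s, ?z a)\<bar> \<le> 2 * \<eta> / \<tau>" using \<tau> by (simp add: abs_mult field_simps)
  have "\<bar>a * pd (ex j) (pd (ex j) f) (s, ?z b)\<bar> \<le> \<tau> * (4 * M)"
    unfolding abs_mult using a b \<tau> bd[of b] by (intro mult_mono) auto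
  then show ?thesis using 1 b(3) by (simp add: mult_ac)
qed


section \<open>Asymptotic equality\<close>

text \<open>The comparison function need not have a limit: typically it is a value of the seed data
  at a point moving with x. Its boundedness is included so that the relation is preserved by
  products.\<close>

definition asym :: "(real \<Rightarrow> real) \<Rightarrow> (real \<Rightarrow> real) \<Rightarrow> bool" where
  "asym f g \<longleftrightarrow> ((\<lambda>x. f x - g x) \<longlongrightarrow> 0) at_top \<and> Bfun g at_top"

lemma tendsto_zero_mult_Bfun:
  fixes f g :: "'a \<Rightarrow> real"
  assumes "(f \<longlongrightarrow> 0) F" "Bfun g F" shows "((\<lambda>x. f x * g x) \<longlongrightarrow> 0) F"
  using bounded_bilinear.Zfun_prod_Bfun[OF bounded_bilinear_mult] assms by (simp add: tendsto_Zfun_iff)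

lemma Bfun_iff: "Bfun (f :: 'a \<Rightarrow> real) F \<longleftrightarrow> (\<exists>M. eventually (\<lambda>x. \<bar>f x\<bar> \<le> M) F)"
proof
  assume "\<exists>M. eventually (\<lambda>x. \<bar>f x\<bar> \<le> M) F"
  then show "Bfun f F" by (auto intro: BfunI)
next
  assume "Bfun f F"
  then obtain B where "eventually (\<lambda>x. norm (f x) \<le> B) F" by (rule BfunE)
  then show "\<exists>M. eventually (\<lambda>x. \<bar>f x\<bar> \<le> M) F" by auto
qed

lemma Bfun_add_real: "Bfun f F \<Longrightarrow> Bfun g F \<Longrightarrow> Bfun (\<lambda>x. f x + g x :: real) F"
  unfolding Bfun_iff
proof (elim exE)
  fix M N assume "eventually (\<lambda>x. \<bar>f x\<bar> \<le> M) F" "eventually (\<lambda>x. \<bar>g x\<bar> \<le> N) F"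
  then have "eventually (\<lambda>x. \<bar>f x + g x\<bar> \<le> M + N) F" by eventually_elim linarith
  then show "\<exists>M. eventually (\<lambda>x. \<bar>f x + g x\<bar> \<le> M) F" by blast
qed

lemma Bfun_mult_real: "Bfun f F \<Longrightarrow> Bfun g F \<Longrightarrow> Bfun (\<lambda>x. f x * g x :: real) F"
  unfolding Bfun_iff
proof (elim exE)
  fix M N assume "eventually (\<lambda>x. \<bar>f x\<bar> \<le> M) F" "eventually (\<lambda>x. \<bar>g x\<bar> \<le> N) F"
  then have "eventually (\<lambda>x. \<bar>f x * g x\<bar> \<le> \<bar>M\<bar> * \<bar>N\<bar>) F"
    by eventually_elim (auto simp: abs_mult intro!: mult_mono)
  then show "\<exists>M. eventually (\<lambda>x. \<bar>f x * g x\<bar> \<le> M) F" by blast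
qed

lemma asym_refl: "Bfun f at_top \<Longrightarrow> asym f f"
  by (simp add: asym_def)

lemma asym_const: "asym (\<lambda>x. a) (\<lambda>x. a)"
  by (simp add: asym_refl)

lemma asym_tendsto: "(f \<longlongrightarrow> l) at_top \<Longrightarrow> asym f (\<lambda>x. l)"
  by (simp add: asym_def LIM_zero)

lemma asym_tendstoD: "asym f (\<lambda>x. l) \<Longrightarrow> (f \<longlongrightarrow> l) at_top"
  by (simp add: asym_def LIM_zero_iff)

lemma asym_Bfun: assumes "asym f g" shows "Bfun f at_top"
proof -
  have "Bfun (\<lambda>x. f x - g x) at_top"
  proof -
    have "((\<lambda>x. f x - g x) \<longlongrightarrow> 0) at_top" using assms by (simp add: asym_def)
    from tendstoD[OF this, of 1] show ?thesis
      unfolding Bfun_iff by (intro exI[of _ 1]) (auto elim: eventually_mono)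
  qed
  then have "Bfun (\<lambda>x. (f x - g x) + g x) at_top"
    using assms by (intro Bfun_add_real) (auto simp: asym_def)
  then show ?thesis by simp
qed

lemma asym_sym: "asym f g \<Longrightarrow> asym g f"
  using asym_Bfun[of f g] tendsto_minus[of "\<lambda>x. f x - g x" 0 at_top] by (auto simp: asym_def)

lemma asym_trans: "asym f g \<Longrightarrow> asym g h \<Longrightarrow> asym f h"
  using tendsto_add[of "\<lambda>x. f x - g x" 0 at_top "\<lambda>x. g x - h x" 0] by (auto simp: asym_def)

lemma asym_eventually: "asym f g \<Longrightarrow> eventually (\<lambda>x. f' x = f x) at_top \<Longrightarrow> asym f' g"
  unfolding asym_def using tendsto_cong[of "\<lambda>x. f' x - g x" "\<lambda>x. f x - g x" at_top 0]
  by (auto elim: eventually_mono)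

lemma asym_add: assumes "asym f f'" "asym g g'" shows "asym (\<lambda>x. f x + g x) (\<lambda>x. f' x + g' x)"
proof -
  have "((\<lambda>x. (f x - f' x) + (g x - g' x)) \<longlongrightarrow> 0 + 0) at_top"
    using assms by (intro tendsto_add) (auto simp: asym_def)
  then show ?thesis using assms by (auto simp: asym_def intro!: Bfun_add_real simp: algebra_simps)
qed

lemma asym_mult: assumes "asym f f'" "asym g g'" shows "asym (\<lambda>x. f x * g x) (\<lambda>x. f' x * g' x)"
proof -
  have "((\<lambda>x. (f x - f' x) * g x + (g x - g' x) * f' x) \<longlongrightarrow> 0 + 0) at_top"
    using assms asym_Bfun[OF assms(2)] by (intro tendsto_add tendsto_zero_mult_Bfun) (auto simp: asym_def)
  then show ?thesis using assms by (auto simp: asym_def intro!: Bfun_mult_real simp: algebra_simps)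
qed

lemma asym_minus: "asym f f' \<Longrightarrow> asym (\<lambda>x. - f x) (\<lambda>x. - f' x)"
  using asym_mult[OF asym_const[of "-1"], of f f'] by simp

lemma asym_diff: "asym f f' \<Longrightarrow> asym g g' \<Longrightarrow> asym (\<lambda>x. f x - g x) (\<lambda>x. f' x - g' x)"
  using asym_add[OF _ asym_minus, of f f' g g'] by simp

lemma asym_power: "asym f f' \<Longrightarrow> asym (\<lambda>x. f x ^ n) (\<lambda>x. f' x ^ n)"
  by (induction n) (auto intro: asym_const asym_mult)

lemma asym_sum:
  "finite I \<Longrightarrow> (\<And>i. i \<in> I \<Longrightarrow> asym (f i) (g i)) \<Longrightarrow> asym (\<lambda>x. \<Sum>i\<in>I. f i x) (\<lambda>x. \<Sum>i\<in>I. g i x)"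
  by (induction I rule: finite_induct) (auto intro: asym_const asym_add)

lemma asym_inverse: "asym f (\<lambda>x. l) \<Longrightarrow> l \<noteq> 0 \<Longrightarrow> asym (\<lambda>x. inverse (f x)) (\<lambda>x. inverse l)"
  using asym_tendsto asym_tendstoD tendsto_inverse by metis

lemma asym_divide: "asym f f' \<Longrightarrow> asym g (\<lambda>x. l) \<Longrightarrow> l \<noteq> 0 \<Longrightarrow> asym (\<lambda>x. f x / g x) (\<lambda>x. f' x / l)"
  using asym_mult[OF _ asym_inverse] by (simp add: divide_inverse)

lemma asym_over_x: "asym f f' \<Longrightarrow> asym (\<lambda>x. f x / x) (\<lambda>x. 0)"
proof -
  assume f: "asym f f'"
  have "asym (\<lambda>x::real. inverse x) (\<lambda>x. 0)"
    by (intro asym_tendsto tendsto_inverse_0_at_top filterlim_ident)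
  from asym_mult[OF f this] show ?thesis by (simp add: divide_inverse)
qed

lemmas asym_intros = asym_const asym_add asym_diff asym_minus asym_mult asym_power asym_divide

lemma Bfun_bounded:
  assumes "\<And>x. \<bar>f x\<bar> \<le> M" shows "Bfun (f :: 'a \<Rightarrow> real) F"
  unfolding Bfun_iff by (intro exI[of _ M] always_eventually allI assms)

text \<open>Uniform convergence is convergence along every selection of points.\<close>

lemma uniform_if_all_selections:
  fixes f :: "real \<Rightarrow> 'a \<Rightarrow> real"
  assumes "S \<noteq> {}" "\<And>p. (\<And>x. p x \<in> S) \<Longrightarrow> ((\<lambda>x. f x (p x)) \<longlongrightarrow> 0) at_top" "e > 0"
  shows "eventually (\<lambda>x. \<forall>s\<in>S. \<bar>f x s\<bar> < e) at_top"
proof -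
  \<comment> \<open>A point violating the bound is selected whenever there is one, so convergence
    along this single selection excludes violations eventually.\<close>
  define p where "p x = (SOME s. s \<in> S \<and> ((\<exists>s\<in>S. \<bar>f x s\<bar> \<ge> e) \<longrightarrow> \<bar>f x s\<bar> \<ge> e))" for x
  have p: "p x \<in> S \<and> ((\<exists>s\<in>S. \<bar>f x s\<bar> \<ge> e) \<longrightarrow> \<bar>f x (p x)\<bar> \<ge> e)" for x
    unfolding p_def by (rule someI_ex) (use assms(1) in \<open>cases "\<exists>s\<in>S. \<bar>f x s\<bar> \<ge> e"; blast\<close>)
  then have "eventually (\<lambda>x. \<bar>f x (p x)\<bar> < e) at_top"
    using tendstoD[OF assms(2)[of p] assms(3)] by (simp add: dist_real_def)
  then show ?thesis by eventually_elim (use p not_le in blast)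
qed

text \<open>
  In the two lemmas below \<open>x\<close> is the radius \<open>r0\<close>, \<open>r = x / q\<close>, \<open>\<kappa>\<close> the null expansion and \<open>D\<close> the
  squared angular gradient; \<open>f\<close>, \<open>ft\<close>, \<open>fr\<close> are \<open>\<psi>\<close> and its time and radial derivatives.
\<close>

locale energy_asymptotics =
  fixes c q f ft fr D \<kappa> m d f' :: "real \<Rightarrow> real"
  assumes c: "asym c (\<lambda>x. 1)" and q: "asym q (\<lambda>x. 1)"
    and f: "asym (\<lambda>x. x * f x) f'"
    and fr: "asym (\<lambda>x. x * fr x) m"
    and Z: "asym (\<lambda>x. x\<^sup>2 * (ft x - c x * fr x - c x * q x / x * f x)) (\<lambda>x. 0)"
    and D: "asym (\<lambda>x. x ^ 4 * D x) d"
    and \<kappa>: "asym (\<lambda>x. x * \<kappa> x + 2 * c x * q x) (\<lambda>x. 0)"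
begin

lemma x_pos: "eventually (\<lambda>x::real. x > 0) at_top" by (rule eventually_gt_at_top)

lemma c_pos: "eventually (\<lambda>x. c x > 0) at_top"
  using asym_tendstoD[OF c] by (rule order_tendstoD) simp

lemma q_pos: "eventually (\<lambda>x. q x > 0) at_top"
  using asym_tendstoD[OF q] by (rule order_tendstoD) simp

text \<open>The term subtracted in \<open>Z\<close> is itself of order x^(-2), so it vanishes in the
  limit when the weight is x instead of x^2.\<close>

lemma incoming: "asym (\<lambda>x. x * (ft x - c x * fr x)) (\<lambda>x. 0)"
proof -
  have "asym (\<lambda>x. x\<^sup>2 * (ft x - c x * fr x - c x * q x / x * f x) / x + (c x * q x * (x * f x)) / x) (\<lambda>x. 0 + 0)"
    by (intro asym_intros asym_over_x[OF Z] asym_over_x[OF asym_mult[OF asym_mult[OF c q] f]])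
  then have "asym (\<lambda>x. x\<^sup>2 * (ft x - c x * fr x - c x * q x / x * f x) / x + (c x * q x * (x * f x)) / x) (\<lambda>x. 0)"
    by simp
  then show ?thesis
    by (rule asym_eventually) (use x_pos in eventually_elim, simp add: field_simps power2_eq_square)
qed

lemma energy0_asym:
  "asym (\<lambda>x. (x / q x)\<^sup>2 * (1 / (2 * c x) * ((ft x / c x + fr x)\<^sup>2 + 1 / c x * (ft x - c x * fr x)\<^sup>2
      + (c x + 1) * D x))) (\<lambda>x. 2 * (m x)\<^sup>2)"
proof -
  \<comment> \<open>The area supplies only two of the four powers of x at which the angular gradient
    would survive.\<close>
  have Dx: "asym (\<lambda>x. x ^ 4 * D x / x / x) (\<lambda>x. 0)" by (rule asym_over_x[OF asym_over_x[OF D]])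
  \<comment> \<open>The outgoing derivative ft/c + fr is the incoming one divided by c plus 2 fr.
    Only the latter survives, and (2m)^2 / 2 = 2 m^2.\<close>
  have "asym (\<lambda>x. 1 / (q x)\<^sup>2 * (1 / (2 * c x) * ((x * (ft x - c x * fr x) / c x + 2 * (x * fr x))\<^sup>2
      + 1 / c x * (x * (ft x - c x * fr x))\<^sup>2 + (c x + 1) * (x ^ 4 * D x / x / x))))
    (\<lambda>x. 1 / 1\<^sup>2 * (1 / (2 * 1) * ((0 / 1 + 2 * m x)\<^sup>2 + 1 / 1 * 0\<^sup>2 + (1 + 1) * 0)))"
    by (intro asym_intros incoming c fr Dx asym_power[OF q] asym_mult[OF asym_const c] asym_tendsto tendsto_const) auto
  then have "asym (\<lambda>x. 1 / (q x)\<^sup>2 * (1 / (2 * c x) * ((x * (ft x - c x * fr x) / c x + 2 * (x * fr x))\<^sup>2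
      + 1 / c x * (x * (ft x - c x * fr x))\<^sup>2 + (c x + 1) * (x ^ 4 * D x / x / x)))) (\<lambda>x. 2 * (m x)\<^sup>2)"
    by (simp add: power2_eq_square)
  then show ?thesis
  proof (rule asym_eventually)
    show "\<forall>\<^sub>F x in at_top. (x / q x)\<^sup>2 * (1 / (2 * c x) * ((ft x / c x + fr x)\<^sup>2
        + 1 / c x * (ft x - c x * fr x)\<^sup>2 + (c x + 1) * D x)) =
      1 / (q x)\<^sup>2 * (1 / (2 * c x) * ((x * (ft x - c x * fr x) / c x + 2 * (x * fr x))\<^sup>2
        + 1 / c x * (x * (ft x - c x * fr x))\<^sup>2 + (c x + 1) * (x ^ 4 * D x / x / x)))"
      using x_pos c_pos q_pos
    proof eventually_elim
      case (elim x)
      have "x * (ft x - c x * fr x) / c x + 2 * (x * fr x) = x * (ft x / c x + fr x)"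
        using elim by (simp add: field_simps)
      moreover have "x ^ 4 * D x / x / x = x\<^sup>2 * D x"
        using elim by (simp add: power2_eq_square power4_eq_xxxx)
      ultimately show ?case
        by (simp only: power_mult_distrib) (simp add: power_divide field_simps)
    qed
  qed
qed

lemma energy1_asym:
  "asym (\<lambda>x. (x / q x)\<^sup>2 * (1 / (2 * c x) * (4 * x / \<kappa> x) *
      (1 / c x * (ft x - c x * fr x + 1/2 * \<kappa> x * f x)\<^sup>2 + c x * D x))) (\<lambda>x. - d x)"
proof -
  \<comment> \<open>This is x^2 times the incoming derivative plus half the expansion times
    \<open>f\<close>, split so that \<open>Z\<close> controls the first summand and \<kappa>,
    against the bounded x f, the second.\<close>
  let ?X = "\<lambda>x. x\<^sup>2 * (ft x - c x * fr x - c x * q x / x * f x) + 1/2 * (x * \<kappa> x + 2 * c x * q x) * (x * f x)"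
  have X: "asym ?X (\<lambda>x. 0 + 1/2 * 0 * f' x)"
    by (intro asym_intros Z \<kappa> f)
  have "asym (\<lambda>x. (x * \<kappa> x + 2 * c x * q x) - 2 * c x * q x) (\<lambda>x. 0 - 2 * 1 * 1)"
    by (intro asym_intros \<kappa> c q)
  then have \<kappa>2: "asym (\<lambda>x. x * \<kappa> x) (\<lambda>x. -2)" by simp
  have \<kappa>neg: "eventually (\<lambda>x. x * \<kappa> x < 0) at_top"
    using asym_tendstoD[OF \<kappa>2] by (rule order_tendstoD) simp
  \<comment> \<open>The factor 4 / (x \<kappa>) tends to -2; with the 1/2 in front it leaves -1,
    which is the sign of the limit.\<close>
  have "asym (\<lambda>x. 1 / (q x)\<^sup>2 * (1 / (2 * c x) * (4 / (x * \<kappa> x)) * (1 / c x * (?X x)\<^sup>2 + c x * (x ^ 4 * D x))))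
    (\<lambda>x. 1 / 1\<^sup>2 * (1 / (2 * 1) * (4 / -2) * (1 / 1 * (0 + 1/2 * 0 * f' x)\<^sup>2 + 1 * d x)))"
    by (intro asym_const asym_divide asym_mult asym_add X D c \<kappa>2 asym_power[OF q] asym_power[OF X] asym_mult[OF asym_const c]) auto
  then have "asym (\<lambda>x. 1 / (q x)\<^sup>2 * (1 / (2 * c x) * (4 / (x * \<kappa> x)) * (1 / c x * (?X x)\<^sup>2 + c x * (x ^ 4 * D x))))
    (\<lambda>x. - d x)" by simp
  then show ?thesis
  proof (rule asym_eventually)
    show "\<forall>\<^sub>F x in at_top. (x / q x)\<^sup>2 * (1 / (2 * c x) * (4 * x / \<kappa> x) *
      (1 / c x * (ft x - c x * fr x + 1/2 * \<kappa> x * f x)\<^sup>2 + c x * D x)) =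
      1 / (q x)\<^sup>2 * (1 / (2 * c x) * (4 / (x * \<kappa> x)) * (1 / c x * (?X x)\<^sup>2 + c x * (x ^ 4 * D x)))"
      using x_pos c_pos q_pos \<kappa>neg
    proof eventually_elim
      case (elim x)
      have "?X x = x\<^sup>2 * (ft x - c x * fr x + 1/2 * \<kappa> x * f x)"
        using elim by (simp add: field_simps power2_eq_square)
      then have X: "(?X x)\<^sup>2 = x ^ 4 * (ft x - c x * fr x + 1/2 * \<kappa> x * f x)\<^sup>2"
        by (simp add: power_mult_distrib flip: power_mult)
      have "1 / (q x)\<^sup>2 * (1 / (2 * c x) * (4 / (x * \<kappa> x)) * (1 / c x * (x ^ 4 * Y) + c x * (x ^ 4 * D x)))
        = (x / q x)\<^sup>2 * (1 / (2 * c x) * (4 * x / \<kappa> x) * (1 / c x * Y + c x * D x))" for Y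
      proof -
        have "\<kappa> x \<noteq> 0" "x \<noteq> 0" "q x \<noteq> 0" "c x \<noteq> 0" using elim by auto
        then show ?thesis by (simp add: power2_eq_square power4_eq_xxxx field_simps)
      qed
      then show ?case unfolding X by simp
    qed
  qed
qed

end


section \<open>The solution on the initial slice\<close>

lemma sgrad_eqI: "(\<And>y. pd (0, y) f p = y \<bullet> v) \<Longrightarrow> sgrad f p = v"
  by (simp add: sgrad_def ex_def vec_eq_iff inner_axis')

definition cyl :: "spacetime set" where "cyl = {0<..<1} \<times> (- {0})"

lemma open_cyl: "open cyl"
  unfolding cyl_def by (intro open_Times) auto

text \<open>
  \<open>H\<close> and \<open>K\<close> are the extensions of \<open>\<phi>0\<close> and \<open>\<phi>1\<close> which are homogeneous of degree zero in \<open>x\<close>.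
  For \<open>s\<close> in \<open>(0,1)\<close> and a unit vector \<open>\<omega>\<close>, all quantities at the point \<open>X\<close> of the slice are expressed by
  the derivatives of \<open>H\<close> and \<open>K\<close> at \<open>P = (s, \<omega>)\<close>.
\<close>

locale pulse_slice = optical_slice G \<phi> u W V "- r0" r0
  for G :: real and \<phi> u :: "spacetime \<Rightarrow> real" and W V :: "spacetime set" and r0 :: real +
  fixes \<delta> :: real and H K :: "spacetime \<Rightarrow> real"
  assumes \<delta>_pos: "\<delta> > 0" and r0_pos: "r0 > 0"
    and slab: "{- r0} \<times> cball 0 (r0 + \<delta>) \<subseteq> W" and shell: "{- r0} \<times> (cball 0 (r0 + \<delta>) - ball 0 r0) \<subseteq> V"
    and wave_eq: "solves_wave_eq G \<phi> W"
    and H: "Cinf_on H cyl" "homog 0 cyl H" and K: "Cinf_on K cyl" "homog 0 cyl K"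
    and data: "r0 < norm x \<Longrightarrow> norm x < r0 + \<delta> \<Longrightarrow> \<phi> (- r0, x) = sqrt \<delta> ^ 3 / r0 * H ((norm x - r0) / \<delta>, x)"
    and data_t: "r0 < norm x \<Longrightarrow> norm x < r0 + \<delta> \<Longrightarrow> pd et \<phi> (- r0, x) = sqrt \<delta> / r0 * K ((norm x - r0) / \<delta>, x)"
    and hyperbolic: "r0 \<le> norm x \<Longrightarrow> norm x \<le> r0 + \<delta> \<Longrightarrow> 1 + 3 * G * (pd et \<phi> (- r0, x))\<^sup>2 > 0"
begin

abbreviation al :: real where "al \<equiv> sqrt \<delta>"

lemma al: "al > 0" "\<delta> = al\<^sup>2" using \<delta>_pos by auto

text \<open>Open in space, so that the data formulas can be differentiated.\<close>

definition open_shell :: "(real^3) set" where "open_shell = {x. r0 < norm x \<and> norm x < r0 + \<delta>}"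

lemma open_open_shell: "open open_shell"
  unfolding open_shell_def by (intro open_Collect_conj open_Collect_less continuous_intros)

lemma data_open_shell:
  assumes "z \<in> open_shell"
  shows "\<phi> (- r0, z) = al ^ 3 / r0 * H ((norm z - r0) / \<delta>, z)"
    "pd et \<phi> (- r0, z) = al / r0 * K ((norm z - r0) / \<delta>, z)"
  using data data_t assms by (auto simp: open_shell_def)

lemma closed_shell_dom: assumes "r0 \<le> norm x" "norm x \<le> r0 + \<delta>" shows "(- r0, x) \<in> dom"
  using assms slab shell hyperbolic[OF assms] r0_pos by (auto simp: dom_def)

lemma shell_dom: "x \<in> open_shell \<Longrightarrow> (- r0, x) \<in> dom"
  using closed_shell_dom by (auto simp: open_shell_def)

lemma shell_cyl: "x \<in> open_shell \<Longrightarrow> ((norm x - r0) / \<delta>, x) \<in> cyl"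
  using \<delta>_pos r0_pos by (auto simp: open_shell_def cyl_def divide_simps)

lemma diff_phi:
  assumes "p \<in> W" "a \<in> Basis"
  shows "\<phi> differentiable (at p)" "pd a \<phi> differentiable (at p)"
  using Cinf_on_differentiable[OF _ open_W assms(1)] smooth_\<phi> Cinf_on_pd[OF smooth_\<phi> assms(2)] by auto

lemma pd_shell:
  assumes f: "f differentiable (at (- r0, x))" and F: "Cinf_on F cyl" and x: "x \<in> open_shell"
    and eq: "\<And>z. z \<in> open_shell \<Longrightarrow> f (- r0, z) = a * F ((norm z - r0) / \<delta>, z)"
  shows "sgrad f (- r0, x) = a *\<^sub>R ((pd et F ((norm x - r0) / \<delta>, x) / \<delta>) *\<^sub>R sgn x + sgrad F ((norm x - r0) / \<delta>, x))"
proof (rule sgrad_eqI)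
  fix y
  have nz: "x \<noteq> 0" using shell_cyl[OF x] by (simp add: cyl_def)
  have "F differentiable (at ((norm x - r0) / \<delta>, x))"
    using Cinf_on_differentiable[OF F open_cyl shell_cyl[OF x]] .
  from pd_slice[OF f open_open_shell x eq has_derivative_mult_right[OF has_derivative_shell[OF this nz]]]
  show "pd (0, y) f (- r0, x) = y \<bullet> (a *\<^sub>R ((pd et F ((norm x - r0) / \<delta>, x) / \<delta>) *\<^sub>R sgn x + sgrad F ((norm x - r0) / \<delta>, x)))"
    by (simp add: inner_add_right algebra_simps)
qed

context
  fixes s :: real and \<omega> :: "real^3"
  assumes s: "0 < s" "s < 1" and \<omega>: "norm \<omega> = 1"
begin

definition r :: real where "r = r0 + \<delta> * s"
definition X :: spacetime where "X = (- r0, r *\<^sub>R \<omega>)"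
definition P :: spacetime where "P = (s, \<omega>)"

lemma r_pos: "r > 0" using r0_pos \<delta>_pos s by (simp add: r_def add_pos_pos)

lemma x_shell: "r *\<^sub>R \<omega> \<in> open_shell"
  using s \<delta>_pos r0_pos \<omega> r_pos by (simp add: open_shell_def r_def)

lemma radius: "norm (r *\<^sub>R \<omega>) = r" "sgn (r *\<^sub>R \<omega>) = \<omega>" "(r - r0) / \<delta> = s" "inverse r *\<^sub>R (r *\<^sub>R \<omega>) = \<omega>"
  using r_pos \<omega> \<delta>_pos by (simp_all add: sgn_div_norm r_def)

lemma P_cyl: "P \<in> cyl" "(s, \<omega>) \<in> cyl" using s \<omega> by (auto simp: cyl_def P_def)

lemma X_dom: "X \<in> dom" and X_W: "X \<in> W"
  using shell_dom[OF x_shell] domD by (auto simp: X_def)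

lemma scaled:
  assumes "homog k cyl F" "Cinf_on F cyl"
  shows "F (s, r *\<^sub>R \<omega>) = F P / r ^ k" "sgrad F (s, r *\<^sub>R \<omega>) = sgrad F P /\<^sub>R r ^ Suc k"
  using homogD[OF assms(1) P_cyl(2) r_pos] sgrad_homog[OF assms(1) open_cyl assms(2) P_cyl(2) r_pos]
  by (simp_all add: P_def)

lemmas H_et = Cinf_on_pd[OF H(1) et_Basis] homog_pd_et[OF H(2) open_cyl H(1)]
lemmas H_ex = Cinf_on_pd[OF H(1) ex_Basis] homog_pd_ex[OF H(2) open_cyl H(1)]
lemmas K_et = Cinf_on_pd[OF K(1) et_Basis] homog_pd_et[OF K(2) open_cyl K(1)]

abbreviation "Hs \<equiv> pd et H P"
abbreviation "Hss \<equiv> pd et (pd et H) P"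
abbreviation "hv \<equiv> sgrad H P"
abbreviation "hs \<equiv> sgrad (pd et H) P"
abbreviation "hh i \<equiv> sgrad (pd (ex i) H) P"
abbreviation "Ks \<equiv> pd et K P"
abbreviation "kv \<equiv> sgrad K P"

lemma tangential: "\<omega> \<bullet> hv = 0" "\<omega> \<bullet> hs = 0" "\<omega> \<bullet> kv = 0" "\<omega> \<bullet> hh i = - hv $ i"
  using homog_Euler[OF H(2) open_cyl H(1) P_cyl(2)] homog_Euler[OF H_et(2) open_cyl H_et(1) P_cyl(2)]
    homog_Euler[OF K(2) open_cyl K(1) P_cyl(2)] homog_Euler[OF H_ex(2)[of i] open_cyl H_ex(1)[of i] P_cyl(2)]
  by (simp_all add: P_def sgrad_def)

lemma phi_t: "pd et \<phi> X = al / r0 * K P"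
  using data_open_shell(2)[OF x_shell] scaled(1)[OF K(2,1)] unfolding radius X_def by simp

lemma sgrad_phi_t: "sgrad (pd et \<phi>) X = (al / r0) *\<^sub>R ((Ks / \<delta>) *\<^sub>R \<omega> + (1 / r) *\<^sub>R kv)"
proof -
  have "pd et \<phi> differentiable (at (- r0, r *\<^sub>R \<omega>))" using diff_phi[OF X_W et_Basis] by (simp add: X_def)
  from pd_shell[OF this K(1) x_shell data_open_shell(2)]
  show ?thesis
    unfolding radius X_def scaled(2)[OF K(2,1)] scaled(1)[OF K_et(2,1)] by (simp add: inverse_eq_divide)
qed

lemma sgrad_phi: "sgrad \<phi> X = (al ^ 3 / r0) *\<^sub>R ((Hs / \<delta>) *\<^sub>R \<omega> + (1 / r) *\<^sub>R hv)"
proof -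
  have "\<phi> differentiable (at (- r0, r *\<^sub>R \<omega>))" using diff_phi[OF X_W et_Basis] by (simp add: X_def)
  from pd_shell[OF this H(1) x_shell data_open_shell(1)]
  show ?thesis
    unfolding radius X_def scaled(2)[OF H(2,1)] scaled(1)[OF H_et(2,1)] by (simp add: inverse_eq_divide)
qed

text \<open>This is a row of the spatial Hessian. The formula for \<partial>_i \<phi> holds on the
  whole open shell and can thus be differentiated again; a derivative in s costs 1/\<delta>, an
  angular one 1/r.\<close>

lemma sgrad_phi_i:
  "sgrad (pd (ex i) \<phi>) X = (al ^ 3 / r0) *\<^sub>R ((Hs / (\<delta> * r)) *\<^sub>R (axis i 1 - (\<omega> $ i) *\<^sub>R \<omega>)
     + (\<omega> $ i / \<delta>) *\<^sub>R ((Hss / \<delta>) *\<^sub>R \<omega> + (1 / r) *\<^sub>R hs) + (hs $ i / (\<delta> * r)) *\<^sub>R \<omega> + (1 / r\<^sup>2) *\<^sub>R hh i)"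
proof (rule sgrad_eqI)
  fix y
  let ?x = "r *\<^sub>R \<omega>" and ?\<sigma> = "\<lambda>z. (norm z - r0) / \<delta>"
  have nz: "?x \<noteq> 0" using r_pos \<omega> by auto
  have cyl: "(?\<sigma> ?x, ?x) \<in> cyl" using shell_cyl[OF x_shell] .
  have dH: "pd et H differentiable (at (?\<sigma> ?x, ?x))" "pd (ex i) H differentiable (at (?\<sigma> ?x, ?x))"
    using Cinf_on_differentiable[OF _ open_cyl cyl] H_et(1) H_ex(1) by auto
  have eq: "pd (ex i) \<phi> (- r0, z) = al ^ 3 / r0 * (z $ i / norm z * (pd et H (?\<sigma> z, z) / \<delta>) + pd (ex i) H (?\<sigma> z, z))"
    if z: "z \<in> open_shell" for z
  proof -
    have "(- r0, z) \<in> W" using domD(2)[OF shell_dom[OF z]] .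
    then have "\<phi> differentiable (at (- r0, z))" using diff_phi[OF _ et_Basis] by simp
    from pd_shell[OF this H(1) z data_open_shell(1)]
    have "sgrad \<phi> (- r0, z) = (al ^ 3 / r0) *\<^sub>R ((pd et H (?\<sigma> z, z) / \<delta>) *\<^sub>R sgn z + sgrad H (?\<sigma> z, z))" .
    from arg_cong[OF this, of "\<lambda>v. v $ i"] show ?thesis
      by (simp add: sgrad_def sgn_div_norm divide_inverse mult_ac)
  qed
  have "pd (ex i) \<phi> differentiable (at (- r0, ?x))" using diff_phi[OF X_W ex_Basis] by (simp add: X_def)
  from pd_slice[OF this open_open_shell x_shell eq
      has_derivative_mult_right[OF has_derivative_add[OF has_derivative_mult[OF has_derivative_sgn_component[OF nz]
        bounded_linear.has_derivative[OF bounded_linear_divide has_derivative_shell[OF dH(1) nz]]]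
        has_derivative_shell[OF dH(2) nz]]], of y]
  have "pd (0, y) (pd (ex i) \<phi>) X = al ^ 3 / r0 * (\<omega> $ i * ((y \<bullet> \<omega> / \<delta> * pd et (pd et H) (s, ?x) + y \<bullet> sgrad (pd et H) (s, ?x)) / \<delta>)
     + (y $ i - y \<bullet> \<omega> * \<omega> $ i) / r * (pd et H (s, ?x) / \<delta>)
     + (y \<bullet> \<omega> / \<delta> * pd et (pd (ex i) H) (s, ?x) + y \<bullet> sgrad (pd (ex i) H) (s, ?x)))"
    unfolding radius X_def using r_pos by simp
  moreover have "pd et (pd (ex i) H) (s, ?x) = hs $ i / r"
  proof -
    have c: "(s, ?x) \<in> cyl" using cyl unfolding radius .
    have "pd et (pd (ex i) H) (s, ?x) = sgrad (pd et H) (s, ?x) $ i"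
      using Cinf_on_pd_commute[OF H(1) open_cyl c et_Basis ex_Basis] by (simp add: sgrad_def)
    then show ?thesis using scaled(2)[OF H_et(2,1)] by (simp add: divide_inverse mult.commute)
  qed
  moreover have "pd et (pd et H) (s, ?x) = Hss" "pd et H (s, ?x) = Hs"
    using scaled(1)[OF H_et(2,1)] scaled(1)[OF homog_pd_et[OF H_et(2) open_cyl H_et(1)] Cinf_on_pd[OF H_et(1) et_Basis]] by simp_all
  ultimately have "pd (0, y) (pd (ex i) \<phi>) X = al ^ 3 / r0 * (\<omega> $ i * ((y \<bullet> \<omega> / \<delta> * Hss + y \<bullet> hs / r) / \<delta>)
     + (y $ i - y \<bullet> \<omega> * \<omega> $ i) / r * (Hs / \<delta>)
     + (y \<bullet> \<omega> / \<delta> * (hs $ i / r) + y \<bullet> hh i / r\<^sup>2))"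
    using scaled(2)[OF H_et(2,1)] scaled(2)[OF H_ex(2,1)] by (simp add: divide_inverse mult_ac power2_eq_square)
  moreover have "y \<bullet> axis i 1 = y $ i" by (simp add: inner_axis)
  ultimately show "pd (0, y) (pd (ex i) \<phi>) X = y \<bullet> ((al ^ 3 / r0) *\<^sub>R ((Hs / (\<delta> * r)) *\<^sub>R (axis i 1 - (\<omega> $ i) *\<^sub>R \<omega>)
     + (\<omega> $ i / \<delta>) *\<^sub>R ((Hss / \<delta>) *\<^sub>R \<omega> + (1 / r) *\<^sub>R hs) + (hs $ i / (\<delta> * r)) *\<^sub>R \<omega> + (1 / r\<^sup>2) *\<^sub>R hh i))"
    by (simp add: inner_add_right inner_diff_right algebra_simps divide_inverse power2_eq_square)
qed

section \<open>Radial and spherical parts of the wave equation\<close>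

abbreviation "q \<equiv> r0 / r"
abbreviation "trH \<equiv> \<Sum>i\<in>UNIV. hh i $ i"
text \<open>\<open>\<rho> / r0\<^sup>2\<close> is the non-radial part of the Laplacian, (2/r)
  \<partial>_r \<phi> plus the spherical Laplacian. On the unit sphere the latter is the full trace
  \<open>trH\<close>, as \<open>H\<close> is homogeneous of degree zero.\<close>

definition \<rho> :: real where "\<rho> = 2 * al * Hs * q + al ^ 3 * trH * q\<^sup>2 / r0"
definition Lb :: "(spacetime \<Rightarrow> real) \<Rightarrow> real" where "Lb f = pd (1, - c X *\<^sub>R \<omega>) f X"
abbreviation "phi_tr \<equiv> \<omega> \<bullet> sgrad (pd et \<phi>) X"
abbreviation "phi_rr \<equiv> \<Sum>i\<in>UNIV. \<omega> $ i * (\<omega> \<bullet> sgrad (pd (ex i) \<phi>) X)"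

lemma \<omega>_sq: "\<omega> \<bullet> \<omega> = 1" "(\<Sum>i\<in>UNIV. \<omega> $ i * \<omega> $ i) = 1"
  using \<omega>[unfolded norm_eq_1] by (auto simp: inner_vec_def)

lemma al_nz: "al \<noteq> 0" "\<delta> \<noteq> 0" "r0 \<noteq> 0" "r \<noteq> 0" using al r_pos r0_pos \<delta>_pos by auto

lemma al_simps: "al * al = \<delta>" "al * (al * z) = \<delta> * z" "al ^ 3 = al * \<delta>"
  using \<delta>_pos by (simp_all add: power3_eq_cube flip: mult.assoc)

lemma phi_tr: "r0 * phi_tr = Ks / al"
  unfolding sgrad_phi_t using al_nz by (simp add: inner_add_right \<omega>_sq tangential field_simps al_simps)

lemma phi_r: "r0 * (\<omega> \<bullet> sgrad \<phi> X) = al * Hs"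
  unfolding sgrad_phi using al_nz by (simp add: inner_add_right \<omega>_sq tangential field_simps al_simps)

lemma phi_ir: "\<omega> \<bullet> sgrad (pd (ex i) \<phi>) X =
  (al ^ 3 / r0) * (\<omega> $ i * Hss / \<delta>\<^sup>2 + hs $ i / (\<delta> * r) - hv $ i / r\<^sup>2)"
proof -
  have "\<omega> \<bullet> axis i 1 = \<omega> $ i" by (simp add: inner_axis)
  then show ?thesis
    unfolding sgrad_phi_i
    by (simp add: inner_add_right inner_diff_right \<omega>_sq tangential algebra_simps power2_eq_square)
qed

lemma phi_rr: "r0 * phi_rr = Hss / al"
proof -
  have "phi_rr = (\<Sum>i\<in>UNIV. \<omega> $ i * ((al ^ 3 / r0) * (\<omega> $ i * Hss / \<delta>\<^sup>2 + hs $ i / (\<delta> * r) - hv $ i / r\<^sup>2)))"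
    by (simp only: phi_ir)
  also have "\<dots> = (al ^ 3 / r0) * (Hss / \<delta>\<^sup>2 * (\<Sum>i\<in>UNIV. \<omega> $ i * \<omega> $ i)
      + (\<omega> \<bullet> hs) / (\<delta> * r) - (\<omega> \<bullet> hv) / r\<^sup>2)"
    unfolding inner_vec_def sum_distrib_left sum_divide_distrib
    by (simp add: sum.distrib sum_subtractf algebra_simps sum_distrib_left)
  finally have "phi_rr = (al ^ 3 / r0) * (Hss / \<delta>\<^sup>2 * (\<Sum>i\<in>UNIV. \<omega> $ i * \<omega> $ i)
      + (\<omega> \<bullet> hs) / (\<delta> * r) - (\<omega> \<bullet> hv) / r\<^sup>2)" .
  then have "phi_rr = al ^ 3 / r0 * (Hss / \<delta>\<^sup>2)" by (simp add: \<omega>_sq tangential)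
  moreover have "r0 * (al ^ 3 / r0 * (Hss / \<delta>\<^sup>2)) = Hss / al"
    using al_nz by (simp add: field_simps al_simps power2_eq_square)
  ultimately show ?thesis by simp
qed

lemma laplacian:
  "(\<Sum>i\<in>UNIV. pd (ex i) (pd (ex i) \<phi>) X) = phi_rr + \<rho> / r0\<^sup>2"
proof -
  have "pd (ex i) (pd (ex i) \<phi>) X = (al ^ 3 / r0) * ((Hs / (\<delta> * r)) * (1 - \<omega> $ i * \<omega> $ i)
     + Hss / \<delta>\<^sup>2 * (\<omega> $ i * \<omega> $ i) + 2 / (\<delta> * r) * (\<omega> $ i * hs $ i) + hh i $ i / r\<^sup>2)" for i
    using arg_cong[OF sgrad_phi_i[of i], of "\<lambda>v. v $ i"]
    by (simp add: sgrad_def algebra_simps divide_inverse power2_eq_square)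
  then have "(\<Sum>i\<in>UNIV. pd (ex i) (pd (ex i) \<phi>) X) = (\<Sum>i\<in>UNIV. (al ^ 3 / r0) * ((Hs / (\<delta> * r)) * (1 - \<omega> $ i * \<omega> $ i)
     + Hss / \<delta>\<^sup>2 * (\<omega> $ i * \<omega> $ i) + 2 / (\<delta> * r) * (\<omega> $ i * hs $ i) + hh i $ i / r\<^sup>2))"
    by simp
  also have "\<dots> = (al ^ 3 / r0) * ((Hs / (\<delta> * r)) * (3 - (\<Sum>i\<in>UNIV. \<omega> $ i * \<omega> $ i))
     + Hss / \<delta>\<^sup>2 * (\<Sum>i\<in>UNIV. \<omega> $ i * \<omega> $ i) + 2 / (\<delta> * r) * (\<omega> \<bullet> hs) + trH / r\<^sup>2)"
    by (simp add: sum.distrib sum_subtractf sum_distrib_left[symmetric] sum_divide_distrib[symmetric] inner_vec_def)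
  also have "\<dots> = (al ^ 3 / r0) * (2 * Hs / (\<delta> * r) + Hss / \<delta>\<^sup>2 + trH / r\<^sup>2)"
    by (simp add: \<omega>_sq tangential)
  also have "\<dots> = Hss / al / r0 + \<rho> / r0\<^sup>2"
    unfolding \<rho>_def using al_nz by (simp add: field_simps al_simps power2_eq_square)
  also have "Hss / al / r0 = phi_rr" unfolding phi_rr[symmetric] using al_nz by simp
  finally show ?thesis .
qed

lemma phi_tt: "pd et (pd et \<phi>) X = (c X)\<^sup>2 * (phi_rr + \<rho> / r0\<^sup>2)"
proof -
  have h: "1 + 3 * G * (pd et \<phi> X)\<^sup>2 > 0" using domD(4)[OF X_dom] .
  have "(1 + 3 * G * (pd et \<phi> X)\<^sup>2) * pd et (pd et \<phi>) X = phi_rr + \<rho> / r0\<^sup>2"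
  proof -
    have "- (1 + 3 * G * (pd et \<phi> X)\<^sup>2) * pd et (pd et \<phi>) X + (\<Sum>i\<in>UNIV. pd (ex i) (pd (ex i) \<phi>) X) = 0"
      using wave_eq X_W unfolding solves_wave_eq_def by blast
    then show ?thesis unfolding laplacian by linarith
  qed
  then have "(c X)\<^sup>2 * (phi_rr + \<rho> / r0\<^sup>2)
      = ((c X)\<^sup>2 * (1 + 3 * G * (pd et \<phi> X)\<^sup>2)) * pd et (pd et \<phi>) X" by simp
  then show ?thesis unfolding wave_speed_sq[OF h] by simp
qed

lemma Lb_eq: "f differentiable (at X) \<Longrightarrow> Lb f = pd et f X - c X * (\<omega> \<bullet> sgrad f X)"
  unfolding Lb_def by (simp add: pd_et_eq)

lemma Lb_phi_t: "Lb (pd et \<phi>) = (c X)\<^sup>2 * (phi_rr + \<rho> / r0\<^sup>2) - c X * phi_tr"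
  using Lb_eq[OF diff_\<phi>t[OF X_W]] phi_tt by simp

lemma ingoing_at: "p \<in> W \<Longrightarrow> ingoing G \<phi> \<phi> p =
  pd et \<phi> p - c p * (\<Sum>i\<in>UNIV. snd p $ i / norm (snd p) * pd (ex i) \<phi> p)"
  unfolding ingoing_def
  using diff_phi(1)[OF _ et_Basis]
  by (simp add: pd_et_eq inner_vec_def sgrad_def sum_distrib_left sum_negf divide_inverse mult_ac)

lemma ingoing_phi: "ingoing G \<phi> \<phi> X = al / r0 * (K P - c X * Hs)"
proof -
  have "ingoing G \<phi> \<phi> X = pd et \<phi> X - c X * (\<omega> \<bullet> sgrad \<phi> X)"
    unfolding ingoing_def using diff_phi(1)[OF X_W et_Basis] radius(4) r_pos \<omega>
    by (simp add: pd_et_eq X_def)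
  moreover have "\<omega> \<bullet> sgrad \<phi> X = al * Hs / r0" using phi_r al_nz by (simp add: field_simps)
  ultimately show ?thesis using phi_t by (simp add: algebra_simps)
qed

text \<open>Expanding the square gives \<phi>_tt - 2c \<phi>_tr + c^2 \<phi>_rr minus \<phi>_r times
  the incoming derivative of c. The wave equation replaces c^2 \<phi>_rr by \<phi>_tt minus the
  non-radial term, so \<phi>_tt - c \<phi>_tr appears twice; the derivative of c gives the term with
  \<open>G\<close>.\<close>

lemma ingoing_ingoing_phi:
  "ingoing G \<phi> (ingoing G \<phi> \<phi>) X = 2 * Lb (pd et \<phi>) - (c X)\<^sup>2 * (\<rho> / r0\<^sup>2)
    + 3 * G * c X ^ 3 * pd et \<phi> X * Lb (pd et \<phi>) * (\<omega> \<bullet> sgrad \<phi> X)"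
proof -
  let ?n = "\<lambda>i p. snd p $ i / norm (snd p) :: real"
  let ?Y = "(1, - c X *\<^sub>R \<omega>)"
  have sX: "snd X = r *\<^sub>R \<omega>" "snd X \<noteq> 0" using r_pos \<omega> by (auto simp: X_def)
  have dn: "(?n i has_derivative (\<lambda>Y. (snd Y $ i - (snd Y \<bullet> \<omega>) * \<omega> $ i) / r)) (at X)" for i
  proof -
    have "(snd has_derivative snd) (at X)" by (auto intro!: derivative_eq_intros)
    from has_derivative_compose[OF this has_derivative_sgn_component[OF sX(2)], of i]
    show ?thesis unfolding sX(1) radius .
  qed
  note dphi = has_derivative_pd[OF diff_phi(2)[OF X_W]]
  have "((\<lambda>p. pd et \<phi> p - c p * (\<Sum>i\<in>UNIV. ?n i p * pd (ex i) \<phi> p)) has_derivative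
    (\<lambda>Y. pd Y (pd et \<phi>) X - (c X * (\<Sum>i\<in>UNIV. ?n i X * pd Y (pd (ex i) \<phi>) X
        + (snd Y $ i - (snd Y \<bullet> \<omega>) * \<omega> $ i) / r * pd (ex i) \<phi> X)
      + (- 3 * G * c X ^ 3 * pd et \<phi> X * pd Y (pd et \<phi>) X) * (\<Sum>i\<in>UNIV. ?n i X * pd (ex i) \<phi> X)))) (at X)"
    by (intro has_derivative_diff has_derivative_mult has_derivative_sum dphi dn et_Basis ex_Basis
        has_derivative_wave_speed diff_\<phi>t X_W domD(4) X_dom)
  then have "(ingoing G \<phi> \<phi> has_derivative
    (\<lambda>Y. pd Y (pd et \<phi>) X - (c X * (\<Sum>i\<in>UNIV. ?n i X * pd Y (pd (ex i) \<phi>) X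
        + (snd Y $ i - (snd Y \<bullet> \<omega>) * \<omega> $ i) / r * pd (ex i) \<phi> X)
      + (- 3 * G * c X ^ 3 * pd et \<phi> X * pd Y (pd et \<phi>) X) * (\<Sum>i\<in>UNIV. ?n i X * pd (ex i) \<phi> X)))) (at X)"
    by (rule has_derivative_transform_within_open[OF _ open_W X_W]) (simp add: ingoing_at)
  \<comment> \<open>The spatial part of \<open>?Y\<close> is radial, so x/|x| is constant in this
    direction and its derivative drops out.\<close>
  from pd_eqI[OF this, of ?Y]
  have "pd ?Y (ingoing G \<phi> \<phi>) X = Lb (pd et \<phi>) - (c X * (\<Sum>i\<in>UNIV. ?n i X * Lb (pd (ex i) \<phi>))
      + (- 3 * G * c X ^ 3 * pd et \<phi> X * Lb (pd et \<phi>)) * (\<Sum>i\<in>UNIV. ?n i X * pd (ex i) \<phi> X))"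
    by (simp add: Lb_def \<omega>_sq)
  moreover have "?n i X = \<omega> $ i" for i using sX r_pos \<omega> by simp
  moreover have "Lb (pd (ex i) \<phi>) = sgrad (pd et \<phi>) X $ i - c X * (\<omega> \<bullet> sgrad (pd (ex i) \<phi>) X)" for i
    using Lb_eq[OF diff_phi(2)[OF X_W ex_Basis]] Cinf_on_pd_commute[OF smooth_\<phi> open_W X_W et_Basis ex_Basis]
    by (simp add: sgrad_def)
  ultimately have "pd ?Y (ingoing G \<phi> \<phi>) X = Lb (pd et \<phi>) - (c X * (phi_tr - c X * phi_rr)
      + (- 3 * G * c X ^ 3 * pd et \<phi> X * Lb (pd et \<phi>)) * (\<omega> \<bullet> sgrad \<phi> X))"
    by (simp add: inner_vec_def sgrad_def right_diff_distrib sum_subtractf sum_distrib_left mult_ac)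
  moreover have "ingoing G \<phi> (ingoing G \<phi> \<phi>) X = pd ?Y (ingoing G \<phi> \<phi>) X"
    unfolding ingoing_def[of G \<phi> "ingoing G \<phi> \<phi>"] using radius(4) r_pos \<omega> by (simp add: X_def)
  moreover have "c X * (phi_tr - c X * phi_rr) = (c X)\<^sup>2 * (\<rho> / r0\<^sup>2) - Lb (pd et \<phi>)"
    unfolding Lb_phi_t by (simp add: algebra_simps power2_eq_square)
  ultimately show ?thesis by (simp add: algebra_simps)
qed

definition T :: real where "T = r0\<^sup>2 * Lb (pd et \<phi>)"

lemma T_phi_t: "r0\<^sup>2 * (pd et (pd et \<phi>) X - c X * phi_tr) = T"
  unfolding T_def using Lb_eq[OF diff_\<phi>t[OF X_W]] by simp

text \<open>Without a rate for the difference of \<open>Hss\<close> and \<open>Ks\<close> this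
  bounds \<open>T\<close> only by a multiple of r0. It is used twice: as that crude bound, and in
  reverse to obtain the limit of \<open>Hss\<close> once \<open>T\<close> is known to be
  bounded.\<close>

lemma T_eq: "T / r0 = (c X)\<^sup>2 * (Hss / al + \<rho> / r0) - c X * (Ks / al)"
  unfolding T_def Lb_phi_t phi_tr[symmetric] phi_rr[symmetric]
  using al_nz by (simp add: field_simps power2_eq_square)

text \<open>On the right \<open>T\<close> carries two inverse powers of r0, so the crude bound makes
  that term vanish; the second no-radiation bound makes the ingoing term O(1/r0). What remains is
  \<rho>.\<close>

lemma T_ingoing:
  "2 * T = r0\<^sup>2 * ingoing G \<phi> (ingoing G \<phi> \<phi>) X + (c X)\<^sup>2 * \<rho>
    - 3 * G * c X ^ 3 * (al * K P) * (al * Hs) * (T / r0 / r0)"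
proof -
  have "\<omega> \<bullet> sgrad \<phi> X = al * Hs / r0" using phi_r al_nz by (simp add: field_simps)
  then show ?thesis
    unfolding T_def ingoing_ingoing_phi phi_t using al_nz by (simp add: field_simps power2_eq_square)
qed

lemma null_expansion:
  "r0 * tr_chi G \<phi> u X + 2 * c X * q = 3 * G * (c X)\<^sup>2 * (al * K P) * (T / r0 / r0)"
proof -
  have "tr_chi G \<phi> u X = - 2 * c X / r + 3 * G * (c X)\<^sup>2 * pd et \<phi> X * Lb (pd et \<phi>)"
    using tr_chi_slice[of "r *\<^sub>R \<omega>"] X_dom radius(4) r_pos \<omega> by (simp add: X_def Lb_def)
  then show ?thesis
    unfolding T_def phi_t using al_nz by (simp add: field_simps power2_eq_square)
qed

text \<open>Both sides are the squared length of the part of \<open>g\<close> orthogonal to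
  \<omega>. Summing squares of components avoids subtracting two radial terms that are much larger
  than the difference.\<close>

lemma angular_norm: "(norm g)\<^sup>2 - (\<omega> \<bullet> g)\<^sup>2 = (\<Sum>j\<in>UNIV. (g $ j - (\<omega> \<bullet> g) * \<omega> $ j)\<^sup>2)"
proof -
  have "(\<Sum>j\<in>UNIV. (g $ j - (\<omega> \<bullet> g) * \<omega> $ j)\<^sup>2) = (g - (\<omega> \<bullet> g) *\<^sub>R \<omega>) \<bullet> (g - (\<omega> \<bullet> g) *\<^sub>R \<omega>)"
    by (simp add: inner_vec_def power2_eq_square)
  also have "\<dots> = (norm g)\<^sup>2 - (\<omega> \<bullet> g)\<^sup>2"
    by (simp add: inner_diff_left inner_diff_right \<omega>_sq power2_norm_eq_inner inner_commute)
      (simp add: power2_eq_square)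
  finally show ?thesis by simp
qed

lemma angular_phi_t:
  "r0 ^ 4 * ((norm (sgrad (pd et \<phi>) X))\<^sup>2 - phi_tr\<^sup>2) = (\<Sum>j\<in>UNIV. (al * q * kv $ j)\<^sup>2)"
proof -
  have "phi_tr = Ks / al / r0" using phi_tr al_nz by (simp add: field_simps)
  then have "r0\<^sup>2 * (sgrad (pd et \<phi>) X $ j - phi_tr * \<omega> $ j)
      = r0\<^sup>2 * ((al / r0) * ((Ks / \<delta>) * \<omega> $ j + (1 / r) * kv $ j) - Ks / al / r0 * \<omega> $ j)" for j
    by (simp only: sgrad_phi_t) simp
  also have "\<dots> j = al * q * kv $ j" for j
    using al_nz by (simp add: field_simps al_simps power2_eq_square)
  finally have "(al * q * kv $ j)\<^sup>2 = r0 ^ 4 * (sgrad (pd et \<phi>) X $ j - phi_tr * \<omega> $ j)\<^sup>2" for j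
    by (metis (no_types, lifting) power_mult_distrib power_mult num_double numeral_times_numeral mult_2_right)
  then show ?thesis unfolding angular_norm by (simp add: sum_distrib_left)
qed

lemma phi_i: "r0 * pd (ex i) \<phi> X = al * \<omega> $ i * Hs + al * \<delta> * hv $ i * q / r0"
proof -
  have "pd (ex i) \<phi> X = (al ^ 3 / r0) * ((Hs / \<delta>) * \<omega> $ i + (1 / r) * hv $ i)"
    using arg_cong[OF sgrad_phi, of "\<lambda>v. v $ i"] by (simp add: sgrad_def)
  then show ?thesis by (simp only:) (use al_nz in \<open>simp add: field_simps al_simps\<close>)
qed

lemma phi_ir_scaled:
  "r0 * (\<omega> \<bullet> sgrad (pd (ex i) \<phi>) X) = \<omega> $ i * Hss / al + al * hs $ i * q / r0 - al * \<delta> * hv $ i * q\<^sup>2 / r0 / r0"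
proof -
  have "al / \<delta> = 1 / al"
    using al_nz \<delta>_pos by (simp add: frac_eq_eq)
  then have d: "al ^ 3 / \<delta>\<^sup>2 = 1 / al" "al ^ 3 / \<delta> = al" using al_nz by (simp_all add: al_simps power2_eq_square)
  have "al ^ 3 * (\<omega> $ i * Hss / \<delta>\<^sup>2 + hs $ i / (\<delta> * r) - hv $ i / r\<^sup>2)
    = \<omega> $ i * Hss * (al ^ 3 / \<delta>\<^sup>2) + (al ^ 3 / \<delta>) * hs $ i / r - al ^ 3 * hv $ i / r\<^sup>2"
    by (simp add: algebra_simps divide_inverse)
  then show ?thesis
    unfolding phi_ir d using al_nz by (simp add: power2_eq_square al_simps)
qed

text \<open>The leading part is r0 times the difference of \<open>Ks\<close> and c
  \<open>Hss\<close>, again without a known rate. \<open>T_eq\<close> turns it into (c^2 \<rho> -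
  T)/c, which stays bounded; for the angular part convergence of the gradients without a rate is
  enough.\<close>

lemma incoming_phi_i:
  "r0\<^sup>2 * (pd et (pd (ex i) \<phi>) X - c X * (\<omega> \<bullet> sgrad (pd (ex i) \<phi>) X)) =
    \<omega> $ i * (((c X)\<^sup>2 * \<rho> - T) / c X) + al * q * (kv $ i - c X * hs $ i) + c X * (al * \<delta> * hv $ i * q\<^sup>2 / r0)"
proof -
  have cp: "c X > 0" using domD(5)[OF X_dom] .
  have "pd et (pd (ex i) \<phi>) X = sgrad (pd et \<phi>) X $ i"
    using Cinf_on_pd_commute[OF smooth_\<phi> open_W X_W et_Basis ex_Basis] by (simp add: sgrad_def)
  also have "\<dots> = (al / r0) * ((Ks / \<delta>) * \<omega> $ i + kv $ i / r)" unfolding sgrad_phi_t by simp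
  finally have 1: "r0\<^sup>2 * pd et (pd (ex i) \<phi>) X = r0 * (\<omega> $ i * Ks / al) + al * q * kv $ i"
    by (simp only:) (use al_nz in \<open>simp add: field_simps al_simps power2_eq_square\<close>)
  have 2: "r0\<^sup>2 * (\<omega> \<bullet> sgrad (pd (ex i) \<phi>) X) = r0 * (\<omega> $ i * Hss / al) + al * hs $ i * q - al * \<delta> * hv $ i * q\<^sup>2 / r0"
  proof -
    have "r0\<^sup>2 * (\<omega> \<bullet> sgrad (pd (ex i) \<phi>) X) = r0 * (r0 * (\<omega> \<bullet> sgrad (pd (ex i) \<phi>) X))"
      by (simp add: power2_eq_square)
    then show ?thesis unfolding phi_ir_scaled using al_nz by (simp add: algebra_simps)
  qed
  have 3: "((c X)\<^sup>2 * \<rho> - T) / c X = r0 * (Ks / al) - c X * (r0 * (Hss / al))"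
  proof -
    have "T = r0 * (T / r0)" using al_nz by simp
    also have "\<dots> = (c X)\<^sup>2 * (r0 * (Hss / al) + \<rho>) - c X * (r0 * (Ks / al))"
      unfolding T_eq using al_nz by (simp add: algebra_simps)
    finally have "(c X)\<^sup>2 * \<rho> - T = c X * (r0 * (Ks / al) - c X * (r0 * (Hss / al)))"
      by (simp add: algebra_simps power2_eq_square)
    then show ?thesis using cp by simp
  qed
  have "r0\<^sup>2 * (pd et (pd (ex i) \<phi>) X - c X * (\<omega> \<bullet> sgrad (pd (ex i) \<phi>) X))
    = r0\<^sup>2 * pd et (pd (ex i) \<phi>) X - c X * (r0\<^sup>2 * (\<omega> \<bullet> sgrad (pd (ex i) \<phi>) X))"
    by (simp add: algebra_simps)
  then show ?thesis unfolding 1 2 3 by (simp add: algebra_simps)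
qed

lemma angular_phi_i:
  "r0 ^ 4 * ((norm (sgrad (pd (ex i) \<phi>) X))\<^sup>2 - (\<omega> \<bullet> sgrad (pd (ex i) \<phi>) X)\<^sup>2) =
    (\<Sum>j\<in>UNIV. (al * q * (Hs * ((if j = i then 1 else 0) - \<omega> $ i * \<omega> $ j) + \<omega> $ i * hs $ j)
      + al * \<delta> * q\<^sup>2 * (hh i $ j + hv $ i * \<omega> $ j) / r0)\<^sup>2)"
proof -
  let ?B = "\<lambda>j. al * q * (Hs * ((if j = i then 1 else 0) - \<omega> $ i * \<omega> $ j) + \<omega> $ i * hs $ j)
      + al * \<delta> * q\<^sup>2 * (hh i $ j + hv $ i * \<omega> $ j) / r0"
  let ?g = "sgrad (pd (ex i) \<phi>) X"
  have "?g $ j - (\<omega> \<bullet> ?g) * \<omega> $ j = (al ^ 3 / r0) * ((Hs / (\<delta> * r)) * ((if j = i then 1 else 0) - \<omega> $ i * \<omega> $ j)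
      + (\<omega> $ i * hs $ j) / (\<delta> * r) + (hh i $ j + hv $ i * \<omega> $ j) / r\<^sup>2)" for j
    unfolding phi_ir unfolding sgrad_phi_i
    by (simp add: axis_def algebra_simps divide_inverse power2_eq_square)
  then have "r0\<^sup>2 * (?g $ j - (\<omega> \<bullet> ?g) * \<omega> $ j) = ?B j" for j
    by (simp only:) (use al_nz in \<open>simp add: al_simps power2_eq_square field_simps\<close>)
  then have "(?B j)\<^sup>2 = (r0\<^sup>2 * (?g $ j - (\<omega> \<bullet> ?g) * \<omega> $ j))\<^sup>2" for j by simp
  also have "(r0\<^sup>2 * z)\<^sup>2 = r0 ^ 4 * z\<^sup>2" for z by (simp add: power_mult_distrib)
  finally show ?thesis unfolding angular_norm by (simp add: sum_distrib_left)
qed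

end

end


section \<open>Asymptotics as the radius tends to infinity\<close>

text \<open>The integrands of the two energies are separated from the integrals so that their limits
  can be taken pointwise first.\<close>

definition dens0 :: "real \<Rightarrow> (spacetime \<Rightarrow> real) \<Rightarrow> (spacetime \<Rightarrow> real) \<Rightarrow> (spacetime \<Rightarrow> real) \<Rightarrow> spacetime \<Rightarrow> real" where
  "dens0 G \<phi> u \<psi> p = (let c = wave_speed G \<phi> p in
     1 / (2 * c) * ((pd (Lvec G \<phi> u p) \<psi> p)\<^sup>2 + mu G \<phi> u p / c\<^sup>2 * (pd (Lbar G \<phi> u p) \<psi> p)\<^sup>2 +
       (mu G \<phi> u p + (mu G \<phi> u p)\<^sup>2 / c\<^sup>2) * dS_sq G \<phi> u \<psi> p))"

definition dens1 :: "real \<Rightarrow> real \<Rightarrow> (spacetime \<Rightarrow> real) \<Rightarrow> (spacetime \<Rightarrow> real) \<Rightarrow> (spacetime \<Rightarrow> real) \<Rightarrow> spacetime \<Rightarrow> real" where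
  "dens1 t G \<phi> u \<psi> p = (let c = wave_speed G \<phi> p in
     1 / (2 * c) * (4 * (-t) / tr_chi G \<phi> u p) *
       (mu G \<phi> u p / c\<^sup>2 * (pd (Lbar G \<phi> u p) \<psi> p + 1/2 * tr_chi G \<phi> u p * \<psi> p)\<^sup>2 + mu G \<phi> u p * dS_sq G \<phi> u \<psi> p))"

lemma (in optical_slice) dens_slice:
  assumes x: "(t, x) \<in> dom" and \<psi>: "\<psi> differentiable (at (t, x))"
  defines "fr \<equiv> (x /\<^sub>R norm x) \<bullet> sgrad \<psi> (t, x)" and "D \<equiv> (norm (sgrad \<psi> (t, x)))\<^sup>2 - ((x /\<^sub>R norm x) \<bullet> sgrad \<psi> (t, x))\<^sup>2"
  shows "dens0 G \<phi> u \<psi> (t, x) = 1 / (2 * c (t, x)) * ((pd et \<psi> (t, x) / c (t, x) + fr)\<^sup>2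
      + 1 / c (t, x) * (pd et \<psi> (t, x) - c (t, x) * fr)\<^sup>2 + (c (t, x) + 1) * D)"
    and "dens1 t G \<phi> u \<psi> (t, x) = 1 / (2 * c (t, x)) * (4 * (- t) / tr_chi G \<phi> u (t, x)) *
      (1 / c (t, x) * (pd et \<psi> (t, x) - c (t, x) * fr + 1/2 * tr_chi G \<phi> u (t, x) * \<psi> (t, x))\<^sup>2 + c (t, x) * D)"
proof -
  have p: "pd (a, y) \<psi> (t, x) = a * pd et \<psi> (t, x) + y \<bullet> sgrad \<psi> (t, x)" for a y
    by (rule pd_et_eq[OF \<psi>])
  have cp: "c (t, x) > 0" using domD(5)[OF x] .
  show "dens0 G \<phi> u \<psi> (t, x) = 1 / (2 * c (t, x)) * ((pd et \<psi> (t, x) / c (t, x) + fr)\<^sup>2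
      + 1 / c (t, x) * (pd et \<psi> (t, x) - c (t, x) * fr)\<^sup>2 + (c (t, x) + 1) * D)"
    unfolding dens0_def Let_def mu_slice[OF x] Lvec_slice[OF x] Lbar_slice[OF x] dS_sq_slice[OF x \<psi>] p fr_def D_def
    using cp by (simp add: power2_eq_square mult.assoc)
  show "dens1 t G \<phi> u \<psi> (t, x) = 1 / (2 * c (t, x)) * (4 * (- t) / tr_chi G \<phi> u (t, x)) *
      (1 / c (t, x) * (pd et \<psi> (t, x) - c (t, x) * fr + 1/2 * tr_chi G \<phi> u (t, x) * \<psi> (t, x))\<^sup>2 + c (t, x) * D)"
    unfolding dens1_def Let_def mu_slice[OF x] Lbar_slice[OF x] dS_sq_slice[OF x \<psi>] p fr_def D_def
    using cp by (simp add: power2_eq_square mult.assoc)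
qed

definition ocyl :: "spacetime set" where "ocyl = {0<..<1} \<times> sphere 0 1"

text \<open>The factor \<open>a\<close> of the overview: 1 for \<open>et\<close> and \<omega>_i for
  \<open>ex i\<close>. A single formula lets the limit densities be stated for every
  \<open>e\<close> in \<open>Basis\<close>.\<close>

definition amplitude :: "spacetime \<Rightarrow> spacetime \<Rightarrow> real" where
  "amplitude e p = fst e + snd e \<bullet> snd p"

text \<open>The gradient along the sphere of \<open>amplitude e\<close> times \<open>K\<close>.\<close>

definition angular_gradient :: "(spacetime \<Rightarrow> real) \<Rightarrow> spacetime \<Rightarrow> spacetime \<Rightarrow> real^3" where
  "angular_gradient K e p = amplitude e p *\<^sub>R sgrad K p + K p *\<^sub>R (snd e - (snd e \<bullet> snd p) *\<^sub>R snd p)"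

text \<open>Three derivatives of \<open>H\<close> are what the interpolation consumes: one in s,
  then two along an axis.\<close>

definition bounded_C3 :: "real \<Rightarrow> (spacetime \<Rightarrow> real) \<Rightarrow> bool" where
  "bounded_C3 M F \<longleftrightarrow> (\<forall>bs p. set bs \<subseteq> Basis \<longrightarrow> length bs \<le> 3 \<longrightarrow> p \<in> ocyl \<longrightarrow> \<bar>foldr pd bs F p\<bar> \<le> M)"

lemma bounded_C3D:
  assumes "bounded_C3 M F" "p \<in> ocyl"
  shows "\<bar>F p\<bar> \<le> M" "a \<in> Basis \<Longrightarrow> \<bar>pd a F p\<bar> \<le> M"
    "a \<in> Basis \<Longrightarrow> b \<in> Basis \<Longrightarrow> \<bar>pd a (pd b F) p\<bar> \<le> M"
    "a \<in> Basis \<Longrightarrow> b \<in> Basis \<Longrightarrow> d \<in> Basis \<Longrightarrow> \<bar>pd a (pd b (pd d F)) p\<bar> \<le> M"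
  using assms(1)[unfolded bounded_C3_def, rule_format, of "[]" p]
    assms(1)[unfolded bounded_C3_def, rule_format, of "[a]" p]
    assms(1)[unfolded bounded_C3_def, rule_format, of "[a, b]" p]
    assms(1)[unfolded bounded_C3_def, rule_format, of "[a, b, d]" p] assms(2) by auto

definition slice_pt :: "real \<Rightarrow> real \<Rightarrow> spacetime \<Rightarrow> spacetime" where
  "slice_pt \<delta> x p = (- x, (x + \<delta> * fst p) *\<^sub>R snd p)"

text \<open>The solution, the optical function and \<open>H\<close> vary with the radius x, whereas
  \<open>K\<close> comes from the fixed seed data. The slice properties hold only for large x: for
  negative G the equation is hyperbolic on the slice once the data are small.\<close>

locale pulse_family =
  fixes G A \<delta> M :: real and \<phi> u H :: "real \<Rightarrow> spacetime \<Rightarrow> real" and K :: "spacetime \<Rightarrow> real"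
  assumes \<delta>_pos: "\<delta> > 0" and K: "Cinf_on K cyl" "homog 0 cyl K" and K_bdd: "bounded_C3 M K"
    and family: "\<forall>\<^sub>F x in at_top. (\<exists>W V. pulse_slice G (\<phi> x) (u x) W V x \<delta> (H x) K) \<and> bounded_C3 M (H x) \<and>
      (\<forall>p\<in>ocyl. \<bar>ingoing G (\<phi> x) (\<phi> x) (slice_pt \<delta> x p)\<bar> \<le> A * sqrt \<delta> ^ 3 / x\<^sup>2 \<and>
         \<bar>ingoing G (\<phi> x) (ingoing G (\<phi> x) (\<phi> x)) (slice_pt \<delta> x p)\<bar> \<le> A * sqrt \<delta> ^ 3 / x ^ 3)"
begin

abbreviation al :: real where "al \<equiv> sqrt \<delta>"

lemma al: "al > 0" "al \<noteq> 0" "al * al = \<delta>" "al ^ 3 = al * \<delta>"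
  using \<delta>_pos by (auto simp: power3_eq_cube)

section \<open>Limits along an arbitrary selection of points\<close>

context
  fixes P :: "real \<Rightarrow> spacetime"
  assumes P_all: "\<forall>x. P x \<in> ocyl"
begin

lemma P: "P x \<in> ocyl" using P_all by blast

abbreviation "s x \<equiv> fst (P x)"
abbreviation "w x \<equiv> snd (P x)"
definition pt :: "real \<Rightarrow> spacetime" where "pt x = slice_pt \<delta> x (P x)"
definition q :: "real \<Rightarrow> real" where "q x = x / (x + \<delta> * s x)"
definition c :: "real \<Rightarrow> real" where "c x = wave_speed G (\<phi> x) (pt x)"
abbreviation "Kp x \<equiv> K (P x)"
abbreviation "Ks x \<equiv> pd et K (P x)"
abbreviation "kv j x \<equiv> sgrad K (P x) $ j"
abbreviation "Hs x \<equiv> pd et (H x) (P x)"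
abbreviation "Hss x \<equiv> pd et (pd et (H x)) (P x)"
abbreviation "hv j x \<equiv> sgrad (H x) (P x) $ j"
abbreviation "hs j x \<equiv> sgrad (pd et (H x)) (P x) $ j"
abbreviation "hh i j x \<equiv> sgrad (pd (ex i) (H x)) (P x) $ j"
definition \<rho> :: "real \<Rightarrow> real" where
  "\<rho> x = 2 * al * Hs x * q x + al ^ 3 * (\<Sum>i\<in>UNIV. hh i i x) * (q x)\<^sup>2 / x"
definition T :: "real \<Rightarrow> real" where
  "T x = x\<^sup>2 * (pd et (pd et (\<phi> x)) (pt x) - c x * (w x \<bullet> sgrad (pd et (\<phi> x)) (pt x)))"

lemma sw: "0 < s x" "s x < 1" "norm (w x) = 1"
  using P[of x] by (auto simp: ocyl_def mem_Times_iff)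

text \<open>\<open>pulse_slice\<close> can be interpreted only for one large x at a time, so its
  identities are exported here together, as eventual statements about functions of x.\<close>

lemma identities:
  "\<forall>\<^sub>F x in at_top. x > 0 \<and> pd et (\<phi> x) (pt x) = al / x * Kp x \<and>
     \<bar>al / x * (Kp x - c x * Hs x)\<bar> \<le> A * al ^ 3 / x\<^sup>2 \<and>
     \<bar>ingoing G (\<phi> x) (ingoing G (\<phi> x) (\<phi> x)) (pt x)\<bar> \<le> A * al ^ 3 / x ^ 3 \<and>
     T x / x = (c x)\<^sup>2 * (Hss x / al + \<rho> x / x) - c x * (Ks x / al) \<and>
     2 * T x = x\<^sup>2 * ingoing G (\<phi> x) (ingoing G (\<phi> x) (\<phi> x)) (pt x) + (c x)\<^sup>2 * \<rho> x
       - 3 * G * c x ^ 3 * (al * Kp x) * (al * Hs x) * (T x / x / x) \<and>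
     x * tr_chi G (\<phi> x) (u x) (pt x) + 2 * c x * q x = 3 * G * (c x)\<^sup>2 * (al * Kp x) * (T x / x / x)"
  using family
proof eventually_elim
  case (elim x)
  then obtain W V where "pulse_slice G (\<phi> x) (u x) W V x \<delta> (H x) K" by blast
  then interpret S: pulse_slice G "\<phi> x" "u x" W V x \<delta> "H x" K .
  note sw = sw[of x]
  have X: "S.X (s x) (w x) = pt x" unfolding S.X_def[OF sw] S.r_def[OF sw] pt_def slice_pt_def by simp
  have q: "x / S.r (s x) = q x" unfolding S.r_def[OF sw] q_def ..
  have c: "wave_speed G (\<phi> x) (pt x) = c x" by (simp add: c_def)
  have P': "S.P (s x) (w x) = P x" unfolding S.P_def[OF sw] by simp
  have \<rho>: "S.\<rho> (s x) (w x) = \<rho> x" unfolding S.\<rho>_def[OF sw] q P' \<rho>_def ..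
  have T: "S.T (s x) (w x) = T x" unfolding S.T_phi_t[OF sw, symmetric] X c T_def ..
  note rw = X q c P' \<rho> T
  have "\<bar>ingoing G (\<phi> x) (\<phi> x) (pt x)\<bar> \<le> A * al ^ 3 / x\<^sup>2"
    "\<bar>ingoing G (\<phi> x) (ingoing G (\<phi> x) (\<phi> x)) (pt x)\<bar> \<le> A * al ^ 3 / x ^ 3"
    using elim P[of x] unfolding pt_def by blast+
  then show ?case
    using S.r0_pos S.phi_t[OF sw, unfolded rw] S.T_eq[OF sw, unfolded rw]
      S.T_ingoing[OF sw, unfolded rw] S.null_expansion[OF sw, unfolded rw]
    unfolding S.ingoing_phi[OF sw, unfolded rw] by (intro conjI)
qed

text \<open>\<open>asym f f\<close> expresses boundedness; in this form quantities without a limit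
  enter the calculus unchanged.\<close>

lemma bdd:
  "asym (\<lambda>x. Kp x) (\<lambda>x. Kp x)" "asym (\<lambda>x. Ks x) (\<lambda>x. Ks x)" "asym (\<lambda>x. kv j x) (\<lambda>x. kv j x)"
  "asym (\<lambda>x. w x $ j) (\<lambda>x. w x $ j)"
proof -
  have "\<bar>w x $ j\<bar> \<le> 1" for x using component_le_norm_cart[of "w x" j] sw(3) by simp
  then show "asym (\<lambda>x. w x $ j) (\<lambda>x. w x $ j)" by (rule asym_refl[OF Bfun_bounded])
  have *: "asym f f" if "\<And>x. \<bar>f x\<bar> \<le> M" for f using asym_refl[OF Bfun_bounded[OF that]] .
  show "asym (\<lambda>x. Kp x) (\<lambda>x. Kp x)" using bounded_C3D[OF K_bdd P] by (intro *)
  show "asym (\<lambda>x. Ks x) (\<lambda>x. Ks x)" using bounded_C3D(2)[OF K_bdd P et_Basis] by (intro *)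
  show "asym (\<lambda>x. kv j x) (\<lambda>x. kv j x)"
    using bounded_C3D(2)[OF K_bdd P ex_Basis] by (intro *) (simp add: sgrad_def)
qed

lemma H_bdd:
  "asym (\<lambda>x. Hs x) (\<lambda>x. Hs x)" "asym (\<lambda>x. Hss x) (\<lambda>x. Hss x)" "asym (\<lambda>x. hv j x) (\<lambda>x. hv j x)"
  "asym (\<lambda>x. hs j x) (\<lambda>x. hs j x)" "asym (\<lambda>x. hh i j x) (\<lambda>x. hh i j x)"
proof -
  have H: "\<forall>\<^sub>F x in at_top. bounded_C3 M (H x)" using family by eventually_elim simp
  have *: "asym f f" if "\<And>x. bounded_C3 M (H x) \<Longrightarrow> \<bar>f x\<bar> \<le> M" for f
  proof -
    have "\<forall>\<^sub>F x in at_top. \<bar>f x\<bar> \<le> M" using H by eventually_elim (rule that)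
    then show ?thesis by (intro asym_refl) (auto simp: Bfun_iff)
  qed
  note b = bounded_C3D[OF _ P]
  show "asym (\<lambda>x. Hs x) (\<lambda>x. Hs x)" using b by (intro *) auto
  show "asym (\<lambda>x. Hss x) (\<lambda>x. Hss x)" using b by (intro *) auto
  show "asym (\<lambda>x. hv j x) (\<lambda>x. hv j x)" using b by (intro *) (auto simp: sgrad_def)
  show "asym (\<lambda>x. hs j x) (\<lambda>x. hs j x)" using b by (intro *) (auto simp: sgrad_def)
  show "asym (\<lambda>x. hh i j x) (\<lambda>x. hh i j x)" using b by (intro *) (auto simp: sgrad_def)
qed

lemma q: "asym q (\<lambda>x. 1)"
proof (rule asym_tendsto, rule tendsto_sandwich)
  have "x / (x + \<delta>) \<le> q x \<and> q x \<le> 1" if "x > 0" for x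
  proof -
    have "0 < \<delta> * s x" "\<delta> * s x \<le> \<delta> * 1" using \<delta>_pos sw[of x] by (auto intro: mult_left_mono)
    then show ?thesis unfolding q_def using that \<delta>_pos by (auto intro!: divide_left_mono mult_pos_pos)
  qed
  then show "\<forall>\<^sub>F x in at_top. x / (x + \<delta>) \<le> q x" "\<forall>\<^sub>F x in at_top. q x \<le> 1"
    by (auto intro!: eventually_mono[OF eventually_gt_at_top[of "0::real"]])
  have "((\<lambda>x. 1 / (1 + \<delta> / x)) \<longlongrightarrow> 1 / (1 + 0)) at_top"
    by (intro tendsto_intros tendsto_divide_0 filterlim_at_top_imp_at_infinity filterlim_ident) auto
  moreover have "\<forall>\<^sub>F x in at_top. 1 / (1 + \<delta> / x) = x / (x + \<delta>)"
    using eventually_gt_at_top[of 0] by eventually_elim (simp add: field_simps)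
  ultimately show "((\<lambda>x. x / (x + \<delta>)) \<longlongrightarrow> 1) at_top"
    using tendsto_cong by fastforce
qed simp

lemma c: "asym c (\<lambda>x. 1)"
proof -
  have "asym (\<lambda>x. 1 + 3 * G * (al * Kp x / x)\<^sup>2) (\<lambda>x. 1 + 3 * G * 0\<^sup>2)"
    by (intro asym_intros asym_over_x[OF asym_mult[OF asym_const bdd(1)]])
  then have "((\<lambda>x. (1 + 3 * G * (al * Kp x / x)\<^sup>2) powr (-1/2)) \<longlongrightarrow> 1 powr (-1/2)) at_top"
    by (intro tendsto_powr tendsto_const asym_tendstoD) simp_all
  then have "asym (\<lambda>x. (1 + 3 * G * (al * Kp x / x)\<^sup>2) powr (-1/2)) (\<lambda>x. 1)"
    by (intro asym_tendsto) simp
  then show ?thesis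
    by (rule asym_eventually) (use identities in eventually_elim, simp add: c_def wave_speed_def)
qed

lemma asym_over_bound:
  assumes "\<forall>\<^sub>F x in at_top. x > 0 \<and> \<bar>f x\<bar> \<le> C / x" shows "asym f (\<lambda>x. 0)"
proof -
  have "asym (\<lambda>x. C / x) (\<lambda>x. 0)" by (rule asym_over_x[OF asym_const])
  then have "((\<lambda>x. C / x) \<longlongrightarrow> 0) at_top" by (rule asym_tendstoD)
  then have "(f \<longlongrightarrow> 0) at_top"
    by (rule Lim_null_comparison[rotated]) (use assms in eventually_elim, simp)
  then show ?thesis by (rule asym_tendsto)
qed

lemma Hs: "asym (\<lambda>x. Hs x) (\<lambda>x. Kp x)"
proof -
  have "asym (\<lambda>x. Kp x - c x * Hs x) (\<lambda>x. 0)"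
  \<comment> \<open>Dividing A al^3 / x^2 by al / x leaves A \<delta> / x.\<close>
  proof (rule asym_over_bound[where C = "A * \<delta>"], use identities in eventually_elim)
    case (elim x)
    then have x: "x > 0" and "\<bar>al / x * (Kp x - c x * Hs x)\<bar> \<le> A * al ^ 3 / x\<^sup>2" by blast+
    then have "al / x * \<bar>Kp x - c x * Hs x\<bar> \<le> A * al ^ 3 / x\<^sup>2" using al(1) by (simp only: abs_mult abs_of_pos zero_less_divide_iff) simp
    also have "A * al ^ 3 / x\<^sup>2 = al / x * (A * \<delta> / x)" using al by (simp add: power2_eq_square)
    finally show ?case using x al(1) by (simp only: mult_le_cancel_left_pos divide_pos_pos)
  qed
  from asym_diff[OF bdd(1) this] have "asym (\<lambda>x. c x * Hs x) (\<lambda>x. Kp x)" by simp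
  moreover have "asym (\<lambda>x. c x * Hs x) (\<lambda>x. Hs x)" using asym_mult[OF c H_bdd(1)] by simp
  ultimately show ?thesis using asym_sym asym_trans by blast
qed

lemma \<rho>: "asym \<rho> (\<lambda>x. 2 * al * Kp x)"
proof -
  have "asym (\<lambda>x. 2 * al * Hs x * q x + al ^ 3 * (\<Sum>i\<in>UNIV. hh i i x) * (q x)\<^sup>2 / x) (\<lambda>x. 2 * al * Kp x * 1 + 0)"
    by (intro asym_add asym_mult asym_const Hs q
        asym_over_x[OF asym_mult[OF asym_mult[OF asym_const asym_sum[OF finite H_bdd(5)]] asym_power[OF q]]])
  then show ?thesis by (simp add: \<rho>_def[abs_def])
qed

lemma T_over_x: "asym (\<lambda>x. T x / x) (\<lambda>x. Hss x / al - Ks x / al)"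
proof -
  have "asym (\<lambda>x. (c x)\<^sup>2 * (Hss x / al + \<rho> x / x) - c x * (Ks x / al)) (\<lambda>x. 1\<^sup>2 * (Hss x / al + 0) - 1 * (Ks x / al))"
    by (intro asym_intros c H_bdd bdd asym_over_x[OF \<rho>] al asym_power[OF c])
  then have "asym (\<lambda>x. (c x)\<^sup>2 * (Hss x / al + \<rho> x / x) - c x * (Ks x / al)) (\<lambda>x. Hss x / al - Ks x / al)" by simp
  then show ?thesis by (rule asym_eventually) (use identities in eventually_elim, blast)
qed

text \<open>Half the limit of \<rho>, because two ingoing derivatives of \<phi> produce the incoming
  derivative of \<partial>_t \<phi> twice. The cubic term is disposed of by
  \<open>T_over_x\<close>.\<close>

lemma T: "asym T (\<lambda>x. al * Kp x)"
proof -
  let ?I = "\<lambda>x. x\<^sup>2 * ingoing G (\<phi> x) (ingoing G (\<phi> x) (\<phi> x)) (pt x)"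
  have I: "asym ?I (\<lambda>x. 0)"
  proof (rule asym_over_bound[where C = "A * al ^ 3"], use identities in eventually_elim)
    case (elim x)
    then have "x\<^sup>2 * \<bar>ingoing G (\<phi> x) (ingoing G (\<phi> x) (\<phi> x)) (pt x)\<bar> \<le> x\<^sup>2 * (A * al ^ 3 / x ^ 3)"
      by (intro mult_left_mono) auto
    also have "\<dots> = A * al ^ 3 / x" using elim by (simp add: power2_eq_square power3_eq_cube)
    finally show ?case using elim by (simp add: abs_mult)
  qed
  have "asym (\<lambda>x. (?I x + (c x)\<^sup>2 * \<rho> x - 3 * G * c x ^ 3 * (al * Kp x) * (al * Hs x) * (T x / x / x)) / 2)
     (\<lambda>x. (0 + 1\<^sup>2 * (2 * al * Kp x) - 3 * G * 1 ^ 3 * (al * Kp x) * (al * Kp x) * 0) / 2)"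
    by (intro asym_divide asym_add asym_diff asym_mult asym_const I \<rho> Hs bdd asym_over_x[OF T_over_x] asym_power[OF c]) auto
  then have "asym (\<lambda>x. (?I x + (c x)\<^sup>2 * \<rho> x - 3 * G * c x ^ 3 * (al * Kp x) * (al * Hs x) * (T x / x / x)) / 2)
     (\<lambda>x. al * Kp x)" by simp
  then show ?thesis
  proof (rule asym_eventually, use identities in eventually_elim)
    case (elim x)
    have half: "t = e / 2" if "2 * t = e" for t e :: real using that by simp
    show ?case by (rule half) (use elim in blast)
  qed
qed

text \<open>Two evaluations of T/x are compared: the one from \<open>T_eq\<close>, and the limit 0
  that follows from boundedness of \<open>T\<close>.\<close>

lemma Hss: "asym (\<lambda>x. Hss x) (\<lambda>x. Ks x)"
proof -
  have "asym (\<lambda>x. Hss x / al - Ks x / al) (\<lambda>x. 0)"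
    using asym_trans[OF asym_sym[OF T_over_x] asym_over_x[OF T]] .
  from asym_add[OF asym_mult[OF asym_const[of al] this] bdd(2)] show ?thesis
    using al by (simp add: right_diff_distrib)
qed

lemma null_expansion_asym: "asym (\<lambda>x. x * tr_chi G (\<phi> x) (u x) (pt x) + 2 * c x * q x) (\<lambda>x. 0)"
proof -
  have "asym (\<lambda>x. 3 * G * (c x)\<^sup>2 * (al * Kp x) * (T x / x / x)) (\<lambda>x. 3 * G * 1\<^sup>2 * (al * Kp x) * 0)"
    by (intro asym_mult asym_const bdd asym_over_x[OF T_over_x] asym_power[OF c])
  then have "asym (\<lambda>x. 3 * G * (c x)\<^sup>2 * (al * Kp x) * (T x / x / x)) (\<lambda>x. 0)" by simp
  then show ?thesis by (rule asym_eventually) (use identities in eventually_elim, blast)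
qed

end

text \<open>Interpolation needs smallness on the whole sphere of fixed s and not just at the
  selected point, hence a uniform statement before gradients are treated.\<close>

lemma Hs_uniform:
  assumes "e > 0" shows "\<forall>\<^sub>F x in at_top. \<forall>p\<in>ocyl. \<bar>pd et (H x) p - K p\<bar> < e"
proof (rule uniform_if_all_selections[OF _ _ assms])
  have "(1/2, axis 1 1) \<in> ocyl" by (simp add: ocyl_def)
  then show "ocyl \<noteq> {}" by blast
  fix P :: "real \<Rightarrow> spacetime" assume "\<And>x. P x \<in> ocyl"
  then have "\<forall>x. P x \<in> ocyl" by blast
  from Hs[OF this] show "((\<lambda>x. pd et (H x) (P x) - K (P x)) \<longlongrightarrow> 0) at_top" by (simp add: asym_def)
qed

lemma pd_diff:
  assumes "f differentiable (at p)" "g differentiable (at p)"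
  shows "pd a (\<lambda>p. f p - g p :: real) p = pd a f p - pd a g p"
  by (rule pd_eqI) (intro has_derivative_diff has_derivative_pd assms)

context
  fixes P :: "real \<Rightarrow> spacetime"
  assumes P: "\<forall>x. P x \<in> ocyl"
begin

text \<open>Interpolation is applied to the difference of \<partial>_s H and K: it is homogeneous of
  degree zero, uniformly small, and has second axis derivatives at most 2M.\<close>

lemma hs: "asym (\<lambda>x. hs P j x) (\<lambda>x. kv P j x)"
  unfolding asym_def
proof
  show "Bfun (\<lambda>x. kv P j x) at_top" using asym_Bfun[OF bdd(3)[OF P]] .
  show "((\<lambda>x. hs P j x - kv P j x) \<longlongrightarrow> 0) at_top"
  proof (rule tendstoI)
    fix e :: real assume e: "e > 0"
    have M: "M \<ge> 0" using bounded_C3D(1)[OF K_bdd P[rule_format]] by (meson abs_ge_zero order_trans)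
    \<comment> \<open>With segment length \<open>t\<close> and smallness e t / 8 the interpolation
      bound is e/4 plus at most e/2.\<close>
    define t where "t = min (1/2) (e / (16 * (M + 1)))"
    have t: "0 < t" "t \<le> 1/2" "t \<le> e / (16 * (M + 1))"
    proof -
      show "0 < t" using e M by (simp add: t_def)
      show "t \<le> 1/2" "t \<le> e / (16 * (M + 1))"
        unfolding t_def by (rule min.cobounded1, rule min.cobounded2)
    qed
    from t(3) have "t * (16 * (M + 1)) \<le> e" using M by (simp add: pos_le_divide_eq)
    then have Mt: "4 * (M + M) * t \<le> e / 2 " using t(1) by (simp add: algebra_simps)
    have "e * t / 8 > 0" using e t by simp
    from Hs_uniform[OF this] family
    show "\<forall>\<^sub>F x in at_top. dist (hs P j x - kv P j x) 0 < e"
    proof eventually_elim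
      case (elim x)
      then obtain W V where "pulse_slice G (\<phi> x) (u x) W V x \<delta> (H x) K" by blast
      then interpret S: pulse_slice G "\<phi> x" "u x" W V x \<delta> "H x" K .
      define f where "f p = pd et (H x) p - K p" for p
      note H = Cinf_on_pd[OF S.H(1) et_Basis] homog_pd_et[OF S.H(2) open_cyl S.H(1)]
      have d: "F differentiable (at p)" if "Cinf_on F cyl" "p \<in> cyl" for F p
        using Cinf_on_differentiable[OF that(1) open_cyl that(2)] .
      have "Ck_on k (\<lambda>p. pd et (H x) p + (-1) * K p) cyl" for k
        using H(1) S.K(1) by (intro Ck_on_add Ck_on_mult Ck_on_const open_cyl) (auto simp: Cinf_on_def)
      then have f: "Cinf_on f cyl" by (simp add: Cinf_on_def f_def[abs_def])
      have hom: "homog 0 cyl f"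
        using H(2) S.K(2) by (auto simp: homog_def f_def)
      have cyl: "(s, y) \<in> cyl" if "0 < s" "s < 1" "y \<noteq> 0" for s y using that by (simp add: cyl_def)
      have 1: "pd (ex j) f p = pd (ex j) (pd et (H x)) p - pd (ex j) K p" if "p \<in> cyl" for p
        unfolding f_def by (intro pd_diff d that H S.K)
      have 2: "pd (ex j) (pd (ex j) f) p = pd (ex j) (pd (ex j) (pd et (H x))) p - pd (ex j) (pd (ex j) K) p"
        if "p \<in> cyl" for p
      proof -
        have "pd (ex j) (pd (ex j) f) p = pd (ex j) (\<lambda>p. pd (ex j) (pd et (H x)) p - pd (ex j) K p) p"
          using 1 by (intro pd_cong[OF open_cyl that])
        then show ?thesis
          using pd_diff[OF d[OF Cinf_on_pd[OF H(1) ex_Basis] that] d[OF Cinf_on_pd[OF S.K(1) ex_Basis] that]] by simp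
      qed
      have oc: "(s P x, y) \<in> ocyl" if "norm y = 1" for y using sw[OF P, of x] that by (simp add: ocyl_def)
      have "\<bar>pd (ex j) f (s P x, w P x)\<bar> \<le> 2 * (e * t / 8) / t + 4 * (M + M) * t"
      proof (rule homog_gradient_interpolation[OF hom open_cyl f _ sw(3)[OF P] _ _ t(1,2)])
        fix y :: "real^3"
        show "(s P x, y) \<in> cyl" if "y \<noteq> 0" using cyl sw[OF P, of x] that by auto
        assume y: "norm y = 1"
        then have yc: "(s P x, y) \<in> cyl" using cyl[OF sw(1)[OF P, of x] sw(2)[OF P, of x]] by (cases "y = 0") auto
        show "\<bar>f (s P x, y)\<bar> \<le> e * t / 8"
          using elim(1) oc[OF y] unfolding f_def by (meson less_imp_le)
        have "\<bar>pd (ex j) (pd (ex j) (pd et (H x))) (s P x, y)\<bar> \<le> M"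
          using elim(2) bounded_C3D(4)[OF _ oc[OF y]] by simp
        moreover have "\<bar>pd (ex j) (pd (ex j) K) (s P x, y)\<bar> \<le> M"
          using bounded_C3D(3)[OF K_bdd oc[OF y]] by simp
        ultimately show "\<bar>pd (ex j) (pd (ex j) f) (s P x, y)\<bar> \<le> M + M" unfolding 2[OF yc] by linarith
      qed
      also have "\<dots> < e" using Mt t(1) e by simp
      finally have "\<bar>pd (ex j) f (P x)\<bar> < e" by simp
      moreover have "P x \<in> cyl"
        using cyl[OF sw(1)[OF P, of x] sw(2)[OF P, of x], of "w P x"] sw(3)[OF P, of x] by (cases "w P x = 0") auto
      ultimately show ?case using 1[of "P x"] by (simp add: sgrad_def)
    qed
  qed
qed

definition r4D :: "spacetime \<Rightarrow> real \<Rightarrow> real" where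
  "r4D e x = x ^ 4 * ((norm (sgrad (pd e (\<phi> x)) (pt P x)))\<^sup>2 - (w P x \<bullet> sgrad (pd e (\<phi> x)) (pt P x))\<^sup>2)"

text \<open>That the first and third quantity share their limit is the source of the cancellation in
  the K_1 energy. For \<open>ex i\<close> the angular terms are of lower order in the first two
  claims but contribute to the last, where they complete the gradient of K to that of \<omega>_i
  K.\<close>

lemma wave_component_asym:
  assumes e: "e \<in> Basis"
  shows "asym (\<lambda>x. x * pd e (\<phi> x) (pt P x)) (\<lambda>x. al * (amplitude e (P x) * Kp P x))"
    "asym (\<lambda>x. x * (w P x \<bullet> sgrad (pd e (\<phi> x)) (pt P x))) (\<lambda>x. amplitude e (P x) * Ks P x / al)"
    "asym (\<lambda>x. x\<^sup>2 * (pd et (pd e (\<phi> x)) (pt P x) - c P x * (w P x \<bullet> sgrad (pd e (\<phi> x)) (pt P x))))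
      (\<lambda>x. al * (amplitude e (P x) * Kp P x))"
    "asym (r4D e) (\<lambda>x. \<delta> * (norm (angular_gradient K e (P x)))\<^sup>2)"
proof -
  note b = bdd[OF P] and Hb = H_bdd[OF P] and cq = c[OF P] q[OF P] and sw = sw[OF P]
  consider (t) "e = et" | (x) i where "e = ex i" using e Basis_spacetime by blast
  note e_cases = this
  have fam: "\<forall>\<^sub>F x in at_top. x > 0 \<and> (\<exists>W V. pulse_slice G (\<phi> x) (u x) W V x \<delta> (H x) K)"
    using family eventually_gt_at_top[of 0] by eventually_elim simp
  have n2: "(norm v)\<^sup>2 = (\<Sum>j\<in>UNIV. (v $ j)\<^sup>2)" for v :: "real^3"
    unfolding power2_norm_eq_inner inner_vec_def by (simp add: power2_eq_square)
  have "(asym (\<lambda>x. x * pd e (\<phi> x) (pt P x)) (\<lambda>x. al * (amplitude e (P x) * Kp P x)) \<and>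
    asym (\<lambda>x. x * (w P x \<bullet> sgrad (pd e (\<phi> x)) (pt P x))) (\<lambda>x. amplitude e (P x) * Ks P x / al)) \<and>
    asym (\<lambda>x. x\<^sup>2 * (pd et (pd e (\<phi> x)) (pt P x) - c P x * (w P x \<bullet> sgrad (pd e (\<phi> x)) (pt P x))))
      (\<lambda>x. al * (amplitude e (P x) * Kp P x)) \<and>
    asym (r4D e) (\<lambda>x. \<delta> * (norm (angular_gradient K e (P x)))\<^sup>2)"
  proof (cases rule: e_cases)
    case t
    have amp: "amplitude e p = 1" for p by (simp add: t amplitude_def et_def)
    have ang: "angular_gradient K e p = sgrad K p" for p
      by (simp add: t angular_gradient_def amplitude_def et_def)
    have ids: "\<forall>\<^sub>F x in at_top. x * pd et (\<phi> x) (pt P x) = al * Kp P x \<and>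
      x * (w P x \<bullet> sgrad (pd et (\<phi> x)) (pt P x)) = Ks P x / al \<and>
      r4D et x = (\<Sum>j\<in>UNIV. (al * q P x * kv P j x)\<^sup>2)"
      using fam
    proof eventually_elim
      case (elim x)
      then obtain W V where "pulse_slice G (\<phi> x) (u x) W V x \<delta> (H x) K" by blast
      then interpret S: pulse_slice G "\<phi> x" "u x" W V x \<delta> "H x" K .
      note sw = sw[of x]
      have X: "S.X (s P x) (w P x) = pt P x" unfolding S.X_def[OF sw] S.r_def[OF sw] pt_def[OF P] slice_pt_def by simp
      have q: "x / S.r (s P x) = q P x" unfolding S.r_def[OF sw] q_def[OF P] ..
      have P': "S.P (s P x) (w P x) = P x" unfolding S.P_def[OF sw] by simp
      note rw = X q P'
      have "x * pd et (\<phi> x) (pt P x) = al * Kp P x" using S.phi_t[OF sw, unfolded rw] elim by simp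
      then show ?case
        unfolding r4D_def using S.phi_tr[OF sw, unfolded rw] S.angular_phi_t[OF sw, unfolded rw] by blast
    qed
    have "asym (\<lambda>x. x * pd et (\<phi> x) (pt P x)) (\<lambda>x. al * Kp P x)"
      by (rule asym_eventually[OF asym_mult[OF asym_const b(1)]]) (use ids in eventually_elim, blast)
    moreover have "asym (\<lambda>x. x * (w P x \<bullet> sgrad (pd et (\<phi> x)) (pt P x))) (\<lambda>x. Ks P x / al)"
      by (rule asym_eventually[OF asym_divide[OF b(2) asym_const al(2)]]) (use ids in eventually_elim, blast)
    moreover have "asym (\<lambda>x. x\<^sup>2 * (pd et (pd et (\<phi> x)) (pt P x) - c P x * (w P x \<bullet> sgrad (pd et (\<phi> x)) (pt P x))))
      (\<lambda>x. al * Kp P x)"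
      using T[OF P] unfolding T_def[OF P, abs_def] .
    moreover have "asym (r4D et) (\<lambda>x. \<delta> * (norm (sgrad K (P x)))\<^sup>2)"
    proof -
      have "asym (\<lambda>x. \<Sum>j\<in>UNIV. (al * q P x * kv P j x)\<^sup>2) (\<lambda>x. \<Sum>j\<in>UNIV. (al * 1 * kv P j x)\<^sup>2)"
        by (intro asym_sum asym_power asym_mult asym_const cq b finite)
      then have "asym (r4D et) (\<lambda>x. \<Sum>j\<in>UNIV. (al * 1 * kv P j x)\<^sup>2)"
        by (rule asym_eventually) (use ids in eventually_elim, blast)
      then show ?thesis using \<delta>_pos by (simp add: n2 power_mult_distrib sum_distrib_left)
    qed
    ultimately show ?thesis unfolding amp ang unfolding t by simp
  next
    case (x i)
    have amp: "amplitude e p = snd p $ i" for p by (simp add: x amplitude_def ex_def inner_axis')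
    have ang: "angular_gradient K e p $ j = K p * ((if j = i then 1 else 0) - snd p $ i * snd p $ j) + snd p $ i * sgrad K p $ j" for p j
    proof -
      have "axis i 1 \<bullet> v = v $ i" "axis i (1::real) $ j = (if j = i then 1 else 0)" for v :: "real^3"
        by (simp_all add: inner_axis') (simp add: axis_def)
      then show ?thesis by (simp add: x angular_gradient_def amplitude_def ex_def)
    qed
    let ?B = "\<lambda>j x. al * q P x * (Hs P x * ((if j = i then 1 else 0) - w P x $ i * w P x $ j) + w P x $ i * hs P j x)
      + al * \<delta> * (q P x)\<^sup>2 * (hh P i j x + hv P i x * w P x $ j) / x"
    have ids: "\<forall>\<^sub>F x in at_top. x * pd (ex i) (\<phi> x) (pt P x) = al * w P x $ i * Hs P x + al * \<delta> * hv P i x * q P x / x \<and>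
      x * (w P x \<bullet> sgrad (pd (ex i) (\<phi> x)) (pt P x)) =
        w P x $ i * Hss P x / al + al * hs P i x * q P x / x - al * \<delta> * hv P i x * (q P x)\<^sup>2 / x / x \<and>
      x\<^sup>2 * (pd et (pd (ex i) (\<phi> x)) (pt P x) - c P x * (w P x \<bullet> sgrad (pd (ex i) (\<phi> x)) (pt P x))) =
        w P x $ i * (((c P x)\<^sup>2 * \<rho> P x - T P x) / c P x) + al * q P x * (kv P i x - c P x * hs P i x)
          + c P x * (al * \<delta> * hv P i x * (q P x)\<^sup>2 / x) \<and>
      r4D (ex i) x = (\<Sum>j\<in>UNIV. (?B j x)\<^sup>2)"
      using fam
    proof eventually_elim
      case (elim x)
      then obtain W V where "pulse_slice G (\<phi> x) (u x) W V x \<delta> (H x) K" by blast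
      then interpret S: pulse_slice G "\<phi> x" "u x" W V x \<delta> "H x" K .
      note sw = sw[of x]
      have X: "S.X (s P x) (w P x) = pt P x" unfolding S.X_def[OF sw] S.r_def[OF sw] pt_def[OF P] slice_pt_def by simp
      have q: "x / S.r (s P x) = q P x" unfolding S.r_def[OF sw] q_def[OF P] ..
      have P': "S.P (s P x) (w P x) = P x" unfolding S.P_def[OF sw] by simp
      have c: "wave_speed G (\<phi> x) (pt P x) = c P x" by (simp add: c_def[OF P])
      have \<rho>: "S.\<rho> (s P x) (w P x) = \<rho> P x" unfolding S.\<rho>_def[OF sw] q P' \<rho>_def[OF P] ..
      have T: "S.T (s P x) (w P x) = T P x" unfolding S.T_phi_t[OF sw, symmetric] X c T_def[OF P] ..
      note rw = X q P' c \<rho> T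
      show ?case
        unfolding r4D_def using S.phi_i[OF sw, of i, unfolded rw] S.phi_ir_scaled[OF sw, of i, unfolded rw]
          S.incoming_phi_i[OF sw, of i, unfolded rw] S.angular_phi_i[OF sw, of i, unfolded rw] by blast
    qed
    have "asym (\<lambda>x. al * w P x $ i * Hs P x + al * \<delta> * hv P i x * q P x / x) (\<lambda>x. al * w P x $ i * Kp P x + 0)"
      by (intro asym_add asym_mult asym_const b Hb cq asym_over_x Hs[OF P])
         (rule asym_over_x asym_mult asym_const Hb cq)+
    then have "asym (\<lambda>x. al * w P x $ i * Hs P x + al * \<delta> * hv P i x * q P x / x) (\<lambda>x. al * (w P x $ i * Kp P x))"
      by (simp add: mult.assoc)
    then have 1: "asym (\<lambda>x. x * pd (ex i) (\<phi> x) (pt P x)) (\<lambda>x. al * (w P x $ i * Kp P x))"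
      by (rule asym_eventually) (use ids in eventually_elim, blast)
    have "asym (\<lambda>x. w P x $ i * Hss P x / al + al * hs P i x * q P x / x - al * \<delta> * hv P i x * (q P x)\<^sup>2 / x / x)
      (\<lambda>x. w P x $ i * Ks P x / al + 0 - 0)"
      by (intro asym_add asym_diff asym_divide[OF asym_mult[OF b(4) Hss[OF P]] asym_const al(2)]
          asym_over_x[OF asym_mult[OF asym_mult[OF asym_const Hb(4)] cq(2)]]
          asym_over_x[OF asym_over_x[OF asym_mult[OF asym_mult[OF asym_const Hb(3)] asym_power[OF cq(2)]]]])
    then have "asym (\<lambda>x. w P x $ i * Hss P x / al + al * hs P i x * q P x / x - al * \<delta> * hv P i x * (q P x)\<^sup>2 / x / x)
      (\<lambda>x. w P x $ i * Ks P x / al)" by simp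
    then have 2: "asym (\<lambda>x. x * (w P x \<bullet> sgrad (pd (ex i) (\<phi> x)) (pt P x))) (\<lambda>x. w P x $ i * Ks P x / al)"
      by (rule asym_eventually) (use ids in eventually_elim, blast)
    \<comment> \<open>Here \<rho> contributes 2 al K, of which \<open>T\<close> removes one half,
      and the gradients of \<partial>_s H and K cancel.\<close>
    have "asym (\<lambda>x. w P x $ i * (((c P x)\<^sup>2 * \<rho> P x - T P x) / c P x) + al * q P x * (kv P i x - c P x * hs P i x)
          + c P x * (al * \<delta> * hv P i x * (q P x)\<^sup>2 / x))
      (\<lambda>x. w P x $ i * ((1\<^sup>2 * (2 * al * Kp P x) - al * Kp P x) / 1) + al * 1 * (kv P i x - 1 * kv P i x) + 1 * 0)"
      by (intro asym_add asym_mult asym_diff asym_divide[OF _ cq(1)] b cq asym_power[OF cq(1)] \<rho>[OF P] T[OF P] hs asym_const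
          asym_over_x[OF asym_mult[OF asym_mult[OF asym_const Hb(3)] asym_power[OF cq(2)]]]) simp
    then have "asym (\<lambda>x. w P x $ i * (((c P x)\<^sup>2 * \<rho> P x - T P x) / c P x) + al * q P x * (kv P i x - c P x * hs P i x)
          + c P x * (al * \<delta> * hv P i x * (q P x)\<^sup>2 / x)) (\<lambda>x. al * (w P x $ i * Kp P x))"
      by (simp add: mult_ac)
    then have 3: "asym (\<lambda>x. x\<^sup>2 * (pd et (pd (ex i) (\<phi> x)) (pt P x) - c P x * (w P x \<bullet> sgrad (pd (ex i) (\<phi> x)) (pt P x))))
      (\<lambda>x. al * (w P x $ i * Kp P x))"
      by (rule asym_eventually) (use ids in eventually_elim, blast)
    have "asym (\<lambda>x. \<Sum>j\<in>UNIV. (?B j x)\<^sup>2) (\<lambda>x. \<Sum>j\<in>UNIV. (al * 1 *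
        (Kp P x * ((if j = i then 1 else 0) - w P x $ i * w P x $ j) + w P x $ i * kv P j x) + 0)\<^sup>2)"
      by (intro asym_sum asym_power asym_add asym_mult asym_diff asym_const cq b finite Hs[OF P] hs
          asym_over_x[OF asym_mult[OF asym_mult[OF asym_const asym_power[OF cq(2)]] asym_add[OF Hb(5) asym_mult[OF Hb(3) b(4)]]]])
    then have "asym (r4D (ex i)) (\<lambda>x. \<Sum>j\<in>UNIV. (al * 1 *
        (Kp P x * ((if j = i then 1 else 0) - w P x $ i * w P x $ j) + w P x $ i * kv P j x) + 0)\<^sup>2)"
      by (rule asym_eventually) (use ids in eventually_elim, blast)
    then have 4: "asym (r4D (ex i)) (\<lambda>x. \<delta> * (norm (angular_gradient K e (P x)))\<^sup>2)"
      unfolding n2 ang using \<delta>_pos by (simp only: sum_distrib_left) (simp add: power_mult_distrib)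
    show ?thesis unfolding amp using 1 2 3 4 unfolding x by blast
  qed
  then show "asym (\<lambda>x. x * pd e (\<phi> x) (pt P x)) (\<lambda>x. al * (amplitude e (P x) * Kp P x))"
    "asym (\<lambda>x. x * (w P x \<bullet> sgrad (pd e (\<phi> x)) (pt P x))) (\<lambda>x. amplitude e (P x) * Ks P x / al)"
    "asym (\<lambda>x. x\<^sup>2 * (pd et (pd e (\<phi> x)) (pt P x) - c P x * (w P x \<bullet> sgrad (pd e (\<phi> x)) (pt P x))))
      (\<lambda>x. al * (amplitude e (P x) * Kp P x))"
    "asym (r4D e) (\<lambda>x. \<delta> * (norm (angular_gradient K e (P x)))\<^sup>2)" by blast+
qed

lemma density_asym:
  assumes e: "e \<in> Basis"
  shows "asym (\<lambda>x. (x + \<delta> * s P x)\<^sup>2 * dens0 G (\<phi> x) (u x) (pd e (\<phi> x)) (pt P x))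
      (\<lambda>x. 2 * (amplitude e (P x) * Ks P x / al)\<^sup>2)"
    "asym (\<lambda>x. (x + \<delta> * s P x)\<^sup>2 * dens1 (- x) G (\<phi> x) (u x) (pd e (\<phi> x)) (pt P x))
      (\<lambda>x. - (\<delta> * (norm (angular_gradient K e (P x)))\<^sup>2))"
    "asym (\<lambda>x. x * tr_chi G (\<phi> x) (u x) (pt P x)) (\<lambda>x. -2)"
proof -
  let ?f = "\<lambda>x. pd e (\<phi> x) (pt P x)" and ?ft = "\<lambda>x. pd et (pd e (\<phi> x)) (pt P x)"
  let ?fr = "\<lambda>x. w P x \<bullet> sgrad (pd e (\<phi> x)) (pt P x)"
  let ?D = "\<lambda>x. (norm (sgrad (pd e (\<phi> x)) (pt P x)))\<^sup>2 - (?fr x)\<^sup>2"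
  let ?tr = "\<lambda>x. tr_chi G (\<phi> x) (u x) (pt P x)"
  note comp = wave_component_asym[OF e]
  \<comment> \<open>The cancellation: c and q tend to 1, and both terms have the limit al times
    amplitude times K.\<close>
  have "asym (\<lambda>x. x\<^sup>2 * (?ft x - c P x * ?fr x) - c P x * q P x * (x * ?f x))
    (\<lambda>x. al * (amplitude e (P x) * Kp P x) - 1 * 1 * (al * (amplitude e (P x) * Kp P x)))"
    by (intro asym_diff asym_mult comp c[OF P] q[OF P])
  then have "asym (\<lambda>x. x\<^sup>2 * (?ft x - c P x * ?fr x) - c P x * q P x * (x * ?f x)) (\<lambda>x. 0)" by simp
  then have Z: "asym (\<lambda>x. x\<^sup>2 * (?ft x - c P x * ?fr x - c P x * q P x / x * ?f x)) (\<lambda>x. 0)"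
    by (rule asym_eventually)
       (use eventually_gt_at_top[of 0] in \<open>eventually_elim, simp add: field_simps power2_eq_square\<close>)
  interpret E: energy_asymptotics "c P" "q P" ?f ?ft ?fr ?D ?tr "\<lambda>x. amplitude e (P x) * Ks P x / al"
    "\<lambda>x. \<delta> * (norm (angular_gradient K e (P x)))\<^sup>2" "\<lambda>x. al * (amplitude e (P x) * Kp P x)"
    by unfold_locales
       (use comp(1,2,4) Z c[OF P] q[OF P] null_expansion_asym[OF P] in \<open>simp_all add: r4D_def[abs_def]\<close>)
  have "asym (\<lambda>x. (x * ?tr x + 2 * c P x * q P x) - 2 * c P x * q P x) (\<lambda>x. 0 - 2 * 1 * 1)"
    by (intro asym_diff asym_mult asym_const null_expansion_asym[OF P] c[OF P] q[OF P])
  then show "asym (\<lambda>x. x * ?tr x) (\<lambda>x. -2)" by simp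
  have id: "\<forall>\<^sub>F x in at_top.
     (x + \<delta> * s P x)\<^sup>2 * dens0 G (\<phi> x) (u x) (pd e (\<phi> x)) (pt P x) = (x / q P x)\<^sup>2 *
       (1 / (2 * c P x) * ((?ft x / c P x + ?fr x)\<^sup>2 + 1 / c P x * (?ft x - c P x * ?fr x)\<^sup>2 + (c P x + 1) * ?D x)) \<and>
     (x + \<delta> * s P x)\<^sup>2 * dens1 (- x) G (\<phi> x) (u x) (pd e (\<phi> x)) (pt P x) = (x / q P x)\<^sup>2 *
       (1 / (2 * c P x) * (4 * x / ?tr x) * (1 / c P x * (?ft x - c P x * ?fr x + 1/2 * ?tr x * ?f x)\<^sup>2 + c P x * ?D x))"
    using family
  proof eventually_elim
    case (elim x)
    then obtain W V where "pulse_slice G (\<phi> x) (u x) W V x \<delta> (H x) K" by blast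
    then interpret S: pulse_slice G "\<phi> x" "u x" W V x \<delta> "H x" K .
    note sw = sw[OF P, of x]
    let ?y = "(x + \<delta> * s P x) *\<^sub>R w P x"
    have X: "S.X (s P x) (w P x) = (- x, ?y)" unfolding S.X_def[OF sw] S.r_def[OF sw] ..
    have pt: "pt P x = (- x, ?y)" unfolding pt_def[OF P] slice_pt_def ..
    have r: "S.r (s P x) = x + \<delta> * s P x" unfolding S.r_def[OF sw] ..
    have y: "?y /\<^sub>R norm ?y = w P x" using S.radius(1,4)[OF sw] unfolding r by simp
    have xq: "x / q P x = x + \<delta> * s P x" unfolding q_def[OF P] using S.r0_pos S.r_pos[OF sw] r by simp
    have dom: "(- x, ?y) \<in> S.dom" using S.X_dom[OF sw] unfolding X .
    have d: "pd e (\<phi> x) differentiable (at (- x, ?y))" using S.diff_phi(2)[OF S.X_W[OF sw] e] unfolding X .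
    have c: "wave_speed G (\<phi> x) (- x, ?y) = c P x" unfolding c_def[OF P] pt ..
    show ?case
      using S.dens_slice[OF dom d] unfolding y c unfolding pt xq by simp
  qed
  show "asym (\<lambda>x. (x + \<delta> * s P x)\<^sup>2 * dens0 G (\<phi> x) (u x) (pd e (\<phi> x)) (pt P x))
      (\<lambda>x. 2 * (amplitude e (P x) * Ks P x / al)\<^sup>2)"
    by (rule asym_eventually[OF E.energy0_asym]) (use id in eventually_elim, blast)
  show "asym (\<lambda>x. (x + \<delta> * s P x)\<^sup>2 * dens1 (- x) G (\<phi> x) (u x) (pd e (\<phi> x)) (pt P x))
      (\<lambda>x. - (\<delta> * (norm (angular_gradient K e (P x)))\<^sup>2))"
    by (rule asym_eventually[OF E.energy1_asym]) (use id in eventually_elim, blast)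
qed

end

text \<open>The third claim keeps the null expansion away from zero, which continuity of the second
  density will require.\<close>

lemma density_uniform:
  assumes e: "e \<in> Basis" and "\<epsilon> > 0"
  shows "\<forall>\<^sub>F x in at_top. \<forall>p\<in>ocyl. \<bar>(x + \<delta> * fst p)\<^sup>2 * dens0 G (\<phi> x) (u x) (pd e (\<phi> x)) (slice_pt \<delta> x p)
      - 2 / \<delta> * (amplitude e p * pd et K p)\<^sup>2\<bar> < \<epsilon>" (is ?A)
    and "\<forall>\<^sub>F x in at_top. \<forall>p\<in>ocyl. \<bar>(x + \<delta> * fst p)\<^sup>2 * dens1 (- x) G (\<phi> x) (u x) (pd e (\<phi> x)) (slice_pt \<delta> x p)
      - - (\<delta> * (norm (angular_gradient K e p))\<^sup>2)\<bar> < \<epsilon>" (is ?B)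
    and "\<forall>\<^sub>F x in at_top. \<forall>p\<in>ocyl. \<bar>x * tr_chi G (\<phi> x) (u x) (slice_pt \<delta> x p) - -2\<bar> < \<epsilon>" (is ?C)
proof -
  have "(1/2, axis 1 1) \<in> ocyl" by (simp add: ocyl_def)
  then have ne: "ocyl \<noteq> {}" by blast
  have sel: "((\<lambda>x. (x + \<delta> * fst (P x))\<^sup>2 * dens0 G (\<phi> x) (u x) (pd e (\<phi> x)) (slice_pt \<delta> x (P x))
      - 2 / \<delta> * (amplitude e (P x) * pd et K (P x))\<^sup>2) \<longlongrightarrow> 0) at_top"
    "((\<lambda>x. (x + \<delta> * fst (P x))\<^sup>2 * dens1 (- x) G (\<phi> x) (u x) (pd e (\<phi> x)) (slice_pt \<delta> x (P x))
      - - (\<delta> * (norm (angular_gradient K e (P x)))\<^sup>2)) \<longlongrightarrow> 0) at_top"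
    "((\<lambda>x. x * tr_chi G (\<phi> x) (u x) (slice_pt \<delta> x (P x)) - -2) \<longlongrightarrow> 0) at_top"
    if "\<And>x. P x \<in> ocyl" for P :: "real \<Rightarrow> spacetime"
  proof -
    have P: "\<forall>x. P x \<in> ocyl" using that by blast
    note a = density_asym[OF P e, unfolded pt_def[OF P] asym_def]
    have "2 * (y / al)\<^sup>2 = 2 / \<delta> * y\<^sup>2" for y using \<delta>_pos by (simp add: power_divide)
    with a(1) show "((\<lambda>x. (x + \<delta> * fst (P x))\<^sup>2 * dens0 G (\<phi> x) (u x) (pd e (\<phi> x)) (slice_pt \<delta> x (P x))
      - 2 / \<delta> * (amplitude e (P x) * pd et K (P x))\<^sup>2) \<longlongrightarrow> 0) at_top" by simp
    show "((\<lambda>x. (x + \<delta> * fst (P x))\<^sup>2 * dens1 (- x) G (\<phi> x) (u x) (pd e (\<phi> x)) (slice_pt \<delta> x (P x))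
      - - (\<delta> * (norm (angular_gradient K e (P x)))\<^sup>2)) \<longlongrightarrow> 0) at_top" using a(2) by (rule conjunct1)
    show "((\<lambda>x. x * tr_chi G (\<phi> x) (u x) (slice_pt \<delta> x (P x)) - -2) \<longlongrightarrow> 0) at_top"
      using a(3) by (rule conjunct1)
  qed
  show ?A by (rule uniform_if_all_selections[OF ne sel(1) \<open>\<epsilon> > 0\<close>])
  show ?B by (rule uniform_if_all_selections[OF ne sel(2) \<open>\<epsilon> > 0\<close>])
  show ?C by (rule uniform_if_all_selections[OF ne sel(3) \<open>\<epsilon> > 0\<close>])
qed

end


section \<open>Convergence of the integrals\<close>

lemma continuous_on_energy_integrand:
  fixes c f ft fr g \<kappa> :: "'a::topological_space \<Rightarrow> real"
  assumes "continuous_on S c" "continuous_on S f" "continuous_on S ft" "continuous_on S fr"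
    "continuous_on S g" "continuous_on S \<kappa>" and c: "\<And>x. x \<in> S \<Longrightarrow> c x \<noteq> 0"
  shows "continuous_on S (\<lambda>x. 1 / (2 * c x) * ((ft x / c x + fr x)\<^sup>2 + 1 / c x * (ft x - c x * fr x)\<^sup>2
      + (c x + 1) * ((g x)\<^sup>2 - (fr x)\<^sup>2)))"
    and "(\<And>x. x \<in> S \<Longrightarrow> \<kappa> x \<noteq> 0) \<Longrightarrow> continuous_on S (\<lambda>x. 1 / (2 * c x) * (a / \<kappa> x) *
      (1 / c x * (ft x - c x * fr x + 1/2 * \<kappa> x * f x)\<^sup>2 + c x * ((g x)\<^sup>2 - (fr x)\<^sup>2)))"
  by (intro continuous_on_add continuous_on_diff continuous_on_mult continuous_on_divide continuous_on_power
      continuous_on_const assms; simp add: c)+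

section \<open>Continuity of the densities on the slice\<close>

context optical_slice
begin

abbreviation slice :: "(real^3) set" where "slice \<equiv> {x. (t, x) \<in> dom}"

lemma continuous_on_slice:
  assumes "continuous_on W f" shows "continuous_on slice (\<lambda>x. f (t, x))"
  by (rule continuous_on_compose2[OF assms]) (auto intro!: continuous_intros simp: domD(2))

lemma continuous_on_wave_speed: "continuous_on slice (\<lambda>x. c (t, x))"
proof -
  have "continuous_on dom c"
    by (intro continuous_at_imp_continuous_on ballI has_derivative_continuous[OF has_derivative_wave_speed]
        diff_\<phi>t domD)
  then show ?thesis by (rule continuous_on_compose2) (auto intro!: continuous_intros)
qed

lemma slice_nz: "x \<in> slice \<Longrightarrow> norm x \<noteq> 0" "x \<in> slice \<Longrightarrow> c (t, x) \<noteq> 0"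
  using x_nz cpos by fastforce+

lemma continuous_on_slice_dir: "continuous_on slice (\<lambda>x. x /\<^sub>R norm x)"
  by (intro continuous_intros) (use slice_nz in auto)

lemma continuous_on_slice_sgrad:
  assumes "Cinf_on \<psi> W" shows "continuous_on slice (\<lambda>x. sgrad \<psi> (t, x))"
  unfolding sgrad_def
  by (intro continuous_on_vec_lambda continuous_on_slice Cinf_on_continuous Cinf_on_pd assms ex_Basis)

lemma continuous_on_slice_pd:
  assumes "Cinf_on \<psi> W" "b \<in> Basis" shows "continuous_on slice (\<lambda>x. pd b \<psi> (t, x))"
  by (intro continuous_on_slice Cinf_on_continuous Cinf_on_pd assms)

text \<open>Continuity is read off from the explicit formula, as the definition of
  \<open>tr_chi\<close> by a choice-free description does not display it.\<close>

lemma continuous_on_tr_chi: "continuous_on slice (\<lambda>x. tr_chi G \<phi> u (t, x))"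
proof -
  note \<phi>t = Cinf_on_pd[OF smooth_\<phi> et_Basis]
  have "continuous_on slice (\<lambda>x. - 2 * c (t, x) / norm x + 3 * G * (c (t, x))\<^sup>2 * pd et \<phi> (t, x) *
      (pd et (pd et \<phi>) (t, x) - c (t, x) * ((x /\<^sub>R norm x) \<bullet> sgrad (pd et \<phi>) (t, x))))"
    by (intro continuous_on_add continuous_on_diff continuous_on_mult continuous_on_divide continuous_on_power
        continuous_on_const continuous_on_norm continuous_on_id continuous_on_inner
        continuous_on_wave_speed continuous_on_slice_dir continuous_on_slice_sgrad
        continuous_on_slice_pd \<phi>t smooth_\<phi> et_Basis ballI slice_nz)
  then show ?thesis
    by (rule continuous_on_eq) (use tr_chi_slice pd_et_eq[OF diff_\<phi>t] domD(2) in auto)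
qed

lemma continuous_on_slice_components:
  assumes "Cinf_on \<psi> W"
  shows "continuous_on slice (\<lambda>x. \<psi> (t, x))" "continuous_on slice (\<lambda>x. pd et \<psi> (t, x))"
    "continuous_on slice (\<lambda>x. (x /\<^sub>R norm x) \<bullet> sgrad \<psi> (t, x))" "continuous_on slice (\<lambda>x. norm (sgrad \<psi> (t, x)))"
  by (intro continuous_on_slice Cinf_on_continuous continuous_on_slice_pd continuous_on_inner continuous_on_norm
      continuous_on_slice_dir continuous_on_slice_sgrad assms et_Basis)+

lemma continuous_on_dens0:
  assumes "Cinf_on \<psi> W" shows "continuous_on slice (\<lambda>x. dens0 G \<phi> u \<psi> (t, x))"
proof (rule continuous_on_eq)
  note k = continuous_on_slice_components[OF assms]
  show "continuous_on slice (\<lambda>x. 1 / (2 * c (t, x)) * ((pd et \<psi> (t, x) / c (t, x) + (x /\<^sub>R norm x) \<bullet> sgrad \<psi> (t, x))\<^sup>2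
      + 1 / c (t, x) * (pd et \<psi> (t, x) - c (t, x) * ((x /\<^sub>R norm x) \<bullet> sgrad \<psi> (t, x)))\<^sup>2
      + (c (t, x) + 1) * ((norm (sgrad \<psi> (t, x)))\<^sup>2 - ((x /\<^sub>R norm x) \<bullet> sgrad \<psi> (t, x))\<^sup>2)))"
    by (rule continuous_on_energy_integrand(1)[OF continuous_on_wave_speed k continuous_on_tr_chi slice_nz(2)])
qed (use dens_slice(1) Cinf_on_differentiable[OF assms open_W] domD(2) in auto)

lemma continuous_on_dens1:
  assumes \<psi>: "Cinf_on \<psi> W" and S: "S \<subseteq> slice" "\<And>x. x \<in> S \<Longrightarrow> tr_chi G \<phi> u (t, x) \<noteq> 0"
  shows "continuous_on S (\<lambda>x. dens1 t G \<phi> u \<psi> (t, x))"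
proof (rule continuous_on_eq)
  note k = continuous_on_slice_components[OF \<psi>, THEN continuous_on_subset, OF S(1)]
  note k2 = continuous_on_wave_speed[THEN continuous_on_subset, OF S(1)]
    continuous_on_tr_chi[THEN continuous_on_subset, OF S(1)]
  show "continuous_on S (\<lambda>x. 1 / (2 * c (t, x)) * (4 * (- t) / tr_chi G \<phi> u (t, x)) *
      (1 / c (t, x) * (pd et \<psi> (t, x) - c (t, x) * ((x /\<^sub>R norm x) \<bullet> sgrad \<psi> (t, x)) + 1/2 * tr_chi G \<phi> u (t, x) * \<psi> (t, x))\<^sup>2
       + c (t, x) * ((norm (sgrad \<psi> (t, x)))\<^sup>2 - ((x /\<^sub>R norm x) \<bullet> sgrad \<psi> (t, x))\<^sup>2)))"
    by (rule continuous_on_energy_integrand(2)[OF k2(1) k k2(2)]) (use S slice_nz(2) in blast)+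
qed (use dens_slice(2) Cinf_on_differentiable[OF \<psi> open_W] domD(2) S in auto)

end

section \<open>Integration over the cylinder\<close>

definition ccyl :: "spacetime set" where "ccyl = {0..1} \<times> sphere 0 1"

lemma ccyl_closure: "ccyl = closure ocyl"
  by (simp add: ccyl_def ocyl_def closure_Times)

lemma compact_ccyl: "compact ccyl"
  unfolding ccyl_def by (intro compact_Times) auto

text \<open>The pointwise analysis covers 0 < s < 1; continuity extends its bounds to the end
  points.\<close>

lemma ccyl_bound:
  fixes F :: "spacetime \<Rightarrow> real"
  assumes "continuous_on ccyl F" "\<And>p. p \<in> ocyl \<Longrightarrow> \<bar>F p\<bar> \<le> b" "p \<in> ccyl"
  shows "\<bar>F p\<bar> \<le> b"
  using continuous_on_closure_norm_le[of ocyl F b p] assms by (simp add: ccyl_closure)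

lemma sph_basis:
  "sph y = (sin (fst y) * cos (snd y)) *\<^sub>R axis 1 1 + (sin (fst y) * sin (snd y)) *\<^sub>R axis 2 1 + cos (fst y) *\<^sub>R axis 3 1"
  by (simp add: sph_def case_prod_beta' vec_eq_iff forall_3 axis_def)

lemma norm_sph [simp]: "norm (sph y) = 1"
proof -
  have *: "(p * a) * (p * a) + (p * b) * (p * b) + d * d = 1" if "a\<^sup>2 + b\<^sup>2 = 1" "p\<^sup>2 + d\<^sup>2 = 1" for a b p d :: real
  proof -
    have "(p * a) * (p * a) + (p * b) * (p * b) + d * d = p\<^sup>2 * (a\<^sup>2 + b\<^sup>2) + d\<^sup>2"
      by (simp add: power2_eq_square algebra_simps)
    then show ?thesis using that by simp
  qed
  show ?thesis
    unfolding norm_eq_1 sph_def case_prod_beta' inner_vec_def using *[of "cos (snd y)" "sin (snd y)" "sin (fst y)" "cos (fst y)"]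
    by (simp add: sum_3)
qed

lemma has_derivative_sph:
  "(sph has_derivative (\<lambda>h. (fst h * (cos (fst y) * cos (snd y)) - snd h * (sin (fst y) * sin (snd y))) *\<^sub>R axis 1 1
     + (fst h * (cos (fst y) * sin (snd y)) + snd h * (sin (fst y) * cos (snd y))) *\<^sub>R axis 2 1
     + (- fst h * sin (fst y)) *\<^sub>R axis 3 1)) (at y)"
  unfolding sph_basis[abs_def]
  by (rule derivative_eq_intros refl)+ (auto simp: fun_eq_iff algebra_simps)

lemma continuous_on_sph: "continuous_on S sph"
  using has_derivative_sph by (intro continuous_at_imp_continuous_on ballI) (rule has_derivative_continuous)

text \<open>The variable of integration is u', not s = u' / \<delta>, so no Jacobian appears; |sin|
  is the area density of the unit sphere in the coordinates \<open>sph\<close>.\<close>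

definition cyl_integral :: "real \<Rightarrow> real \<Rightarrow> (spacetime \<Rightarrow> real) \<Rightarrow> real" where
  "cyl_integral \<delta> v F = integral {0..v} (\<lambda>u'. integral (cbox (0, 0) (pi, 2 * pi)) (\<lambda>y. F (u' / \<delta>, sph y) * \<bar>sin (fst y)\<bar>))"

text \<open>\<open>\<Gamma>\<close> is known at every unit vector, so the parametrisation by angles
  and its derivatives are explicit. They have no time component, and the Gram determinant is that of
  a round sphere of radius \<open>R\<close>.\<close>

lemma integral_S_initial:
  assumes \<Gamma>: "\<And>\<omega>. norm \<omega> = 1 \<Longrightarrow> \<Gamma> t u' \<omega> = R *\<^sub>R \<omega>"
  shows "integral_S G \<phi> \<Gamma> t u' f = integral (cbox (0, 0) (pi, 2 * pi)) (\<lambda>y. R\<^sup>2 * f (t, R *\<^sub>R sph y) * \<bar>sin (fst y)\<bar>)"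
  unfolding integral_S_def
proof (rule arg_cong[where f = "integral _"], rule ext)
  fix y :: "real \<times> real"
  define X where "X z = (t, R *\<^sub>R sph z)" for z
  have X: "(\<lambda>z. (t, \<Gamma> t u' (sph z))) = X" by (simp add: \<Gamma> X_def fun_eq_iff)
  have d: "pd a X y = (0, R *\<^sub>R ((fst a * (cos (fst y) * cos (snd y)) - snd a * (sin (fst y) * sin (snd y))) *\<^sub>R axis 1 1
     + (fst a * (cos (fst y) * sin (snd y)) + snd a * (sin (fst y) * cos (snd y))) *\<^sub>R axis 2 1
     + (- fst a * sin (fst y)) *\<^sub>R axis 3 1))" for a
    unfolding X_def[abs_def]
    by (rule pd_eqI) (intro has_derivative_Pair has_derivative_const has_derivative_scaleR_right has_derivative_sph)
  let ?g = "\<lambda>a b. gmet G \<phi> (X y) (pd a X y) (pd b X y)"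
  have ax: "axis i (1::real) \<bullet> axis j 1 = (if i = j then 1 else 0)" for i j :: 3
    by (simp add: inner_axis_axis)
  have sc: "(cos z)\<^sup>2 = 1 - (sin z)\<^sup>2" for z :: real by (simp add: cos_squared_eq)
  have g: "?g (1, 0) (1, 0) = R\<^sup>2" "?g (0, 1) (0, 1) = R\<^sup>2 * (sin (fst y))\<^sup>2" "?g (1, 0) (0, 1) = 0"
    unfolding gmet_def d
    by (simp_all add: inner_add_left inner_add_right ax power_mult_distrib sc algebra_simps flip: power2_eq_square)
  have "sqrt (?g (1, 0) (1, 0) * ?g (0, 1) (0, 1) - (?g (1, 0) (0, 1))\<^sup>2) = R\<^sup>2 * \<bar>sin (fst y)\<bar>"
  proof -
    have "R\<^sup>2 * (R\<^sup>2 * (sin (fst y))\<^sup>2) - 0\<^sup>2 = (R\<^sup>2 * sin (fst y))\<^sup>2"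
      by (simp add: power2_eq_square algebra_simps)
    then show ?thesis unfolding g by (simp only: real_sqrt_abs) (simp add: abs_mult)
  qed
  then show "(let X = (\<lambda>z. (t, \<Gamma> t u' (sph z))); \<gamma> = (\<lambda>a b. gmet G \<phi> (X y) (pd a X y) (pd b X y))
     in f (X y) * sqrt (\<gamma> (1, 0) (1, 0) * \<gamma> (0, 1) (0, 1) - (\<gamma> (1, 0) (0, 1))\<^sup>2))
     = R\<^sup>2 * f (t, R *\<^sub>R sph y) * \<bar>sin (fst y)\<bar>"
    unfolding X Let_def by (simp add: X_def)
qed

lemma integral_Sigma_initial:
  assumes "generators G \<phi> u \<delta> r0 \<Gamma>" and v: "v \<in> {0..\<delta>}" and \<delta>: "\<delta> > 0"
  shows "integral_Sigma G \<phi> \<Gamma> (- r0) v f = cyl_integral \<delta> v (\<lambda>p. (r0 + \<delta> * fst p)\<^sup>2 * f (slice_pt \<delta> r0 p))"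
  unfolding integral_Sigma_def cyl_integral_def
proof (rule integral_cong)
  fix u' assume u': "u' \<in> {0..v}"
  have "\<Gamma> (- r0) u' \<omega> = (r0 + u') *\<^sub>R \<omega>" if "norm \<omega> = 1" for \<omega>
    using assms(1) u' v that by (auto simp: generators_def)
  from integral_S_initial[where t = "- r0" and R = "r0 + u'" and \<Gamma> = \<Gamma> and u' = u', OF this]
  show "integral_S G \<phi> \<Gamma> (- r0) u' f = integral (cbox (0, 0) (pi, 2 * pi))
      (\<lambda>y. (r0 + \<delta> * fst (u' / \<delta>, sph y))\<^sup>2 * f (slice_pt \<delta> r0 (u' / \<delta>, sph y)) * \<bar>sin (fst y)\<bar>)"
    using \<delta> by (simp add: slice_pt_def)
qed

context
  fixes \<delta> v :: real
  assumes \<delta>: "\<delta> > 0" and v: "0 \<le> v" "v \<le> \<delta>"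
begin

lemma integrable_cyl:
  assumes F: "continuous_on ccyl F"
  shows "u' \<in> {0..v} \<Longrightarrow> (\<lambda>y. F (u' / \<delta>, sph y) * \<bar>sin (fst y)\<bar>) integrable_on cbox (0, 0) (pi, 2 * pi)"
    and "(\<lambda>u'. integral (cbox (0, 0) (pi, 2 * pi)) (\<lambda>y. F (u' / \<delta>, sph y) * \<bar>sin (fst y)\<bar>)) integrable_on {0..v}"
proof -
  have c: "continuous_on ({0..v} \<times> cbox (0, 0) (pi, 2 * pi)) (\<lambda>(u', y). F (u' / \<delta>, sph y) * \<bar>sin (fst y)\<bar>)"
    unfolding case_prod_beta'
    by (intro continuous_intros continuous_on_compose2[OF F] continuous_on_compose2[OF continuous_on_sph])
       (use \<delta> v in \<open>auto simp: ccyl_def divide_simps\<close>)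
  show "(\<lambda>u'. integral (cbox (0, 0) (pi, 2 * pi)) (\<lambda>y. F (u' / \<delta>, sph y) * \<bar>sin (fst y)\<bar>)) integrable_on {0..v}"
    by (intro integrable_continuous_real integral_continuous_on_param c)
  show "(\<lambda>y. F (u' / \<delta>, sph y) * \<bar>sin (fst y)\<bar>) integrable_on cbox (0, 0) (pi, 2 * pi)" if "u' \<in> {0..v}"
  proof (rule integrable_continuous)
    have "continuous_on (cbox (0, 0) (pi, 2 * pi)) (\<lambda>y. (\<lambda>(u', y). F (u' / \<delta>, sph y) * \<bar>sin (fst y)\<bar>) (u', y))"
      by (rule continuous_on_compose2[OF c]) (use that in \<open>auto intro!: continuous_intros\<close>)
    then show "continuous_on (cbox (0, 0) (pi, 2 * pi)) (\<lambda>y. F (u' / \<delta>, sph y) * \<bar>sin (fst y)\<bar>)" by simp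
  qed
qed

text \<open>2 pi^2 is the area of the coordinate rectangle rather than of the sphere, as |sin| is
  estimated by 1.\<close>

lemma cyl_integral_bound:
  assumes F: "continuous_on ccyl F" and b: "\<And>p. p \<in> ocyl \<Longrightarrow> \<bar>F p\<bar> \<le> b"
  shows "\<bar>cyl_integral \<delta> v F\<bar> \<le> b * (2 * pi\<^sup>2) * v"
proof -
  have b0: "b \<ge> 0"
  proof -
    have "(1/2, axis 1 1) \<in> ocyl" by (simp add: ocyl_def)
    from b[OF this] show ?thesis by linarith
  qed
  have "norm (integral (cbox (0, 0) (pi, 2 * pi)) (\<lambda>y. F (u' / \<delta>, sph y) * \<bar>sin (fst y)\<bar>))
      \<le> b * measure lborel (cbox (0, 0) (pi, 2 * pi))" if u': "u' \<in> {0..v}" for u'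
  proof (rule integrable_bound[OF b0 integrable_cyl(1)[OF F u']])
    fix y :: "real \<times> real"
    have "(u' / \<delta>, sph y) \<in> ccyl" using u' \<delta> v by (auto simp: ccyl_def divide_simps)
    then have "\<bar>F (u' / \<delta>, sph y)\<bar> \<le> b" using ccyl_bound[OF F b] by blast
    then show "norm (F (u' / \<delta>, sph y) * \<bar>sin (fst y)\<bar>) \<le> b"
      using mult_mono[of "\<bar>F (u' / \<delta>, sph y)\<bar>" b "\<bar>sin (fst y)\<bar>" 1] b0 by (simp add: abs_mult)
  qed
  moreover have "measure lborel (cbox (0, 0) (pi, 2 * pi)) = 2 * pi\<^sup>2"
    by (simp add: content_Pair power2_eq_square)
  ultimately have I: "norm (integral (cbox (0, 0) (pi, 2 * pi)) (\<lambda>y. F (u' / \<delta>, sph y) * \<bar>sin (fst y)\<bar>)) \<le> b * (2 * pi\<^sup>2)"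
    if "u' \<in> cbox 0 v" for u' using that by simp
  have "norm (cyl_integral \<delta> v F) \<le> b * (2 * pi\<^sup>2) * measure lborel (cbox 0 v)"
    unfolding cyl_integral_def cbox_interval[symmetric]
    by (rule integrable_bound[OF _ integrable_cyl(2)[OF F, folded cbox_interval] I]) (simp add: b0)
  then show ?thesis using v by simp
qed

lemma cyl_integral_diff:
  assumes "continuous_on ccyl F" "continuous_on ccyl E"
  shows "cyl_integral \<delta> v (\<lambda>p. F p - E p) = cyl_integral \<delta> v F - cyl_integral \<delta> v E"
proof -
  have "cyl_integral \<delta> v (\<lambda>p. F p - E p) = integral {0..v} (\<lambda>u'.
     integral (cbox (0, 0) (pi, 2 * pi)) (\<lambda>y. F (u' / \<delta>, sph y) * \<bar>sin (fst y)\<bar>) -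
     integral (cbox (0, 0) (pi, 2 * pi)) (\<lambda>y. E (u' / \<delta>, sph y) * \<bar>sin (fst y)\<bar>))"
    unfolding cyl_integral_def
    by (rule integral_cong) (simp add: left_diff_distrib integral_diff integrable_cyl assms)
  then show ?thesis
    unfolding cyl_integral_def by (simp add: integral_diff integrable_cyl assms)
qed

lemma cyl_integral_tendsto:
  assumes L: "continuous_on ccyl L" and F: "\<forall>\<^sub>F x in at_top. continuous_on ccyl (F x)"
    and unif: "\<And>e. e > 0 \<Longrightarrow> \<forall>\<^sub>F x in at_top. \<forall>p\<in>ocyl. \<bar>F x p - L p\<bar> < e"
  shows "((\<lambda>x::real. cyl_integral \<delta> v (F x)) \<longlongrightarrow> cyl_integral \<delta> v L) at_top"
proof (rule tendstoI)
  fix e :: real assume e: "e > 0"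
  \<comment> \<open>The summand 1 keeps \<open>b\<close> positive when v = 0 and makes the final
    inequality strict.\<close>
  define b where "b = 2 * pi\<^sup>2 * v + 1"
  have b: "b > 0" using v by (simp add: b_def add_nonneg_pos)
  then have "e / b > 0" using e by simp
  from F unif[OF this] show "\<forall>\<^sub>F x in at_top. dist (cyl_integral \<delta> v (F x)) (cyl_integral \<delta> v L) < e"
  proof eventually_elim
    case (elim x)
    have "\<bar>cyl_integral \<delta> v (\<lambda>p. F x p - L p)\<bar> \<le> e / b * (2 * pi\<^sup>2) * v"
      using elim by (intro cyl_integral_bound continuous_on_diff L) (auto intro: less_imp_le)
    also have "\<dots> = e / b * (b - 1)" by (simp add: b_def)
    also have "\<dots> < e / b * b" using e b by (intro mult_strict_left_mono) auto
    also have "\<dots> = e" using b by simp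
    finally show ?case using cyl_integral_diff[OF elim(1) L] by (simp add: dist_real_def)
  qed
qed

end


section \<open>Uniform derivative bounds from the data\<close>

lemma Cinf_on_foldr_pd: "Cinf_on F S \<Longrightarrow> set bs \<subseteq> Basis \<Longrightarrow> Cinf_on (foldr pd bs F) S"
  by (induction bs) (auto intro: Cinf_on_pd)

text \<open>There are finitely many lists of at most three basis directions, and each derivative is
  bounded on the compact \<open>ccyl\<close>; the bounds are added up.\<close>

lemma bounded_C3_compact:
  assumes "Cinf_on F S" "ccyl \<subseteq> S" shows "\<exists>M. bounded_C3 M F"
proof -
  let ?B = "{bs :: spacetime list. set bs \<subseteq> Basis \<and> length bs \<le> 3}"
  have fin: "finite ?B" by (intro finite_lists_length_le finite_Basis)
  have "\<exists>M. \<forall>p\<in>ccyl. \<bar>foldr pd bs F p\<bar> \<le> M" if "bs \<in> ?B" for bs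
  proof -
    have "continuous_on ccyl (foldr pd bs F)"
      using that Cinf_on_continuous[OF Cinf_on_foldr_pd[OF assms(1)]] continuous_on_subset[OF _ assms(2)] by blast
    then have "bounded (foldr pd bs F ` ccyl)"
      by (intro compact_imp_bounded compact_continuous_image compact_ccyl)
    then show ?thesis by (auto simp: bounded_iff)
  qed
  then have "\<forall>bs\<in>?B. \<exists>M. \<forall>p\<in>ccyl. \<bar>foldr pd bs F p\<bar> \<le> M" by blast
  from bchoice[OF this] obtain M where "\<forall>bs\<in>?B. \<forall>p\<in>ccyl. \<bar>foldr pd bs F p\<bar> \<le> M bs" ..
  then have M: "\<bar>foldr pd bs F p\<bar> \<le> M bs" if "bs \<in> ?B" "p \<in> ccyl" for bs p using that by blast
  have "bounded_C3 (\<Sum>bs\<in>?B. \<bar>M bs\<bar>) F"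
    unfolding bounded_C3_def
  proof (intro allI impI)
    fix bs p assume "set bs \<subseteq> (Basis :: spacetime set)" "length bs \<le> 3" "p \<in> ocyl"
    then have bs: "bs \<in> ?B" and p: "p \<in> ccyl" by (auto simp: ocyl_def ccyl_def)
    have "\<bar>foldr pd bs F p\<bar> \<le> \<bar>M bs\<bar>" using M[OF bs p] by linarith
    also have "\<dots> \<le> (\<Sum>bs\<in>?B. \<bar>M bs\<bar>)" using member_le_sum[OF bs, of "\<lambda>bs. \<bar>M bs\<bar>"] fin by simp
    finally show "\<bar>foldr pd bs F p\<bar> \<le> (\<Sum>bs\<in>?B. \<bar>M bs\<bar>)" .
  qed
  then show ?thesis by blast
qed

lemma bounded_C3_Ck_norm:
  assumes "Ck_norm 3 f \<le> ereal b" shows "bounded_C3 b (hom0 f)"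
  unfolding bounded_C3_def
proof (intro allI impI)
  fix bs p assume "set bs \<subseteq> (Basis :: spacetime set)" "length bs \<le> 3" "p \<in> ocyl"
  then have "(bs, p) \<in> {bs. set bs \<subseteq> Basis \<and> length bs \<le> 3} \<times> ({0<..<1} \<times> sphere 0 1)" by (simp add: ocyl_def)
  then have "(\<lambda>(bs, p). ereal \<bar>foldr pd bs (hom0 f) p\<bar>) (bs, p) \<le> Ck_norm 3 f"
    unfolding Ck_norm_def by (rule SUP_upper)
  from order_trans[OF this assms] show "\<bar>foldr pd bs (hom0 f) p\<bar> \<le> b" by simp
qed

lemma bounded_C3_mono: "bounded_C3 M F \<Longrightarrow> M \<le> N \<Longrightarrow> bounded_C3 N F"
  unfolding bounded_C3_def by fastforce

text \<open>Only the values of \<open>f\<close> over the unit sphere are meaningful. The smooth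
  extension \<open>F\<close> has the same degree-zero extension on the open set \<open>cyl\<close>,
  and passes its smoothness on.\<close>

lemma Cinf_cyl_hom0:
  assumes "Cinf_cyl {0..1} f" shows "Cinf_on (hom0 f) cyl"
proof -
  obtain F W where F: "open W" "{0..1} \<times> sphere 0 1 \<subseteq> W" "Cinf_on F W" "\<forall>p\<in>{0..1} \<times> sphere 0 1. F p = f p"
    using assms unfolding Cinf_cyl_def by blast
  have sub: "(s, x /\<^sub>R norm x) \<in> {0..1} \<times> sphere 0 1" if "(s, x) \<in> cyl" for s and x :: "real^3"
    using that by (auto simp: cyl_def)
  then have "cyl \<subseteq> cone W" using F(2) by (fastforce simp: cone_def cyl_def)
  then have "Cinf_on (hom0 F) cyl" using Cinf_on_hom0[OF F(1,3)] Cinf_on_subset by blast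
  moreover have "hom0 F p = hom0 f p" if "p \<in> cyl" for p
    using F(4) sub that by (cases p) (auto simp: hom0_def)
  ultimately show ?thesis
    unfolding Cinf_on_def using Ck_on_cong[OF open_cyl, of "hom0 F" "hom0 f"] by simp
qed

lemma homog_hom0_cyl: "homog 0 cyl (hom0 f)"
proof -
  have "(l *\<^sub>R x) /\<^sub>R norm (l *\<^sub>R x) = x /\<^sub>R norm x" if "l > 0" for l and x :: "real^3"
    using that by simp
  then show ?thesis
    unfolding homog_def hom0_def cyl_def by (simp del: scaleR_scaleR norm_scaleR)
qed

section \<open>Continuity up to the boundary of the shell\<close>

context pulse_slice
begin

lemma slice_pt_dom: "p \<in> ccyl \<Longrightarrow> (r0 + \<delta> * fst p) *\<^sub>R snd p \<in> slice"
  using \<delta>_pos r0_pos by (auto simp: ccyl_def abs_mult intro!: closed_shell_dom)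

lemma continuous_on_shell_dens:
  assumes "e \<in> Basis"
  shows "continuous_on ccyl (\<lambda>p. (r0 + \<delta> * fst p)\<^sup>2 * dens0 G \<phi> u (pd e \<phi>) (slice_pt \<delta> r0 p))"
    and "continuous_on ccyl (\<lambda>p. r0 * tr_chi G \<phi> u (slice_pt \<delta> r0 p))"
    and "(\<And>p. p \<in> ccyl \<Longrightarrow> tr_chi G \<phi> u (slice_pt \<delta> r0 p) \<noteq> 0) \<Longrightarrow>
      continuous_on ccyl (\<lambda>p. (r0 + \<delta> * fst p)\<^sup>2 * dens1 (- r0) G \<phi> u (pd e \<phi>) (slice_pt \<delta> r0 p))"
proof -
  let ?g = "\<lambda>p :: spacetime. (r0 + \<delta> * fst p) *\<^sub>R snd p"
  have g: "continuous_on ccyl ?g" by (intro continuous_intros)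
  note \<psi> = Cinf_on_pd[OF smooth_\<phi> assms]
  have comp: "continuous_on ccyl (\<lambda>p. f (slice_pt \<delta> r0 p))" if "continuous_on (?g ` ccyl) (\<lambda>x. f (- r0, x))" for f :: "spacetime \<Rightarrow> real"
    unfolding slice_pt_def by (rule continuous_on_compose2[OF that g]) simp
  have sub: "?g ` ccyl \<subseteq> slice" using slice_pt_dom by blast
  show "continuous_on ccyl (\<lambda>p. (r0 + \<delta> * fst p)\<^sup>2 * dens0 G \<phi> u (pd e \<phi>) (slice_pt \<delta> r0 p))"
    by (intro continuous_on_mult comp continuous_on_subset[OF continuous_on_dens0[OF \<psi>] sub] continuous_intros)
  show "continuous_on ccyl (\<lambda>p. r0 * tr_chi G \<phi> u (slice_pt \<delta> r0 p))"
    by (intro continuous_on_mult comp continuous_on_subset[OF continuous_on_tr_chi sub] continuous_on_const)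
  show "continuous_on ccyl (\<lambda>p. (r0 + \<delta> * fst p)\<^sup>2 * dens1 (- r0) G \<phi> u (pd e \<phi>) (slice_pt \<delta> r0 p))"
    if "\<And>p. p \<in> ccyl \<Longrightarrow> tr_chi G \<phi> u (slice_pt \<delta> r0 p) \<noteq> 0"
    by (intro continuous_on_mult comp continuous_on_dens1[OF \<psi> sub] continuous_intros)
       (use that in \<open>auto simp: slice_pt_def\<close>)
qed

end

lemma (in pulse_family) density_continuous:
  assumes e: "e \<in> Basis"
  shows "\<forall>\<^sub>F x in at_top. continuous_on ccyl (\<lambda>p. (x + \<delta> * fst p)\<^sup>2 * dens0 G (\<phi> x) (u x) (pd e (\<phi> x)) (slice_pt \<delta> x p)) \<and>
    continuous_on ccyl (\<lambda>p. (x + \<delta> * fst p)\<^sup>2 * dens1 (- x) G (\<phi> x) (u x) (pd e (\<phi> x)) (slice_pt \<delta> x p))"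
  using family density_uniform(3)[OF e zero_less_one]
proof eventually_elim
  case (elim x)
  then obtain W V where "pulse_slice G (\<phi> x) (u x) W V x \<delta> (H x) K" by blast
  then interpret S: pulse_slice G "\<phi> x" "u x" W V x \<delta> "H x" K .
  note cont = S.continuous_on_shell_dens[OF e]
  have "tr_chi G (\<phi> x) (u x) (slice_pt \<delta> x p) \<noteq> 0" if "p \<in> ccyl" for p
  proof -
    \<comment> \<open>A value within 1 of -2 cannot be zero, and \<open>ccyl_bound\<close> includes
      s = 0 and s = 1.\<close>
    have "\<bar>x * tr_chi G (\<phi> x) (u x) (slice_pt \<delta> x p) - -2\<bar> \<le> 1"
      by (rule ccyl_bound[OF continuous_on_diff[OF cont(2) continuous_on_const] less_imp_le that]) (rule elim(2)[rule_format])
    then show ?thesis by auto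
  qed
  then show ?case using cont(1,3) by blast
qed

lemma amplitude_bound:
  assumes "e \<in> Basis" "p \<in> ocyl" shows "\<bar>amplitude e p\<bar> \<le> 1" "norm (snd e) \<le> 1"
proof -
  consider "e = et" | i where "e = ex i" using assms(1) Basis_spacetime by blast
  then show "\<bar>amplitude e p\<bar> \<le> 1"
  proof cases
    case 2
    then show ?thesis
      using component_le_norm_cart[of "snd p" i] assms(2) by (auto simp: amplitude_def ex_def inner_axis' ocyl_def)
  qed (simp add: amplitude_def et_def)
  show "norm (snd e) \<le> 1" using assms(1) by (auto simp: Basis_spacetime et_def ex_def)
qed

text \<open>The 5 M consists of 3 M for the three components of the gradient of \<open>K\<close> and
  2 M for \<open>K\<close> times the projected axis vector, whose norm is estimated by 2.\<close>

lemma limit_density_bounds: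
  assumes M: "bounded_C3 M K" and e: "e \<in> Basis" and p: "p \<in> ocyl"
  shows "\<bar>amplitude e p * pd et K p\<bar> \<le> M" "norm (angular_gradient K e p) \<le> 5 * M"
proof -
  note K = bounded_C3D[OF M p] and a = amplitude_bound[OF e p]
  have M0: "M \<ge> 0" using K(1) by linarith
  show "\<bar>amplitude e p * pd et K p\<bar> \<le> M"
    using mult_mono[OF a(1) K(2)[OF et_Basis]] M0 by (simp add: abs_mult)
  have "norm (sgrad K p) \<le> (\<Sum>i\<in>UNIV. \<bar>sgrad K p $ i\<bar>)" by (rule norm_le_l1_cart)
  also have "\<dots> \<le> (\<Sum>i\<in>(UNIV :: 3 set). M)" by (intro sum_mono) (use K(2) in \<open>simp add: sgrad_def\<close>)
  finally have sg: "norm (sgrad K p) \<le> 3 * M" by simp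
  have sp: "norm (snd p) = 1" using p by (auto simp: ocyl_def)
  have "\<bar>snd e \<bullet> snd p\<bar> \<le> norm (snd e) * norm (snd p)" by (rule Cauchy_Schwarz_ineq2)
  then have "norm (snd e - (snd e \<bullet> snd p) *\<^sub>R snd p) \<le> 1 + 1"
    using a(2) sp by (intro norm_triangle_le_diff) (simp add: add_mono)
  then have "norm (K p *\<^sub>R (snd e - (snd e \<bullet> snd p) *\<^sub>R snd p)) \<le> M * 2"
    using K(1) M0 by (auto intro!: mult_mono)
  moreover have "norm (amplitude e p *\<^sub>R sgrad K p) \<le> 1 * (3 * M)"
    using mult_mono[OF a(1) sg] by simp
  ultimately show "norm (angular_gradient K e p) \<le> 5 * M"
    unfolding angular_gradient_def by (intro norm_triangle_le) linarith
qed

text \<open>Smoothness of \<open>K\<close> near the closed cylinder makes the limit densities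
  continuous up to s = 0 and s = 1. \<open>N\<close> is kept apart from the \<open>M\<close> of the
  locale: it bounds \<open>K\<close> alone, so the bounds on \<open>H\<close> do not enter the
  constants.\<close>

lemma (in pulse_family) energies_converge:
  assumes K': "Cinf_on K S" "ccyl \<subseteq> S" and N: "bounded_C3 N K"
    and gen: "\<forall>\<^sub>F x in at_top. generators G (\<phi> x) (u x) \<delta> x (\<Gamma> x)"
    and e: "e \<in> Basis" and v: "v \<in> {0..\<delta>}"
  shows "\<exists>l0 l1. ((\<lambda>x. energy0 G (\<phi> x) (u x) (\<Gamma> x) (pd e (\<phi> x)) (- x) v) \<longlongrightarrow> l0) at_top \<and>
     ((\<lambda>x. energy1 G (\<phi> x) (u x) (\<Gamma> x) (pd e (\<phi> x)) (- x) v) \<longlongrightarrow> l1) at_top \<and>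
     \<bar>l0\<bar> \<le> 50 * pi\<^sup>2 * N\<^sup>2 \<and> \<bar>l1\<bar> \<le> 50 * pi\<^sup>2 * N\<^sup>2 * \<delta>\<^sup>2"
proof -
  let ?L0 = "\<lambda>p. 2 / \<delta> * (amplitude e p * pd et K p)\<^sup>2"
  let ?L1 = "\<lambda>p. - (\<delta> * (norm (angular_gradient K e p))\<^sup>2)"
  have v': "0 \<le> v" "v \<le> \<delta>" using v by auto
  have amp: "continuous_on ccyl (amplitude e)"
    unfolding amplitude_def[abs_def] by (intro continuous_intros)
  note cont = Cinf_on_continuous[THEN continuous_on_subset, OF _ K'(2)]
  have Kc: "continuous_on ccyl K" "\<And>b. b \<in> Basis \<Longrightarrow> continuous_on ccyl (pd b K)"
    using cont K'(1) Cinf_on_pd[OF K'(1)] by blast+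
  have sg: "continuous_on ccyl (sgrad K)"
    unfolding sgrad_def[abs_def] by (intro continuous_on_vec_lambda Kc ex_Basis)
  have L0: "continuous_on ccyl ?L0" by (intro continuous_intros amp Kc et_Basis)
  have L1: "continuous_on ccyl ?L1"
    unfolding angular_gradient_def by (intro continuous_intros amp Kc sg et_Basis)
  have lim0: "((\<lambda>x. cyl_integral \<delta> v (\<lambda>p. (x + \<delta> * fst p)\<^sup>2 * dens0 G (\<phi> x) (u x) (pd e (\<phi> x)) (slice_pt \<delta> x p)))
      \<longlongrightarrow> cyl_integral \<delta> v ?L0) at_top"
    by (rule cyl_integral_tendsto[OF \<delta>_pos v' L0 eventually_mono[OF density_continuous[OF e]] density_uniform(1)[OF e]]) blast+
  have lim1: "((\<lambda>x. cyl_integral \<delta> v (\<lambda>p. (x + \<delta> * fst p)\<^sup>2 * dens1 (- x) G (\<phi> x) (u x) (pd e (\<phi> x)) (slice_pt \<delta> x p)))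
      \<longlongrightarrow> cyl_integral \<delta> v ?L1) at_top"
    by (rule cyl_integral_tendsto[OF \<delta>_pos v' L1 eventually_mono[OF density_continuous[OF e]] density_uniform(2)[OF e]]) blast+
  have en: "energy0 G (\<phi> x) (u x) (\<Gamma> x) \<psi> (- x) v = integral_Sigma G (\<phi> x) (\<Gamma> x) (- x) v (dens0 G (\<phi> x) (u x) \<psi>)"
    "energy1 G (\<phi> x) (u x) (\<Gamma> x) \<psi> (- x) v = integral_Sigma G (\<phi> x) (\<Gamma> x) (- x) v (dens1 (- x) G (\<phi> x) (u x) \<psi>)" for \<psi> x
    by (simp_all add: energy0_def energy1_def dens0_def[abs_def] dens1_def[abs_def])
  have lims: "((\<lambda>x. energy0 G (\<phi> x) (u x) (\<Gamma> x) (pd e (\<phi> x)) (- x) v) \<longlongrightarrow> cyl_integral \<delta> v ?L0) at_top"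
     "((\<lambda>x. energy1 G (\<phi> x) (u x) (\<Gamma> x) (pd e (\<phi> x)) (- x) v) \<longlongrightarrow> cyl_integral \<delta> v ?L1) at_top"
    unfolding en
    by (rule Lim_transform_eventually[OF lim0], use gen in eventually_elim, simp add: integral_Sigma_initial[OF _ v \<delta>_pos])
       (rule Lim_transform_eventually[OF lim1], use gen in eventually_elim, simp add: integral_Sigma_initial[OF _ v \<delta>_pos])
  have b0: "\<bar>?L0 p\<bar> \<le> 2 / \<delta> * N\<^sup>2" if "p \<in> ocyl" for p
  proof -
    have "(amplitude e p * pd et K p)\<^sup>2 \<le> N\<^sup>2"
      using limit_density_bounds(1)[OF N e that] by (simp add: abs_le_square_iff[symmetric])
    then show ?thesis using \<delta>_pos by (auto intro!: divide_right_mono)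
  qed
  have b1: "\<bar>?L1 p\<bar> \<le> \<delta> * (25 * N\<^sup>2)" if "p \<in> ocyl" for p
  proof -
    have "(norm (angular_gradient K e p))\<^sup>2 \<le> (5 * N)\<^sup>2"
      using limit_density_bounds(2)[OF N e that] by (intro power_mono) auto
    then show ?thesis using \<delta>_pos by (auto simp: abs_mult power_mult_distrib)
  qed
  have "\<bar>cyl_integral \<delta> v ?L0\<bar> \<le> 2 / \<delta> * N\<^sup>2 * (2 * pi\<^sup>2) * v" by (rule cyl_integral_bound[OF \<delta>_pos v' L0 b0])
  \<comment> \<open>v \<le> \<delta> absorbs the 1/\<delta> of the density. The resulting 4 pi^2 N^2
    is enlarged so that one constant serves both energies.\<close>
  also have "\<dots> \<le> 2 / \<delta> * N\<^sup>2 * (2 * pi\<^sup>2) * \<delta>" using v' \<delta>_pos by (intro mult_left_mono) auto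
  also have "\<dots> \<le> 50 * pi\<^sup>2 * N\<^sup>2" using \<delta>_pos by simp
  finally have B0: "\<bar>cyl_integral \<delta> v ?L0\<bar> \<le> 50 * pi\<^sup>2 * N\<^sup>2" .
  have "\<bar>cyl_integral \<delta> v ?L1\<bar> \<le> \<delta> * (25 * N\<^sup>2) * (2 * pi\<^sup>2) * v" by (rule cyl_integral_bound[OF \<delta>_pos v' L1 b1])
  \<comment> \<open>One factor \<delta> comes from the density, the other from the length v \<le>
    \<delta>.\<close>
  also have "\<dots> \<le> \<delta> * (25 * N\<^sup>2) * (2 * pi\<^sup>2) * \<delta>" using v' \<delta>_pos by (intro mult_left_mono) auto
  also have "\<dots> = 50 * pi\<^sup>2 * N\<^sup>2 * \<delta>\<^sup>2" by (simp add: power2_eq_square)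
  finally show ?thesis using lims B0 by blast
qed

lemma powr_three_halves:
  assumes "\<delta> > 0" shows "\<delta> powr (3/2) = sqrt \<delta> ^ 3"
proof -
  have "\<delta> powr (3/2) = (\<delta> powr (1/2)) powr 3" unfolding powr_powr by simp
  then show ?thesis using assms by (simp add: powr_half_sqrt powr_numeral)
qed

text \<open>On the closed shell |\<phi>_t| is at most \<open>sqrt \<delta> / r0 * N\<close>, so
  \<open>large\<close> keeps the coefficient of the second time derivative positive even for
  negative G.\<close>

lemma pulse_sliceI:
  assumes \<delta>: "\<delta> > 0" and r0: "r0 > 0"
    and sp: "short_pulse_solution G \<delta> r0 \<phi>0 \<phi>1 \<phi>" and nr: "no_outgoing_radiation G A B \<delta> r0 \<phi>0 \<phi>1 \<phi>2 \<phi>"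
    and opt: "optical G \<phi> u \<delta> r0"
    and K: "Cinf_on K cyl" "homog 0 cyl K" "\<And>s x. s \<in> {0..1} \<Longrightarrow> x \<noteq> 0 \<Longrightarrow> K (s, x) = \<phi>1 (s, x /\<^sub>R norm x)"
    and bd: "\<And>p. p \<in> ccyl \<Longrightarrow> \<bar>K p\<bar> \<le> N" and large: "3 * \<bar>G\<bar> * (sqrt \<delta> / r0 * N)\<^sup>2 < 1"
  shows "\<exists>W V. pulse_slice G \<phi> u W V r0 \<delta> (hom0 \<phi>0) K"
proof -
  obtain W where W: "open W" "{-r0} \<times> cball 0 (r0 + \<delta>) \<subseteq> W" "Cinf_on \<phi> W" "solves_wave_eq G \<phi> W"
    using sp unfolding short_pulse_solution_def by blast
  obtain V where V: "open V" "{-r0} \<times> (cball 0 (r0 + \<delta>) - ball 0 r0) \<subseteq> V" "Cinf_on u V"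
    "\<forall>p\<in>V. ginv G \<phi> u u p = 0 \<and> pd et u p > 0" "\<forall>x. (-r0, x) \<in> V \<longrightarrow> u (-r0, x) = norm x - r0"
    using opt unfolding optical_def by blast
  have pw: "\<delta> powr (3/2) = sqrt \<delta> ^ 3" "\<delta> powr (1/2) = sqrt \<delta>"
    using \<delta> by (simp_all add: powr_three_halves powr_half_sqrt)
  have s: "(norm x - r0) / \<delta> \<in> {0..1}" "x \<noteq> 0" if "r0 \<le> norm x" "norm x \<le> r0 + \<delta>" for x :: "real^3"
    using that \<delta> r0 by (auto simp: divide_simps)
  have t: "pd et \<phi> (- r0, x) = sqrt \<delta> / r0 * K ((norm x - r0) / \<delta>, x)" if "r0 \<le> norm x" "norm x \<le> r0 + \<delta>" for x
    using sp that K(3)[OF s[OF that]] unfolding short_pulse_solution_def pw by metis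
  have hyp: "1 + 3 * G * (pd et \<phi> (- r0, x))\<^sup>2 > 0" if x: "r0 \<le> norm x" "norm x \<le> r0 + \<delta>" for x
  proof -
    have "K ((norm x - r0) / \<delta>, x) = K ((norm x - r0) / \<delta>, x /\<^sub>R norm x)"
      using K(3) s[OF x] by simp
    moreover have "\<bar>K ((norm x - r0) / \<delta>, x /\<^sub>R norm x)\<bar> \<le> N"
      by (rule bd) (use s[OF x] in \<open>auto simp: ccyl_def\<close>)
    ultimately have "\<bar>pd et \<phi> (- r0, x)\<bar> \<le> sqrt \<delta> / r0 * N"
      unfolding t[OF x] using r0 \<delta> by (auto simp: abs_mult intro!: divide_right_mono mult_left_mono)
    then have "(pd et \<phi> (- r0, x))\<^sup>2 \<le> (sqrt \<delta> / r0 * N)\<^sup>2"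
      by (metis abs_ge_zero power2_abs power_mono)
    then have "3 * \<bar>G\<bar> * (pd et \<phi> (- r0, x))\<^sup>2 \<le> 3 * \<bar>G\<bar> * (sqrt \<delta> / r0 * N)\<^sup>2"
      by (intro mult_left_mono) auto
    then have "\<bar>3 * G * (pd et \<phi> (- r0, x))\<^sup>2\<bar> < 1" using large by (simp add: abs_mult)
    then show ?thesis by linarith
  qed
  have "pulse_slice G \<phi> u W V r0 \<delta> (hom0 \<phi>0) K"
  proof
    show "Cinf_on (hom0 \<phi>0) cyl" using nr Cinf_cyl_hom0 by (simp add: no_outgoing_radiation_def)
    show "\<phi> (- r0, x) = sqrt \<delta> ^ 3 / r0 * hom0 \<phi>0 ((norm x - r0) / \<delta>, x)" if "r0 < norm x" "norm x < r0 + \<delta>" for x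
      using sp that unfolding short_pulse_solution_def pw hom0_def by simp
  qed (use W V \<delta> r0 K t hyp homog_hom0_cyl in auto)
  then show ?thesis by blast
qed

theorem proposition5p2:
  fixes \<phi>1 \<phi>2 :: "real \<times> (real^3) \<Rightarrow> real"
  assumes "seed_data \<phi>1" and "seed_data \<phi>2"
  shows "\<exists>C::real. \<forall>(G::real) (A::real) (B :: nat \<Rightarrow> (nat \<Rightarrow> ereal) \<Rightarrow> (nat \<Rightarrow> ereal) \<Rightarrow> real) (\<delta>::real)
      (\<phi>0 :: real \<Rightarrow> real \<times> (real^3) \<Rightarrow> real)
      (\<phi> :: real \<Rightarrow> spacetime \<Rightarrow> real) (u :: real \<Rightarrow> spacetime \<Rightarrow> real)
      (\<Gamma> :: real \<Rightarrow> real \<Rightarrow> real \<Rightarrow> real^3 \<Rightarrow> real^3).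
    G \<noteq> 0 \<longrightarrow> \<delta> > 0 \<longrightarrow>
    (\<forall>\<^sub>F r0 in at_top.
       short_pulse_solution G \<delta> r0 (\<phi>0 r0) \<phi>1 (\<phi> r0) \<and>
       no_outgoing_radiation G A B \<delta> r0 (\<phi>0 r0) \<phi>1 \<phi>2 (\<phi> r0) \<and>
       optical G (\<phi> r0) (u r0) \<delta> r0 \<and>
       generators G (\<phi> r0) (u r0) \<delta> r0 (\<Gamma> r0)) \<longrightarrow>
    (\<forall>e \<in> insert et (range ex). \<forall>v \<in> {0..\<delta>}.
       \<exists>l0 l1.
         ((\<lambda>r0. energy0 G (\<phi> r0) (u r0) (\<Gamma> r0) (pd e (\<phi> r0)) (-r0) v) \<longlongrightarrow> l0) at_top \<and>
         ((\<lambda>r0. energy1 G (\<phi> r0) (u r0) (\<Gamma> r0) (pd e (\<phi> r0)) (-r0) v) \<longlongrightarrow> l1) at_top \<and>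
         \<bar>l0\<bar> \<le> C \<and> \<bar>l1\<bar> \<le> C * \<delta>\<^sup>2)"
proof -
  obtain F W where F: "open W" "{0..1} \<times> sphere 0 1 \<subseteq> W" "Cinf_on F W" "\<forall>p\<in>{0..1} \<times> sphere 0 1. F p = \<phi>1 p"
    using assms(1) unfolding seed_data_def Cinf_cyl_def by blast
  \<comment> \<open>\<open>K\<close> is built from the extension \<open>F\<close> and not from
    \<phi>1, whose values off the cylinder are arbitrary; thus it is smooth near the closed
    cylinder.\<close>
  define K where "K = hom0 F"
  have sub: "ccyl \<subseteq> cone W" "cyl \<subseteq> cone W" using F(2) by (fastforce simp: ccyl_def cyl_def cone_def)+
  have KW: "Cinf_on K (cone W)" unfolding K_def using Cinf_on_hom0 F by blast
  have K: "Cinf_on K cyl" "homog 0 cyl K" using KW sub(2) Cinf_on_subset homog_hom0_cyl by (auto simp: K_def)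
  have K\<phi>1: "K (s, x) = \<phi>1 (s, x /\<^sub>R norm x)" if "s \<in> {0..1}" "x \<noteq> 0" for s x
    using F(4) that by (simp add: K_def hom0_def)
  \<comment> \<open>\<open>N\<close> is fixed before G, A, B and \<delta> are introduced, so the
    final constant depends on \<phi>1 only.\<close>
  obtain N where N: "bounded_C3 N K" using bounded_C3_compact[OF KW sub(1)] by blast
  have Kc: "continuous_on ccyl K" using Cinf_on_continuous[OF KW] continuous_on_subset sub(1) by blast
  have KN: "\<bar>K p\<bar> \<le> N" if "p \<in> ccyl" for p using ccyl_bound[OF Kc bounded_C3D(1)[OF N] that] .
  show ?thesis
  proof (rule exI[of _ "50 * pi\<^sup>2 * N\<^sup>2"], intro allI impI ballI, goal_cases)
    case (1 G A B \<delta> \<phi>0 \<phi> u \<Gamma> e v)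
    note \<delta> = \<open>\<delta> > 0\<close> and ev = 1(3)
    \<comment> \<open>This bound on \<phi>0 depends on B; it is used for the convergence and does
      not enter the bounds on the limits.\<close>
    define b where "b = B 3 (\<lambda>j. Ck_norm j \<phi>1) (\<lambda>j. Ck_norm j \<phi>2)"
    note pw = powr_three_halves[OF \<delta>]
    have "((\<lambda>x. 3 * \<bar>G\<bar> * (sqrt \<delta> / x * N)\<^sup>2) \<longlongrightarrow> 3 * \<bar>G\<bar> * (0 * N)\<^sup>2) at_top"
      by (intro tendsto_intros tendsto_divide_0[OF tendsto_const] filterlim_at_top_imp_at_infinity filterlim_ident)
    then have large: "\<forall>\<^sub>F x in at_top. 3 * \<bar>G\<bar> * (sqrt \<delta> / x * N)\<^sup>2 < 1"
      by (rule order_tendstoD) simp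
    interpret pulse_family G A \<delta> "max N b" \<phi> u "\<lambda>x. hom0 (\<phi>0 x)" K
    proof
      show "bounded_C3 (max N b) K" using bounded_C3_mono[OF N] by simp
      show "\<forall>\<^sub>F x in at_top. (\<exists>W V. pulse_slice G (\<phi> x) (u x) W V x \<delta> (hom0 (\<phi>0 x)) K) \<and> bounded_C3 (max N b) (hom0 (\<phi>0 x)) \<and>
        (\<forall>p\<in>ocyl. \<bar>ingoing G (\<phi> x) (\<phi> x) (slice_pt \<delta> x p)\<bar> \<le> A * sqrt \<delta> ^ 3 / x\<^sup>2 \<and>
           \<bar>ingoing G (\<phi> x) (ingoing G (\<phi> x) (\<phi> x)) (slice_pt \<delta> x p)\<bar> \<le> A * sqrt \<delta> ^ 3 / x ^ 3)"
        using ev large eventually_gt_at_top[of 0]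
      proof eventually_elim
        case (elim x)
        then have sp: "short_pulse_solution G \<delta> x (\<phi>0 x) \<phi>1 (\<phi> x)" and nr: "no_outgoing_radiation G A B \<delta> x (\<phi>0 x) \<phi>1 \<phi>2 (\<phi> x)"
          and opt: "optical G (\<phi> x) (u x) \<delta> x" by blast+
        have "\<exists>W V. pulse_slice G (\<phi> x) (u x) W V x \<delta> (hom0 (\<phi>0 x)) K"
          by (rule pulse_sliceI[OF \<delta> elim(3) sp nr opt K K\<phi>1 KN elim(2)])
        moreover have "Ck_norm 3 (\<phi>0 x) \<le> ereal b" using nr unfolding no_outgoing_radiation_def b_def by blast
        then have "bounded_C3 (max N b) (hom0 (\<phi>0 x))" using bounded_C3_mono[OF bounded_C3_Ck_norm] by simp
        moreover have "\<bar>ingoing G (\<phi> x) (\<phi> x) (slice_pt \<delta> x p)\<bar> \<le> A * sqrt \<delta> ^ 3 / x\<^sup>2 \<and>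
           \<bar>ingoing G (\<phi> x) (ingoing G (\<phi> x) (\<phi> x)) (slice_pt \<delta> x p)\<bar> \<le> A * sqrt \<delta> ^ 3 / x ^ 3" if p: "p \<in> ocyl" for p
        proof -
          have "norm ((x + \<delta> * fst p) *\<^sub>R snd p) = x + \<delta> * fst p" "0 \<le> \<delta> * fst p" "\<delta> * fst p \<le> \<delta> * 1"
            using p \<delta> elim(3) by (auto simp: ocyl_def abs_mult intro!: mult_left_mono)
          then have "x \<le> norm ((x + \<delta> * fst p) *\<^sub>R snd p)" "norm ((x + \<delta> * fst p) *\<^sub>R snd p) \<le> x + \<delta>" by auto
          then show ?thesis using nr unfolding no_outgoing_radiation_def slice_pt_def pw by blast
        qed
        ultimately show ?case by blast
      qed
    qed (use \<delta> K in auto)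
    have gen: "\<forall>\<^sub>F x in at_top. generators G (\<phi> x) (u x) \<delta> x (\<Gamma> x)" using ev by eventually_elim blast
    have "e \<in> Basis" using 1(4) by (simp add: Basis_spacetime)
    from energies_converge[OF KW sub(1) N gen this 1(5)] show ?case .
  qed
qed

end
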